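(* Let $R$ be a local principal ideal ring of length two with residue field $k$, let $p\in k[t]$ be monic irreducible, and let $A=C_{p^{\lambda_1}}\oplus\dots\oplus C_{p^{\lambda_l}}\in M_n(k)$ (with $\lambda_1\ge\dots\ge\lambda_l\ge1$) be a $p$-primary matrix in rational normal form. For each $\xi\in\mathrm{Ext}^1_{k[t]}(M^A,M^A)$, the matrix $\mathbf A_\xi\in M_n(R)$ is similar to its transpose if and only if $E(\xi)$ lies in the same $G_A$-orbit as its transpose $E(\xi)^T$.
   Context: $(\pi)$ is the maximal ideal of $R$. $C_f$ denotes the companion matrix of a monic polynomial $f$: the matrix of multiplication by $t$ on $k[t]/f$ (or $R[t]/f$) in the basis $1,t,\dots,t^{\deg f-1}$. $M^A$ is the $k[t]$-module $k^n$ with $t$ acting by $A$, so $M^A=k[t]/p^{\lambda_1}\oplus\dots\oplus k[t]/p^{\lambda_l}$, with generators $e_1,\dots,e_l$ (the images of $1$ in the summands); it is also an $R[t]$-module via $R[t]\to k[t]$. Two matrices in $M_n(R)$ are similar if conjugate under $\mathrm{GL}_n(R)$. Matrix of an extension: for a class $\xi$ of $0\to M^A\xrightarrow{i}M\xrightarrow{q}M^A\to0$ in $\mathrm{Ext}^1_{k[t]}(M^A,M^A)$, choose $\tilde f_j\in M$ with $q(\tilde f_j)=e_j$ and write $p^{\lambda_j}\tilde f_j=\sum_i\epsilon_{ij}\,i(e_i)$ with $\epsilon_{ij}\in k[t]$. Then $E(\xi)=(\epsilon_{ij})$, where $\epsilon_{ij}$ is well defined modulo $p^{\min(\lambda_i,\lambda_j)}$.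 The map $\xi\mapsto E(\xi)$ identifies $\mathrm{Ext}^1_{k[t]}(M^A,M^A)$ with the set of $l\times l$ matrices whose $(i,j)$ entry lies in $k[t]/p^{\min(\lambda_i,\lambda_j)}$; this set is stable under transposition. $G_A=\mathrm{Aut}_{k[t]}(M^A)$ acts on $\mathrm{Ext}^1_{k[t]}(M^A,M^A)$: for classes $\xi$, $\xi'$ of $0\to M^A\xrightarrow{i}M\xrightarrow{q}M^A\to0$ and $0\to M^A\xrightarrow{i'}M'\xrightarrow{q'}M^A\to0$, one has $\xi'={}^g\xi$ iff there is a homomorphism $\phi:M\to M'$ with $\phi i=i'g$ and $q'\phi=gq$. The matrix $\mathbf A_\xi$: let $\mathbf p\in R[t]$ be a monic lift of $p$ and $\mathbf A_0=C_{\mathbf p^{\lambda_1}}\oplus\dots\oplus C_{\mathbf p^{\lambda_l}}$. $\xi_{\mathbf A_0}\in\mathrm{Ext}^1_{R[t]}(M^A,M^A)$ is the class of $0\to M^A\xrightarrow{\pi}M^{\mathbf A_0}\to M^A\to0$, where $M^{\mathbf A_0}$ is $R^n$ with $t$ acting by $\mathbf A_0$, the first map is $x\mapsto\pi\tilde x$ for any lift $\tilde x$ of $x$, and the second is reduction. Let $\iota:\mathrm{Ext}^1_{k[t]}(M^A,M^A)\to \mathrm{Ext}^1_{R[t]}(M^A,M^A)$ be the natural map. Take an extension of $R[t]$-modules $0\to M^A\to E\to M^A\to0$ in the class $\iota(\xi)+\xi_{\mathbf A_0}$; $E$ is free of rank $n$ over $R$ and $\mathbf A_\xi$ is the matrix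 of multiplication by $t$ on $E$ in any $R$-basis lifting the standard basis of $M^A$ (defined up to conjugation by $\ker(\mathrm{GL}_n(R)\to\mathrm{GL}_n(k))$). *)

theory Defs
  imports "Jordan_Normal_Form.VS_Connect" "HOL-Algebra.Ideal"
begin

section \<open>Local principal ideal rings of finite length\<close>

definition local_ring :: "'a ring \<Rightarrow> bool" where
  "local_ring R \<longleftrightarrow> cring R \<and> (\<exists>!m. maximalideal m R)"

definition principal_ideal_ring :: "'a ring \<Rightarrow> bool" where
  "principal_ideal_ring R \<longleftrightarrow> cring R \<and> (\<forall>I. ideal I R \<longrightarrow> principalideal I R)"

definition ideal_chain :: "'a ring \<Rightarrow> (nat \<Rightarrow> 'a set) \<Rightarrow> nat \<Rightarrow> bool" where
  "ideal_chain R I n \<longleftrightarrow> (\<forall>j\<le>n. ideal (I j) R) \<and> (\<forall>j<n. I j \<subset> I (Suc j))"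

definition has_length :: "'a ring \<Rightarrow> nat \<Rightarrow> bool" where
  "has_length R n \<longleftrightarrow> (\<exists>I. ideal_chain R I n) \<and> \<not> (\<exists>I. ideal_chain R I (Suc n))"

section \<open>Module extensions\<close>

text \<open>\<open>0 \<rightarrow> N \<rightarrow> middle \<rightarrow> Q \<rightarrow> 0\<close>, with maps \<open>incl\<close> and \<open>proj\<close>.\<close>

record ('s, 'n, 'm, 'q) extension =
  middle :: "('s, 'm) module"
  incl :: "'n \<Rightarrow> 'm"
  proj :: "'m \<Rightarrow> 'q"

definition is_extension ::
  "'s ring \<Rightarrow> ('s, 'n) module \<Rightarrow> ('s, 'q) module \<Rightarrow> ('s, 'n, 'm, 'q) extension \<Rightarrow> bool" where
  "is_extension S N Q X \<longleftrightarrow>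
     module S N \<and> module S Q \<and> module S (middle X) \<and>
     incl X \<in> LinearCombinations.module_hom S N (middle X) \<and>
     proj X \<in> LinearCombinations.module_hom S (middle X) Q \<and>
     inj_on (incl X) (carrier N) \<and>
     proj X ` carrier (middle X) = carrier Q \<and>
     incl X ` carrier N = a_kernel (middle X) Q (proj X)"

text \<open>A homomorphism of extensions inducing the identity on both ends is automatically an
  isomorphism, so between extensions of the same modules this is an equivalence relation.\<close>

definition ext_equiv ::
  "'s ring \<Rightarrow> ('s, 'n) module \<Rightarrow> ('s, 'n, 'm, 'q) extension \<Rightarrow> ('s, 'n, 'm2, 'q) extension \<Rightarrow> bool"
  where
  "ext_equiv S N X Y \<longleftrightarrow> (\<exists>\<phi> \<in> LinearCombinations.module_hom S (middle X) (middle Y).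
     (\<forall>a\<in>carrier N. \<phi> (incl X a) = incl Y a) \<and>
     (\<forall>m\<in>carrier (middle X). proj Y (\<phi> m) = proj X m))"

text \<open>The middle term of an extension of \<open>Q\<close> by \<open>N\<close> is in bijection with \<open>N \<times> Q\<close> as a set, so
  every extension, whatever its carrier type, is equivalent to one whose middle term has
  elements of type \<open>'n \<times> 'q\<close> (with an arbitrary module structure). Classes are therefore
  formed inside that type, which makes the set of all classes available in HOL.\<close>

type_synonym ('s, 'n, 'q) ext_class = "('s, 'n, 'n \<times> 'q, 'q) extension set"

definition ext_class_of ::
  "'s ring \<Rightarrow> ('s, 'n) module \<Rightarrow> ('s, 'q) module \<Rightarrow> ('s, 'n, 'm, 'q) extension \<Rightarrow> ('s, 'n, 'q) ext_class"
  where
  "ext_class_of S N Q X = {Y. is_extension S N Q Y \<and> ext_equiv S N X Y}"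

definition Ext1 ::
  "'s ring \<Rightarrow> ('s, 'n) module \<Rightarrow> ('s, 'q) module \<Rightarrow> ('s, 'n, 'q) ext_class set" where
  "Ext1 S N Q = {ext_class_of S N Q X | X :: ('s, 'n, 'n \<times> 'q, 'q) extension. is_extension S N Q X}"

definition quotient_module :: "('s, 'm) module \<Rightarrow> 'm set \<Rightarrow> ('s, 'm set) module" where
  "quotient_module M H = \<lparr>
     carrier = a_rcosets\<^bsub>M\<^esub> H,
     mult = undefined,
     one = undefined,
     zero = H,
     add = set_add M,
     smult = (\<lambda>r C. \<Union>x\<in>C. H +>\<^bsub>M\<^esub> (r \<odot>\<^bsub>M\<^esub> x))\<rparr>"

text \<open>Baer sum: the fibre product over \<open>Q\<close> modulo the antidiagonal copy of \<open>N\<close>.\<close>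

definition fibre_product ::
  "('s, 'n, 'm, 'q) extension \<Rightarrow> ('s, 'n, 'm2, 'q) extension \<Rightarrow> ('s, 'm \<times> 'm2) module" where
  "fibre_product X Y = (direct_sum (middle X) (middle Y))
     \<lparr>carrier := {(x, y). x \<in> carrier (middle X) \<and> y \<in> carrier (middle Y) \<and> proj X x = proj Y y}\<rparr>"

definition antidiagonal ::
  "('s, 'n) module \<Rightarrow> ('s, 'n, 'm, 'q) extension \<Rightarrow> ('s, 'n, 'm2, 'q) extension \<Rightarrow> ('m \<times> 'm2) set" where
  "antidiagonal N X Y = (\<lambda>a. (incl X a, \<ominus>\<^bsub>middle Y\<^esub> incl Y a)) ` carrier N"

definition baer_sum ::
  "('s, 'n) module \<Rightarrow> ('s, 'n, 'm, 'q) extension \<Rightarrow> ('s, 'n, 'm2, 'q) extension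
    \<Rightarrow> ('s, 'n, ('m \<times> 'm2) set, 'q) extension" where
  "baer_sum N X Y = \<lparr>
     middle = quotient_module (fibre_product X Y) (antidiagonal N X Y),
     incl = (\<lambda>a. antidiagonal N X Y +>\<^bsub>fibre_product X Y\<^esub> (incl X a, \<zero>\<^bsub>middle Y\<^esub>)),
     proj = (\<lambda>C. the_elem ((\<lambda>z. proj X (fst z)) ` C))\<rparr>"

definition ext_add ::
  "'s ring \<Rightarrow> ('s, 'n) module \<Rightarrow> ('s, 'q) module
    \<Rightarrow> ('s, 'n, 'q) ext_class \<Rightarrow> ('s, 'n, 'q) ext_class \<Rightarrow> ('s, 'n, 'q) ext_class" where
  "ext_add S N Q \<xi> \<eta> = (\<Union>X\<in>\<xi>. \<Union>Y\<in>\<eta>. ext_class_of S N Q (baer_sum N X Y))"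

definition restrict_scalars :: "('t \<Rightarrow> 's) \<Rightarrow> ('s, 'm) module \<Rightarrow> ('t, 'm) module" where
  "restrict_scalars h M = \<lparr>
     carrier = carrier M, mult = mult M, one = one M, zero = zero M, add = add M,
     smult = (\<lambda>r. smult M (h r))\<rparr>"

definition restrict_extension ::
  "('t \<Rightarrow> 's) \<Rightarrow> ('s, 'n, 'm, 'q) extension \<Rightarrow> ('t, 'n, 'm, 'q) extension" where
  "restrict_extension h X =
     \<lparr>middle = restrict_scalars h (middle X), incl = incl X, proj = proj X\<rparr>"

text \<open>The natural map on \<open>Ext1\<close> induced by restriction of scalars along \<open>h : T \<rightarrow> S\<close>.\<close>

definition ext_restrict ::
  "'t ring \<Rightarrow> ('t \<Rightarrow> 's) \<Rightarrow> ('s, 'n) module \<Rightarrow> ('s, 'q) module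
    \<Rightarrow> ('s, 'n, 'q) ext_class \<Rightarrow> ('t, 'n, 'q) ext_class" where
  "ext_restrict T h N Q \<xi> =
     (\<Union>X\<in>\<xi>. ext_class_of T (restrict_scalars h N) (restrict_scalars h Q) (restrict_extension h X))"

definition module_aut :: "'s ring \<Rightarrow> ('s, 'm) module \<Rightarrow> ('m \<Rightarrow> 'm) set" where
  "module_aut S M = {g \<in> LinearCombinations.module_hom S M M. bij_betw g (carrier M) (carrier M)}"

text \<open>The class \<open>\<^sup>g\<xi>\<close>: automorphisms act on both ends simultaneously.\<close>

definition ext_act ::
  "'s ring \<Rightarrow> ('s, 'n) module \<Rightarrow> ('n \<Rightarrow> 'n) \<Rightarrow> ('s, 'n, 'n) ext_class \<Rightarrow> ('s, 'n, 'n) ext_class" where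
  "ext_act S N g \<xi> = {X'. is_extension S N N X' \<and>
     (\<exists>X\<in>\<xi>. \<exists>\<phi> \<in> LinearCombinations.module_hom S (middle X) (middle X').
        (\<forall>a\<in>carrier N. \<phi> (incl X a) = incl X' (g a)) \<and>
        (\<forall>m\<in>carrier (middle X). proj X' (\<phi> m) = g (proj X m)))}"

section \<open>Matrices and polynomial modules\<close>

text \<open>For monic \<open>f\<close> of degree \<open>d\<close>: column \<open>j\<close> holds the coordinates of \<open>t * t^j\<close> modulo \<open>f\<close> in the
  basis \<open>1, t, \<dots>, t^(d-1)\<close>; in the last column \<open>t^d = - (\<Sum>i<d. coeff f i * t^i)\<close>.\<close>

definition companion_mat :: "'a :: comm_ring_1 poly \<Rightarrow> 'a mat" where
  "companion_mat f = (let d = degree f in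
     mat d d (\<lambda>(i, j). if Suc j < d then (if i = Suc j then 1 else 0) else - coeff f i))"

definition primary_mat :: "'a :: comm_ring_1 poly \<Rightarrow> nat list \<Rightarrow> 'a mat" where
  "primary_mat f lams = diag_block_mat (map (\<lambda>k. companion_mat (f ^ k)) lams)"

text \<open>Column vectors with the variable of the polynomial ring acting by a square matrix.\<close>

definition mat_module :: "'a :: comm_ring_1 mat \<Rightarrow> ('a poly, 'a vec) module" where
  "mat_module A = \<lparr>
     carrier = carrier_vec (dim_row A),
     mult = undefined,
     one = undefined,
     zero = 0\<^sub>v (dim_row A),
     add = (+),
     smult = (\<lambda>f v. vec (dim_row A) (\<lambda>r. \<Sum>i\<le>degree f. coeff f i * ((A ^\<^sub>m i *\<^sub>v v) $ r)))\<rparr>"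

text \<open>\<open>M\<^sup>A\<close> for \<open>A = primary_mat p lams\<close>, and \<open>G\<^sub>A\<close>.\<close>

definition M_A :: "'k :: field poly \<Rightarrow> nat list \<Rightarrow> ('k poly, 'k vec) module" where
  "M_A p lams = mat_module (primary_mat p lams)"

definition G_A :: "'k :: field poly \<Rightarrow> nat list \<Rightarrow> ('k vec \<Rightarrow> 'k vec) set" where
  "G_A p lams = module_aut class_ring (M_A p lams)"

text \<open>The generator of the \<open>i\<close>-th summand (the image of \<open>1\<close>) is the first basis vector of the
  \<open>i\<close>-th diagonal block; summands are numbered from \<open>0\<close>.\<close>

definition gen_A :: "'k :: field poly \<Rightarrow> nat list \<Rightarrow> nat \<Rightarrow> 'k vec" where
  "gen_A p lams i =
     unit_vec (dim_row (primary_mat p lams)) (\<Sum>j<i. degree (p ^ (lams ! j)))"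

text \<open>\<open>E(\<xi>)\<close>. Its \<open>(i, j)\<close> entry, a residue class modulo \<open>p ^ min (lams ! i) (lams ! j)\<close>, is
  represented by its unique reduced representative; \<open>ft j\<close> is the chosen lift of the \<open>j\<close>-th
  generator. The result does not depend on the choices.\<close>

definition ext_matrix ::
  "'k :: field poly \<Rightarrow> nat list \<Rightarrow> ('k poly, 'k vec, 'k vec) ext_class \<Rightarrow> 'k poly mat" where
  "ext_matrix p lams \<xi> = (THE E. \<exists>X\<in>\<xi>. \<exists>ft \<epsilon>.
     (\<forall>j<length lams. ft j \<in> carrier (middle X) \<and> proj X (ft j) = gen_A p lams j \<and>
        p ^ (lams ! j) \<odot>\<^bsub>middle X\<^esub> ft j =
          (\<Oplus>\<^bsub>middle X\<^esub>i\<in>{..<length lams}. \<epsilon> i j \<odot>\<^bsub>middle X\<^esub> incl X (gen_A p lams i))) \<and>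
     E = mat (length lams) (length lams)
           (\<lambda>(i, j). \<epsilon> i j mod p ^ min (lams ! i) (lams ! j)))"

section \<open>The matrices attached to an extension class\<close>

text \<open>In the following, \<open>red : R \<rightarrow> k\<close> is the residue map, \<open>\<pi>\<close> generates its kernel, and \<open>P\<close> is a
  monic lift of \<open>p\<close>. In \<open>xi_A0\<close>, \<open>inv_into UNIV red\<close> is an arbitrary section of \<open>red\<close>: since
  \<open>\<pi>\<^sup>2 = 0\<close>, the element \<open>\<pi> * r\<close> depends only on \<open>red r\<close>.\<close>

definition M_A_lifted ::
  "('r :: comm_ring_1 \<Rightarrow> 'k :: field) \<Rightarrow> 'k poly \<Rightarrow> nat list \<Rightarrow> ('r poly, 'k vec) module" where
  "M_A_lifted red p lams = restrict_scalars (map_poly red) (M_A p lams)"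

definition xi_A0 ::
  "('r :: comm_ring_1 \<Rightarrow> 'k :: field) \<Rightarrow> 'r \<Rightarrow> 'k poly \<Rightarrow> 'r poly \<Rightarrow> nat list
    \<Rightarrow> ('r poly, 'k vec, 'k vec) ext_class" where
  "xi_A0 red \<pi> p P lams =
     ext_class_of class_ring (M_A_lifted red p lams) (M_A_lifted red p lams)
       \<lparr>middle = mat_module (primary_mat P lams),
        incl = (\<lambda>x. \<pi> \<cdot>\<^sub>v map_vec (inv_into UNIV red) x),
        proj = map_vec red\<rparr>"

text \<open>\<open>b 0, \<dots>, b (n - 1)\<close> is a basis over \<open>R\<close>, the coefficient ring of \<open>R[t]\<close>.\<close>

definition is_coeff_basis ::
  "('r :: comm_ring_1 poly, 'm) module \<Rightarrow> nat \<Rightarrow> (nat \<Rightarrow> 'm) \<Rightarrow> bool" where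
  "is_coeff_basis M n b \<longleftrightarrow> (\<forall>j<n. b j \<in> carrier M) \<and>
     (\<forall>x\<in>carrier M. \<exists>!c. c \<in> carrier_vec n \<and> x = (\<Oplus>\<^bsub>M\<^esub>j\<in>{..<n}. [:c $ j:] \<odot>\<^bsub>M\<^esub> b j))"

text \<open>All matrices that may serve as \<open>\<^bold>A\<^sub>\<xi>\<close>, for all choices of an extension in the class
  \<open>\<iota>(\<xi>) + \<xi>\<^sub>A\<^sub>0\<close> and of a basis lifting the standard basis.\<close>

definition A_xi ::
  "('r :: comm_ring_1 \<Rightarrow> 'k :: field) \<Rightarrow> 'r \<Rightarrow> 'k poly \<Rightarrow> 'r poly \<Rightarrow> nat list
    \<Rightarrow> ('k poly, 'k vec, 'k vec) ext_class \<Rightarrow> 'r mat set" where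
  "A_xi red \<pi> p P lams \<xi> =
    (let n = dim_row (primary_mat p lams); L = M_A_lifted red p lams in
     {B \<in> carrier_mat n n.
       \<exists>X \<in> ext_add class_ring L L
              (ext_restrict class_ring (map_poly red) (M_A p lams) (M_A p lams) \<xi>)
              (xi_A0 red \<pi> p P lams).
       \<exists>b. is_coeff_basis (middle X) n b \<and>
           (\<forall>j<n. proj X (b j) = unit_vec n j) \<and>
           (\<forall>j<n. monom 1 1 \<odot>\<^bsub>middle X\<^esub> b j =
              (\<Oplus>\<^bsub>middle X\<^esub>i\<in>{..<n}. [:B $$ (i, j):] \<odot>\<^bsub>middle X\<^esub> b i))})"

end

theory Submission
  imports Defs "HOL-Number_Theory.Cong" "Jordan_Normal_Form.Char_Poly"
begin

text \<open>
  Write \<open>f\<^sub>i = p ^ \<lambda>\<^sub>i\<close>, so that \<open>M\<^sup>A = \<Oplus> k[t]/(f\<^sub>i)\<close>. Choosing a \<open>k\<close>-linear section \<open>s\<close> of an extension of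
  \<open>M\<^sup>A\<close> by itself, one has \<open>t s = s A + D\<close> for a matrix \<open>D\<close>, and \<open>D\<close> modulo commutators
  \<open>A V - V A\<close> depends only on the class \<open>\<xi>\<close>. Adding the class of \<open>A0\<close> and passing to a lifted basis shows
  that \<open>A\<^sub>\<xi> = A0 + \<pi> K\<close>, where \<open>K\<close> reduces to \<open>D\<close> up to a commutator (\<open>matrix_of_basis\<close>,
  \<open>A_xi_form\<close>). The theorem thus compares two operations on \<open>D\<close>: transposing \<open>A0 + \<pi> D\<close> and
  transposing \<open>E(\<xi>)\<close>.

  They are linked by the block diagonal symmetric Hankel matrix \<open>T\<close> with \<open>A T = T A\<^sup>T\<close>
  (\<open>companion_hankel_symmetric\<close>), which lifts to such a matrix for \<open>A0\<close> over \<open>R\<close>. On the one hand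
  \<open>(A0 + \<pi> D)\<^sup>T\<close> is conjugate by \<open>T\<close> to \<open>A0 + \<pi> D'\<close> with \<open>D' T = (D T)\<^sup>T\<close>. On the other hand the
  columns of \<open>T\<close> are the Horner polynomials of the \<open>f\<^sub>j\<close> applied to the generators, and pushing \<open>f\<^sub>j\<close> past
  the section shows that the entry \<open>(i, j)\<close> of \<open>E(\<xi>)\<close> is the contraction
  \<open>\<Sum> (D T)\<^sub>a\<^sub>b t\<^sup>a\<^sup>+\<^sup>b\<close> of the block \<open>(i, j)\<close> of \<open>D T\<close>, taken modulo \<open>(f\<^sub>i, f\<^sub>j)\<close> (\<open>ext_matrix_eq\<close>).
  Contraction is symmetric in \<open>a\<close> and \<open>b\<close>, so passing from \<open>D\<close> to \<open>D'\<close> transposes \<open>E(\<xi>)\<close>.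
  Moreover the contractions of \<open>D T\<close> lie in the ideals \<open>(f\<^sub>i, f\<^sub>j)\<close> exactly when \<open>D\<close> is a commutator
  with \<open>A\<close> (\<open>commutator_iff_contract_in_ideal\<close>), so \<open>E(\<xi>)\<close> determines \<open>D\<close> up to commutators.

  It remains to see that \<open>A0 + \<pi> D\<close> and \<open>A0 + \<pi> D'\<close> are similar over \<open>R\<close> if and only if \<open>g D g\<inverse>\<close> and
  \<open>D'\<close> agree modulo commutators for some invertible \<open>g\<close> that commutes with \<open>A\<close>
  (\<open>similar_deformations_iff\<close>). For this one needs that the commutator with \<open>A0\<close> of any lift of \<open>g\<close> to
  \<open>R\<close> is \<open>\<pi>\<close> times a commutator with \<open>A\<close> (\<open>lift_commutes_up_to_commutator\<close>), which again follows by
  contraction. Such \<open>g\<close> are the elements of \<open>G\<^sub>A\<close>, and \<open>g\<close> acts on \<open>\<xi>\<close> by conjugating \<open>D\<close>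
  (\<open>ext_act_coordinates\<close>).
\<close>

section \<open>Block diagonal matrices indexed by a list of polynomials\<close>

definition block_offset :: "'a :: zero poly list \<Rightarrow> nat \<Rightarrow> nat" where
  "block_offset fs i = (\<Sum>j<i. degree (fs ! j))"

lemma block_offset_0 [simp]: "block_offset fs 0 = 0"
  and block_offset_Suc: "block_offset fs (Suc i) = block_offset fs i + degree (fs ! i)"
  by (simp_all add: block_offset_def)

lemma block_offset_mono: "i \<le> j \<Longrightarrow> block_offset fs i \<le> block_offset fs j"
  unfolding block_offset_def by (intro sum_mono2) auto

lemma block_offset_less:
  assumes "i < l" "a < degree (fs ! i)"
  shows "block_offset fs i + a < block_offset fs l"
  using block_offset_mono[of "Suc i" l fs] assms by (simp add: block_offset_Suc)

lemma block_offset_Cons: "block_offset (f # fs) (Suc i) = degree f + block_offset fs i"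
  unfolding block_offset_def by (subst sum.lessThan_Suc_shift) simp

lemma sum_block_offset:
  "(\<Sum>r<block_offset fs l. g r) = (\<Sum>j<l. \<Sum>b<degree (fs ! j). g (block_offset fs j + b))"
  for g :: "nat \<Rightarrow> 'b :: comm_monoid_add"
proof (induction l)
  case (Suc l)
  have "(\<Sum>r<block_offset fs (Suc l). g r)
      = (\<Sum>r<block_offset fs l. g r) + (\<Sum>r\<in>{block_offset fs l..<block_offset fs l + degree (fs ! l)}. g r)"
    unfolding block_offset_Suc lessThan_atLeast0 by (rule sum.atLeastLessThan_concat[symmetric]) auto
  also have "(\<Sum>r\<in>{block_offset fs l..<block_offset fs l + degree (fs ! l)}. g r)
      = (\<Sum>b<degree (fs ! l). g (block_offset fs l + b))"
    using sum.shift_bounds_nat_ivl[of g 0 "block_offset fs l" "degree (fs ! l)"]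
    by (simp add: lessThan_atLeast0 add.commute)
  finally show ?case using Suc by simp
qed simp

lemma block_offset_cases:
  assumes "r < block_offset fs l"
  obtains j b where "j < l" "b < degree (fs ! j)" "r = block_offset fs j + b"
proof -
  have "\<exists>j b. j < l \<and> b < degree (fs ! j) \<and> r = block_offset fs j + b" using assms
  proof (induction l)
    case (Suc l)
    show ?case
    proof (cases "r < block_offset fs l")
      case True
      with Suc.IH show ?thesis using less_SucI by blast
    next
      case False
      with Suc.prems have "l < Suc l \<and> r - block_offset fs l < degree (fs ! l)
          \<and> r = block_offset fs l + (r - block_offset fs l)"
        by (auto simp: block_offset_Suc)
      then show ?thesis by blast
    qed
  qed simp
  with that show thesis by blast
qed

definition blockwise :: "('a :: comm_ring_1 poly \<Rightarrow> 'a mat) \<Rightarrow> 'a poly list \<Rightarrow> 'a mat" where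
  "blockwise M fs = diag_block_mat (map M fs)"

lemma blockwise_carrier:
  assumes M: "\<And>f. M f \<in> carrier_mat (degree f) (degree f)"
  shows "blockwise M fs \<in> carrier_mat (block_offset fs (length fs)) (block_offset fs (length fs))"
proof (induction fs)
  case Nil
  then show ?case by (simp add: blockwise_def)
next
  case (Cons f fs)
  then show ?case using M[of f] unfolding length_Cons block_offset_Cons
    by (auto simp: blockwise_def Let_def)
qed

lemma index_blockwise:
  assumes M: "\<And>f. M f \<in> carrier_mat (degree f) (degree f)"
    and "i < length fs" "j < length fs" "a < degree (fs ! i)" "b < degree (fs ! j)"
  shows "blockwise M fs $$ (block_offset fs i + a, block_offset fs j + b)
    = (if i = j then M (fs ! i) $$ (a, b) else 0)"
  using assms(2-)
proof (induction fs arbitrary: i j)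
  case (Cons f fs)
  let ?D = "blockwise M fs" and ?n = "block_offset fs (length fs)"
  have D: "?D \<in> carrier_mat ?n ?n" by (rule blockwise_carrier[OF M])
  have f: "M f \<in> carrier_mat (degree f) (degree f)" by (rule M)
  have eq: "blockwise M (f # fs) = four_block_mat (M f) (0\<^sub>m (degree f) ?n) (0\<^sub>m ?n (degree f)) ?D"
    using D f by (simp add: blockwise_def Let_def)
  note ix = index_mat_four_block(1)[of _ "M f" ?D]
  show ?case
  proof (cases i; cases j)
    fix i' j' assume ij: "i = Suc i'" "j = Suc j'"
    with Cons.prems have lt: "block_offset fs i' + a < ?n" "block_offset fs j' + b < ?n"
      by (auto intro: block_offset_less)
    show ?thesis using Cons lt D f ij unfolding eq ij block_offset_Cons
      by (subst ix) auto
  next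
    fix j' assume ij: "i = 0" "j = Suc j'"
    with Cons.prems have lt: "block_offset fs j' + b < ?n" by (auto intro: block_offset_less)
    show ?thesis using Cons.prems lt D f ij unfolding eq ij block_offset_Cons
      by (subst ix) auto
  next
    fix i' assume ij: "i = Suc i'" "j = 0"
    with Cons.prems have lt: "block_offset fs i' + a < ?n" by (auto intro: block_offset_less)
    show ?thesis using Cons.prems lt D f ij unfolding eq ij block_offset_Cons
      by (subst ix) auto
  next
    assume "i = 0" "j = 0"
    then show ?thesis using Cons.prems D f unfolding eq
      by (subst ix) auto
  qed
qed simp

lemma blockwise_mult_vec:
  assumes M: "\<And>f. M f \<in> carrier_mat (degree f) (degree f)"
    and v: "v \<in> carrier_vec (block_offset fs (length fs))"
    and i: "i < length fs" and a: "a < degree (fs ! i)"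
  shows "(blockwise M fs *\<^sub>v v) $ (block_offset fs i + a)
    = (\<Sum>b<degree (fs ! i). M (fs ! i) $$ (a, b) * v $ (block_offset fs i + b))"
proof -
  let ?n = "block_offset fs (length fs)"
  have D: "blockwise M fs \<in> carrier_mat ?n ?n" by (rule blockwise_carrier[OF M])
  have r: "block_offset fs i + a < ?n" using i a by (rule block_offset_less)
  have "(blockwise M fs *\<^sub>v v) $ (block_offset fs i + a)
      = (\<Sum>r<?n. blockwise M fs $$ (block_offset fs i + a, r) * v $ r)"
    using D v r by (auto simp: scalar_prod_def lessThan_atLeast0 intro!: sum.cong)
  also have "\<dots> = (\<Sum>j<length fs. \<Sum>b<degree (fs ! j).
      (if i = j then M (fs ! i) $$ (a, b) else 0) * v $ (block_offset fs j + b))"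
    unfolding sum_block_offset by (intro sum.cong refl) (simp add: index_blockwise[OF M] i a)
  also have "\<dots> = (\<Sum>j<length fs. if i = j then
      (\<Sum>b<degree (fs ! i). M (fs ! i) $$ (a, b) * v $ (block_offset fs i + b)) else 0)"
    by (intro sum.cong refl) auto
  also have "\<dots> = (\<Sum>b<degree (fs ! i). M (fs ! i) $$ (a, b) * v $ (block_offset fs i + b))"
    using i by (subst sum.delta') auto
  finally show ?thesis .
qed

lemma companion_mat_carrier: "companion_mat f \<in> carrier_mat (degree f) (degree f)"
  by (simp add: companion_mat_def Let_def)

text \<open>Column \<open>b\<close> is the Horner polynomial \<open>f div t ^ (b + 1)\<close>. For monic \<open>f\<close> these form the basis
  dual to \<open>1, t, t\<^sup>2, \<dots>\<close> for the symmetric bilinear form on \<open>R[t]/(f)\<close> that takes the coefficient of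
  \<open>t ^ (degree f - 1)\<close> of the product; this matrix is the change of basis between the two.\<close>

definition hankel_mat :: "'a :: comm_ring_1 poly \<Rightarrow> 'a mat" where
  "hankel_mat f = mat (degree f) (degree f) (\<lambda>(a, b). coeff f (a + b + 1))"

lemma hankel_mat_carrier: "hankel_mat f \<in> carrier_mat (degree f) (degree f)"
  by (simp add: hankel_mat_def)

abbreviation "companion_blocks \<equiv> blockwise companion_mat"
abbreviation "hankel_blocks \<equiv> blockwise hankel_mat"

lemmas companion_blocks_carrier = blockwise_carrier[of companion_mat, OF companion_mat_carrier]
lemmas hankel_blocks_carrier = blockwise_carrier[of hankel_mat, OF hankel_mat_carrier]
lemmas index_companion_blocks = index_blockwise[of companion_mat, OF companion_mat_carrier]
lemmas index_hankel_blocks = index_blockwise[of hankel_mat, OF hankel_mat_carrier]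

section \<open>Coordinate vectors as tuples of polynomials\<close>

text \<open>The \<open>i\<close>-th block of a coordinate vector, read as an element of \<open>R[t]/(f\<^sub>i)\<close> in the basis
  \<open>1, t, t\<^sup>2, \<dots>\<close>.\<close>

definition block_poly :: "'a :: comm_ring_1 poly list \<Rightarrow> nat \<Rightarrow> 'a vec \<Rightarrow> 'a poly" where
  "block_poly fs i v = (\<Sum>a<degree (fs ! i). monom (v $ (block_offset fs i + a)) a)"

lemma coeff_block_poly:
  "coeff (block_poly fs i v) a = (if a < degree (fs ! i) then v $ (block_offset fs i + a) else 0)"
  unfolding block_poly_def coeff_sum by (simp add: sum.delta)

lemma block_poly_add:
  assumes "v \<in> carrier_vec (block_offset fs (length fs))" "w \<in> carrier_vec (block_offset fs (length fs))"
    "i < length fs"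
  shows "block_poly fs i (v + w) = block_poly fs i v + block_poly fs i w"
  using assms block_offset_less[of i "length fs" _ fs]
  by (intro poly_eqI) (auto simp: coeff_block_poly)

lemma block_poly_smult:
  assumes "v \<in> carrier_vec (block_offset fs (length fs))" "i < length fs"
  shows "block_poly fs i (c \<cdot>\<^sub>v v) = Polynomial.smult c (block_poly fs i v)"
  using assms block_offset_less[of i "length fs" _ fs]
  by (intro poly_eqI) (auto simp: coeff_block_poly)

lemma vec_eq_iff_block_poly:
  assumes "v \<in> carrier_vec (block_offset fs (length fs))" "w \<in> carrier_vec (block_offset fs (length fs))"
  shows "v = w \<longleftrightarrow> (\<forall>i<length fs. block_poly fs i v = block_poly fs i w)"
proof (intro iffI allI impI)
  assume eq: "\<forall>i<length fs. block_poly fs i v = block_poly fs i w"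
  show "v = w"
  proof (rule eq_vecI)
    fix r assume "r < dim_vec w"
    with assms obtain j b where j: "j < length fs" "b < degree (fs ! j)" "r = block_offset fs j + b"
      using block_offset_cases[of r fs "length fs"] by auto
    from eq j(1) have "coeff (block_poly fs j v) b = coeff (block_poly fs j w) b" by simp
    with j show "v $ r = w $ r" by (simp add: coeff_block_poly)
  qed (use assms in auto)
qed simp

lemma degree_block_poly:
  "0 < degree (fs ! i) \<Longrightarrow> degree (block_poly fs i v) < degree (fs ! i)"
  by (intro degree_lessI) (auto simp: coeff_block_poly)

lemma block_poly_vec_of_polys:
  assumes "\<And>i. i < length fs \<Longrightarrow> degree (q i) < degree (fs ! i)"
  shows "\<exists>v\<in>carrier_vec (block_offset fs (length fs)). \<forall>i<length fs. block_poly fs i v = q i"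
proof -
  define coord where "coord r = (THE x. \<forall>i<length fs. \<forall>a<degree (fs ! i).
      r = block_offset fs i + a \<longrightarrow> x = coeff (q i) a)" for r
  have inj: "i = j \<and> a = b" if "block_offset fs i + a = block_offset fs j + b"
    "a < degree (fs ! i)" "b < degree (fs ! j)" for i j a b
    using that block_offset_less[of i j a fs] block_offset_less[of j i b fs]
    by (cases i j rule: linorder_cases) auto
  have coord: "coord (block_offset fs i + a) = coeff (q i) a"
    if "i < length fs" "a < degree (fs ! i)" for i a
    unfolding coord_def using that by (intro the_equality) (auto dest: inj)
  let ?v = "vec (block_offset fs (length fs)) coord"
  have "block_poly fs i ?v = q i" if "i < length fs" for i
    using that assms[OF that] block_offset_less[of i "length fs" _ fs]
    by (intro poly_eqI) (auto simp: coeff_block_poly coord coeff_eq_0)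
  then show ?thesis by (intro bexI[of _ ?v]) auto
qed

text \<open>Multiplication by \<open>t\<close> on \<open>R[t]/(f\<^sub>i)\<close>: the entry of top degree would become the coefficient of
  \<open>t ^ degree f\<^sub>i\<close> and is cleared by subtracting a multiple of the monic \<open>f\<^sub>i\<close>.\<close>

lemma block_poly_companion:
  assumes v: "v \<in> carrier_vec (block_offset fs (length fs))"
    and i: "i < length fs" and f: "lead_coeff (fs ! i) = 1" "0 < degree (fs ! i)"
  shows "block_poly fs i (companion_blocks fs *\<^sub>v v)
    = pCons 0 (block_poly fs i v)
      - Polynomial.smult (v $ (block_offset fs i + (degree (fs ! i) - 1))) (fs ! i)"
proof (rule poly_eqI)
  fix a
  let ?d = "degree (fs ! i)" and ?o = "block_offset fs i"
  show "coeff (block_poly fs i (companion_blocks fs *\<^sub>v v)) a = coeff (pCons 0 (block_poly fs i v)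
      - Polynomial.smult (v $ (?o + (?d - 1))) (fs ! i)) a"
  proof (cases "a < ?d")
    case True
    obtain e where e: "?d = Suc e" using f(2) by (cases ?d) auto
    have "(companion_blocks fs *\<^sub>v v) $ (?o + a)
        = (\<Sum>b<Suc (?d - 1). companion_mat (fs ! i) $$ (a, b) * v $ (?o + b))"
      using True f by (subst blockwise_mult_vec[OF companion_mat_carrier v i]) auto
    also have "\<dots> = (\<Sum>b<?d - 1. (if a = Suc b then v $ (?o + b) else 0))
        - coeff (fs ! i) a * v $ (?o + (?d - 1))"
      using True unfolding companion_mat_def Let_def e by (auto intro!: sum.cong)
    also have "(\<Sum>b<?d - 1. (if a = Suc b then v $ (?o + b) else 0))
        = (if a = 0 then 0 else v $ (?o + (a - 1)))"
    proof (cases a)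
      case (Suc a')
      then have "(\<Sum>b<?d - 1. (if a = Suc b then v $ (?o + b) else 0))
          = (\<Sum>b<?d - 1. (if a' = b then v $ (?o + b) else 0))" by auto
      with Suc True show ?thesis by (subst (asm) sum.delta') auto
    qed auto
    finally show ?thesis using True f by (auto simp: coeff_block_poly coeff_pCons split: nat.split)
  next
    case False
    then show ?thesis using f
      by (cases "a = ?d") (auto simp: coeff_block_poly coeff_pCons coeff_eq_0 split: nat.split)
  qed
qed

section \<open>The symmetric matrix that intertwines companion blocks with their transpose\<close>

lemma transpose_hankel_blocks: "transpose_mat (hankel_blocks fs) = hankel_blocks fs"
proof (rule eq_matI)
  let ?n = "block_offset fs (length fs)"
  have T: "hankel_blocks fs \<in> carrier_mat ?n ?n" by (rule hankel_blocks_carrier)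
  fix r c assume "r < dim_row (hankel_blocks fs)" "c < dim_col (hankel_blocks fs)"
  with T have rc: "r < ?n" "c < ?n" by auto
  from rc(1) obtain i a where i: "i < length fs" "a < degree (fs ! i)" "r = block_offset fs i + a"
    by (rule block_offset_cases)
  from rc(2) obtain j b where j: "j < length fs" "b < degree (fs ! j)" "c = block_offset fs j + b"
    by (rule block_offset_cases)
  show "transpose_mat (hankel_blocks fs) $$ (r, c) = hankel_blocks fs $$ (r, c)"
    using T rc i(1,2) j(1,2) unfolding i(3) j(3)
    by (auto simp: index_hankel_blocks hankel_mat_def add.commute[of a b])
qed (use hankel_blocks_carrier[of fs] in auto)

lemma block_poly_col_hankel:
  assumes "i < length fs" "j < length fs" "b < degree (fs ! j)"
  shows "block_poly fs i (col (hankel_blocks fs) (block_offset fs j + b))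
    = (if i = j then poly_shift (Suc b) (fs ! j) else 0)"
proof (rule poly_eqI)
  fix a
  have T: "hankel_blocks fs \<in> carrier_mat (block_offset fs (length fs)) (block_offset fs (length fs))"
    by (rule hankel_blocks_carrier)
  show "coeff (block_poly fs i (col (hankel_blocks fs) (block_offset fs j + b))) a
    = coeff (if i = j then poly_shift (Suc b) (fs ! j) else 0) a"
    using assms T block_offset_less[of i "length fs" _ fs] block_offset_less[of j "length fs" _ fs]
    by (auto simp: coeff_block_poly coeff_poly_shift index_hankel_blocks hankel_mat_def coeff_eq_0)
qed

text \<open>Multiplication by \<open>t\<close> is self-adjoint for the form described above, so \<open>A T\<close> is symmetric along
  with \<open>T\<close>. Concretely a diagonal block of \<open>A T\<close> has \<open>- coeff f 0\<close> in its corner and \<open>coeff f (a + b)\<close>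
  at the positions \<open>(a, b)\<close> with \<open>a, b > 0\<close>, and it is zero elsewhere.\<close>

lemma companion_hankel_symmetric:
  assumes fs: "\<And>i. i < length fs \<Longrightarrow> lead_coeff (fs ! i) = 1 \<and> 0 < degree (fs ! i)"
  shows "companion_blocks fs * hankel_blocks fs = hankel_blocks fs * transpose_mat (companion_blocks fs)"
proof -
  let ?n = "block_offset fs (length fs)" and ?A = "companion_blocks fs" and ?T = "hankel_blocks fs"
  have T: "?T \<in> carrier_mat ?n ?n" by (rule hankel_blocks_carrier)
  have A: "?A \<in> carrier_mat ?n ?n" by (rule companion_blocks_carrier)
  have entry: "(?A * ?T) $$ (block_offset fs i + a, block_offset fs j + b) =
     (if i = j \<and> (0 < a \<longleftrightarrow> 0 < b) then (if 0 < a then coeff (fs ! i) (a + b) else - coeff (fs ! i) 0) else 0)"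
    if i: "i < length fs" "a < degree (fs ! i)" and j: "j < length fs" "b < degree (fs ! j)" for i j a b
  proof -
    let ?c = "col ?T (block_offset fs j + b)"
    have lt: "block_offset fs i + a < ?n" "block_offset fs j + b < ?n"
      using i j by (auto intro: block_offset_less)
    have "(?A * ?T) $$ (block_offset fs i + a, block_offset fs j + b)
        = coeff (block_poly fs i (?A *\<^sub>v ?c)) a"
      using lt A T i by (simp add: coeff_block_poly)
    also have "block_poly fs i (?A *\<^sub>v ?c) = pCons 0 (block_poly fs i ?c)
        - Polynomial.smult (?c $ (block_offset fs i + (degree (fs ! i) - 1))) (fs ! i)"
      using fs[OF i(1)] T lt(2) i(1) by (intro block_poly_companion) auto
    also have "?c $ (block_offset fs i + (degree (fs ! i) - 1))
        = (if i = j then coeff (fs ! i) (degree (fs ! i) - 1 + b + 1) else 0)"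
      using fs[OF i(1)] i j T lt block_offset_less[of i "length fs" "degree (fs ! i) - 1" fs]
        index_hankel_blocks[of i fs j "degree (fs ! i) - 1" b]
      by (auto simp: hankel_mat_def)
    finally show ?thesis
      using fs[OF i(1)] i j by (auto simp: block_poly_col_hankel coeff_pCons coeff_poly_shift coeff_eq_0 
        split: nat.split)
  qed
  have "transpose_mat (?A * ?T) = ?A * ?T"
  proof (rule eq_matI)
    fix r c assume "r < dim_row (?A * ?T)" "c < dim_col (?A * ?T)"
    with A T have rc: "r < ?n" "c < ?n" by auto
    from rc(1) obtain i a where i: "i < length fs" "a < degree (fs ! i)" "r = block_offset fs i + a"
      by (rule block_offset_cases)
    from rc(2) obtain j b where j: "j < length fs" "b < degree (fs ! j)" "c = block_offset fs j + b"
      by (rule block_offset_cases)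
    have "transpose_mat (?A * ?T) $$ (r, c) = (?A * ?T) $$ (c, r)" using A T rc by auto
    also have "\<dots> = (?A * ?T) $$ (r, c)" unfolding i(3) j(3) entry[OF i(1,2) j(1,2)] entry[OF j(1,2) i(1,2)]
      by (auto simp: add.commute)
    finally show "transpose_mat (?A * ?T) $$ (r, c) = (?A * ?T) $$ (r, c)" .
  qed (use A T in auto)
  then show ?thesis using transpose_mult[OF A T] transpose_hankel_blocks by metis
qed

text \<open>Each block vanishes below its antidiagonal, where the entries are the leading coefficient \<open>1\<close>.
  Reading the rows from the bottom up therefore shows that a kernel vector has zero entries.\<close>

lemma det_hankel_blocks_nonzero:
  fixes fs :: "'a :: field poly list"
  assumes fs: "\<And>i. i < length fs \<Longrightarrow> lead_coeff (fs ! i) = 1"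
  shows "det (hankel_blocks fs) \<noteq> 0"
proof
  let ?n = "block_offset fs (length fs)"
  assume "det (hankel_blocks fs) = 0"
  then obtain v where v: "v \<in> carrier_vec ?n" "v \<noteq> 0\<^sub>v ?n" "hankel_blocks fs *\<^sub>v v = 0\<^sub>v ?n"
    using det_0_iff_vec_prod_zero_field[OF hankel_blocks_carrier] by blast
  have "v $ (block_offset fs i + b) = 0" if i: "i < length fs" and "b < degree (fs ! i)" for i b
    using that(2)
  proof (induction b rule: less_induct)
    case (less b)
    let ?d = "degree (fs ! i)"
    have lt: "block_offset fs i + (?d - 1 - b) < ?n" using i less.prems by (intro block_offset_less) auto
    have "0 = (hankel_blocks fs *\<^sub>v v) $ (block_offset fs i + (?d - 1 - b))"
      using v(3) lt by simp
    also have "\<dots> = (\<Sum>b'<?d. hankel_mat (fs ! i) $$ (?d - 1 - b, b') * v $ (block_offset fs i + b'))"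
      using less.prems i by (intro blockwise_mult_vec[OF hankel_mat_carrier v(1)]) auto
    also have "\<dots> = (\<Sum>b'<?d. if b = b' then v $ (block_offset fs i + b) else 0)"
    proof (intro sum.cong refl)
      fix b' assume b': "b' \<in> {..<?d}"
      then consider "b' < b" | "b' = b" | "b < b'" by fastforce
      then show "hankel_mat (fs ! i) $$ (?d - 1 - b, b') * v $ (block_offset fs i + b')
          = (if b = b' then v $ (block_offset fs i + b) else 0)"
        using less b' fs[OF i] by cases (auto simp: hankel_mat_def coeff_eq_0)
    qed
    also have "\<dots> = v $ (block_offset fs i + b)" using less.prems by (subst sum.delta') auto
    finally show ?case by simp
  qed
  then have "v = 0\<^sub>v ?n" using v(1) by (intro eq_vecI) (auto elim!: block_offset_cases)
  with v(2) show False by simp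
qed

section \<open>Contraction of a matrix to polynomials\<close>

text \<open>The \<open>(i, j)\<close> block of \<open>W\<close> represents the element \<open>\<Sum> W\<^sub>a\<^sub>b t\<^sup>a \<otimes> t\<^sup>b\<close> of
  \<open>R[t]/(f\<^sub>i) \<otimes> R[t]/(f\<^sub>j)\<close>; contraction is the multiplication map to \<open>R[t]/(f\<^sub>i, f\<^sub>j)\<close>, with the value
  kept as an unreduced polynomial.\<close>

definition contract :: "'a :: comm_ring_1 poly list \<Rightarrow> 'a mat \<Rightarrow> nat \<Rightarrow> nat \<Rightarrow> 'a poly" where
  "contract fs W i j = (\<Sum>a<degree (fs ! i). \<Sum>b<degree (fs ! j).
     monom (W $$ (block_offset fs i + a, block_offset fs j + b)) (a + b))"

lemma contract_transpose:
  assumes "W \<in> carrier_mat (block_offset fs (length fs)) (block_offset fs (length fs))"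
    and "i < length fs" "j < length fs"
  shows "contract fs (transpose_mat W) i j = contract fs W j i"
  unfolding contract_def using assms block_offset_less[of _ "length fs" _ fs]
  by (subst sum.swap) (auto intro!: sum.cong simp: add.commute)

lemma contract_block_poly:
  assumes "W \<in> carrier_mat (block_offset fs (length fs)) (block_offset fs (length fs))"
    and "i < length fs" "j < length fs"
  shows "contract fs W i j
    = (\<Sum>b<degree (fs ! j). monom 1 b * block_poly fs i (col W (block_offset fs j + b)))"
  unfolding contract_def block_poly_def sum_distrib_left
  using assms block_offset_less[of _ "length fs" _ fs]
  by (subst sum.swap) (auto intro!: sum.cong simp: mult_monom add.commute)

lemma contract_minus:
  assumes "W \<in> carrier_mat (block_offset fs (length fs)) (block_offset fs (length fs))"
    "W' \<in> carrier_mat (block_offset fs (length fs)) (block_offset fs (length fs))"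
    and "i < length fs" "j < length fs"
  shows "contract fs (W - W') i j = contract fs W i j - contract fs W' i j"
  unfolding contract_def using assms block_offset_less[of _ "length fs" _ fs]
  by (auto intro!: sum.cong simp: sum_subtractf[symmetric] diff_monom)

text \<open>Multiplying the first tensor factor by \<open>t\<close> pushes the row of top degree past \<open>f\<^sub>i\<close>. This
  polynomial is the multiple of \<open>f\<^sub>i\<close> that the contraction loses when that row is reduced.\<close>

definition top_row_poly :: "'a :: comm_ring_1 poly list \<Rightarrow> 'a mat \<Rightarrow> nat \<Rightarrow> nat \<Rightarrow> 'a poly" where
  "top_row_poly fs W i j = (\<Sum>b<degree (fs ! j).
     monom (W $$ (block_offset fs i + (degree (fs ! i) - 1), block_offset fs j + b)) b)"

text \<open>Multiplication by \<open>t\<close> on either tensor factor contracts to multiplication by \<open>t\<close>, up to an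
  explicit multiple of \<open>f\<^sub>i\<close> (here) or \<open>f\<^sub>j\<close> (below). Hence contractions of \<open>A Y - Y A\<^sup>T\<close> lie in
  the ideal \<open>(f\<^sub>i, f\<^sub>j)\<close>; keeping the cofactors is what later allows lifting from \<open>k\<close> to \<open>R\<close>.\<close>

lemma contract_companion_left:
  assumes W: "W \<in> carrier_mat (block_offset fs (length fs)) (block_offset fs (length fs))"
    and ij: "i < length fs" "j < length fs" and f: "lead_coeff (fs ! i) = 1" "0 < degree (fs ! i)"
  shows "contract fs (companion_blocks fs * W) i j
    = pCons 0 (contract fs W i j) - top_row_poly fs W i j * fs ! i"
proof -
  let ?n = "block_offset fs (length fs)" and ?A = "companion_blocks fs"
  have A: "?A \<in> carrier_mat ?n ?n" by (rule companion_blocks_carrier)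
  have "contract fs (?A * W) i j
     = (\<Sum>b<degree (fs ! j). monom 1 b * block_poly fs i (col (?A * W) (block_offset fs j + b)))"
    using A W ij by (intro contract_block_poly) auto
  also have "\<dots> = (\<Sum>b<degree (fs ! j). monom 1 b * (pCons 0 (block_poly fs i (col W (block_offset fs j + b)))
        - Polynomial.smult (W $$ (block_offset fs i + (degree (fs ! i) - 1), block_offset fs j + b)) (fs ! i)))"
  proof (intro sum.cong refl)
    fix b assume "b \<in> {..<degree (fs ! j)}"
    then have lt: "block_offset fs j + b < ?n" using ij by (auto intro: block_offset_less)
    have lt2: "block_offset fs i + (degree (fs ! i) - 1) < ?n" using ij f by (intro block_offset_less) auto
    have "col (?A * W) (block_offset fs j + b) = ?A *\<^sub>v col W (block_offset fs j + b)"
      using lt A W by (intro col_mult2) auto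
    with lt lt2 W ij f show "monom 1 b * block_poly fs i (col (?A * W) (block_offset fs j + b)) =
      monom 1 b * (pCons 0 (block_poly fs i (col W (block_offset fs j + b)))
        - Polynomial.smult (W $$ (block_offset fs i + (degree (fs ! i) - 1), block_offset fs j + b)) (fs ! i))"
      using block_poly_companion[of "col W (block_offset fs j + b)" fs i] by auto
  qed
  also have "\<dots> = pCons 0 (contract fs W i j) - top_row_poly fs W i j * fs ! i"
  proof -
    have "pCons 0 q = monom 1 1 * q" for q :: "'a poly" by (simp add: monom_altdef)
    moreover have "Polynomial.smult c q = monom c 0 * q" for c and q :: "'a poly"
      by (simp add: monom_0)
    ultimately show ?thesis unfolding contract_block_poly[OF W ij] top_row_poly_def
      by (simp add: algebra_simps sum_subtractf sum_distrib_left sum_distrib_right mult_monom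
          mult.assoc[symmetric])
  qed
  finally show ?thesis .
qed

lemma contract_companion_right:
  assumes W: "W \<in> carrier_mat (block_offset fs (length fs)) (block_offset fs (length fs))"
    and ij: "i < length fs" "j < length fs" and f: "lead_coeff (fs ! j) = 1" "0 < degree (fs ! j)"
  shows "contract fs (W * transpose_mat (companion_blocks fs)) i j
    = pCons 0 (contract fs W i j) - top_row_poly fs (transpose_mat W) j i * fs ! j"
proof -
  let ?n = "block_offset fs (length fs)" and ?A = "companion_blocks fs"
  have A: "?A \<in> carrier_mat ?n ?n" by (rule companion_blocks_carrier)
  have "contract fs (W * transpose_mat ?A) i j = contract fs (transpose_mat (?A * transpose_mat W)) i j"
    using A W by (subst transpose_mult) auto
  also have "\<dots> = contract fs (?A * transpose_mat W) j i"
    using A W ij by (intro contract_transpose) auto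
  also have "\<dots> = pCons 0 (contract fs (transpose_mat W) j i) - top_row_poly fs (transpose_mat W) j i * fs ! j"
    using W ij f by (intro contract_companion_left) auto
  also have "contract fs (transpose_mat W) j i = contract fs W i j"
    using W ij by (intro contract_transpose)
  finally show ?thesis .
qed

section \<open>Matrices that contract to zero are commutators\<close>

lemma pCons_as_mult: "pCons 0 q = [:0, 1:] * q" for q :: "'a :: comm_ring_1 poly"
  by simp

text \<open>Solving \<open>w = A Y - Y A\<^sup>T\<close> for the columns of \<open>Y\<close> in block \<open>j\<close>, where \<open>y (b + 1)\<close> stands for
  column \<open>b\<close> and \<open>y 0 = 0\<close> closes the system. The last column \<open>x = y (degree f\<^sub>j)\<close> may be chosen
  freely and determines the others by downward recursion. Unrolled as in Horner's scheme, the
  recursion gives \<open>y 0 = f\<^sub>j x - \<Sum> t\<^sup>b w\<^sub>b\<close> in \<open>\<Oplus> k[t]/(f\<^sub>i)\<close>. So the system is solvable as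
  soon as each component of \<open>\<Sum> t\<^sup>b w\<^sub>b\<close> is a multiple of \<open>f\<^sub>j\<close> modulo \<open>f\<^sub>i\<close>.\<close>

lemma horner_column:
  fixes fs :: "'a :: field poly list"
  assumes fs: "\<And>i. i < length fs \<Longrightarrow> lead_coeff (fs ! i) = 1 \<and> 0 < degree (fs ! i)"
    and w: "\<And>b. w b \<in> carrier_vec (block_offset fs (length fs))"
    and j: "j < length fs"
    and ideal: "\<And>i. i < length fs \<Longrightarrow> \<exists>u v. (\<Sum>b<degree (fs ! j). monom 1 b * block_poly fs i (w b))
       = u * fs ! i + v * fs ! j"
  obtains y where "\<And>b. y b \<in> carrier_vec (block_offset fs (length fs))" "y 0 = 0\<^sub>v (block_offset fs (length fs))"
    "\<And>b. b < degree (fs ! j) \<Longrightarrow>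
       y b = companion_blocks fs *\<^sub>v y (Suc b) + coeff (fs ! j) b \<cdot>\<^sub>v y (degree (fs ! j)) - w b"
proof -
  let ?n = "block_offset fs (length fs)" and ?A = "companion_blocks fs"
  define d where "d = degree (fs ! j)"
  have A: "?A \<in> carrier_mat ?n ?n" by (rule companion_blocks_carrier)
  obtain u v where uv: "\<And>i. i < length fs \<Longrightarrow> (\<Sum>b<d. monom 1 b * block_poly fs i (w b))
       = u i * fs ! i + v i * fs ! j" using ideal unfolding d_def by metis
  have "\<exists>x\<in>carrier_vec ?n. \<forall>i<length fs. block_poly fs i x = v i mod fs ! i"
  proof (rule block_poly_vec_of_polys)
    fix i assume i: "i < length fs"
    then show "degree (v i mod fs ! i) < degree (fs ! i)"
      using fs[OF i] degree_mod_less'[of "fs ! i" "v i"]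
      by (cases "v i mod fs ! i = 0") (simp, metis degree_0 less_irrefl)
  qed
  then obtain x where x: "x \<in> carrier_vec ?n"
    and bx: "\<And>i. i < length fs \<Longrightarrow> block_poly fs i x = v i mod fs ! i" by blast
  \<comment> \<open>\<open>z m\<close> is \<open>y (d - m)\<close>: the recursion runs from the last column down to \<open>y 0\<close>.\<close>
  define z where "z = rec_nat x (\<lambda>m y. ?A *\<^sub>v y + coeff (fs ! j) (d - 1 - m) \<cdot>\<^sub>v x - w (d - 1 - m))"
  have z0: "z 0 = x" and zS: "z (Suc m) = ?A *\<^sub>v z m + coeff (fs ! j) (d - 1 - m) \<cdot>\<^sub>v x - w (d - 1 - m)" for m
    by (simp_all add: z_def)
  have zc: "z m \<in> carrier_vec ?n" for m
    by (induction m) (use x A w in \<open>auto simp: z0 zS\<close>)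
  have cong: "[block_poly fs i (z m) = block_poly fs i x * poly_shift (d - m) (fs ! j)
      - (\<Sum>b<m. monom 1 b * block_poly fs i (w (d - m + b)))] (mod fs ! i)"
    if i: "i < length fs" and "m \<le> d" for i m using that(2)
  proof (induction m)
    case 0
    have "poly_shift d (fs ! j) = 1"
      using fs[OF j] unfolding d_def
      by (intro poly_eqI) (auto simp: coeff_poly_shift coeff_1 coeff_eq_0)
    then show ?case by (simp add: z0)
  next
    case (Suc m)
    let ?c = "coeff (fs ! j) (d - 1 - m)" and ?w = "block_poly fs i (w (d - 1 - m))"
    let ?S = "\<lambda>m. \<Sum>b<m. monom 1 b * block_poly fs i (w (d - m + b))"
    have "block_poly fs i (z (Suc m)) = pCons 0 (block_poly fs i (z m))
        - Polynomial.smult (z m $ (block_offset fs i + (degree (fs ! i) - 1))) (fs ! i)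
        + Polynomial.smult ?c (block_poly fs i x) - ?w"
    proof -
      have "?A *\<^sub>v z m + ?c \<cdot>\<^sub>v x - w (d - 1 - m) = ?A *\<^sub>v z m + ?c \<cdot>\<^sub>v x + (- 1) \<cdot>\<^sub>v w (d - 1 - m)"
        using A zc x w[of "d - 1 - m"] by (intro eq_vecI) auto
      then show ?thesis unfolding zS using A zc x w i fs[OF i]
        by (simp add: block_poly_add block_poly_smult block_poly_companion)
    qed
    then have "[block_poly fs i (z (Suc m)) = pCons 0 (block_poly fs i (z m))
        + Polynomial.smult ?c (block_poly fs i x) - ?w] (mod fs ! i)"
      unfolding cong_iff_dvd_diff by (simp add: dvd_smult)
    also have "[pCons 0 (block_poly fs i (z m)) + Polynomial.smult ?c (block_poly fs i x) - ?w
       = [:0, 1:] * (block_poly fs i x * poly_shift (d - m) (fs ! j) - ?S m)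
         + Polynomial.smult ?c (block_poly fs i x) - ?w] (mod fs ! i)"
      unfolding pCons_as_mult[of "block_poly fs i (z m)"] using Suc
      by (intro cong_diff[OF cong_add[OF cong_mult[OF cong_refl]] cong_refl] cong_refl) simp
    also have "[:0, 1:] * (block_poly fs i x * poly_shift (d - m) (fs ! j) - ?S m)
         + Polynomial.smult ?c (block_poly fs i x) - ?w
       = block_poly fs i x * poly_shift (d - Suc m) (fs ! j) - ?S (Suc m)"
    proof -
      have 1: "poly_shift (d - Suc m) (fs ! j) = pCons ?c (poly_shift (d - m) (fs ! j))"
        using Suc.prems by (intro poly_eqI) (auto simp: coeff_poly_shift coeff_pCons Suc_diff_Suc split: nat.split)
      have 2: "?S (Suc m) = ?w + [:0, 1:] * ?S m"
        unfolding sum.lessThan_Suc_shift sum_distrib_left using Suc.prems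
        by (auto intro!: sum.cong simp: monom_Suc Suc_diff_Suc mult.assoc[symmetric])
      show ?thesis unfolding 1 2 by (simp add: algebra_simps)
    qed
    finally show ?case .
  qed
  have zd: "z d = 0\<^sub>v ?n"
  proof -
    have "block_poly fs i (z d) = block_poly fs i (0\<^sub>v ?n)" if i: "i < length fs" for i
    proof -
      have "[block_poly fs i (z d) = block_poly fs i x * fs ! j - (u i * fs ! i + v i * fs ! j)] (mod fs ! i)"
        using cong[OF i order_refl] by (simp add: uv[OF i])
      also have "[block_poly fs i x * fs ! j - (u i * fs ! i + v i * fs ! j)
          = v i * fs ! j - (0 + v i * fs ! j)] (mod fs ! i)"
          unfolding bx[OF i]
        by (intro cong_diff[OF cong_mult[OF _ cong_refl] cong_add[OF _ cong_refl]]) (auto simp: cong_def)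
      finally have "block_poly fs i (z d) mod fs ! i = 0" by (simp add: cong_def)
      moreover have "degree (block_poly fs i (z d)) < degree (fs ! i)"
        using fs[OF i] by (intro degree_block_poly) auto
      ultimately have "block_poly fs i (z d) = 0" by (simp add: mod_poly_less)
      moreover have "block_poly fs i (0\<^sub>v ?n) = 0"
        using i block_offset_less[of i "length fs" _ fs] by (intro poly_eqI) (auto simp: coeff_block_poly)
      ultimately show ?thesis by simp
    qed
    then show ?thesis using vec_eq_iff_block_poly[OF zc, of "0\<^sub>v ?n" d] by auto
  qed
  show thesis
  proof (rule that[of "\<lambda>b. z (d - b)"])
    fix b assume b: "b < degree (fs ! j)"
    then have "d - b = Suc (d - Suc b)" "d - 1 - (d - Suc b) = b" by (auto simp: d_def)
    then show "z (d - b) = ?A *\<^sub>v z (d - Suc b) + coeff (fs ! j) b \<cdot>\<^sub>v z (d - degree (fs ! j)) - w b"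
      using zS[of "d - Suc b"] by (simp add: d_def z0)
  qed (use zc zd in auto)
qed

text \<open>By the contraction formulas the condition is also necessary; sufficiency is the preceding lemma
  applied to each block of columns. The entries of \<open>Y A\<^sup>T\<close> are read off from the action of \<open>A\<close> on the
  rows of \<open>Y\<close>.\<close>

lemma commutator_if_contract_in_ideal:
  fixes fs :: "'a :: field poly list"
  assumes fs: "\<And>i. i < length fs \<Longrightarrow> lead_coeff (fs ! i) = 1 \<and> 0 < degree (fs ! i)"
    and W: "W \<in> carrier_mat (block_offset fs (length fs)) (block_offset fs (length fs))"
    and ideal: "\<And>i j. i < length fs \<Longrightarrow> j < length fs \<Longrightarrow>
      \<exists>u v. contract fs W i j = u * fs ! i + v * fs ! j"
  obtains Y where "Y \<in> carrier_mat (block_offset fs (length fs)) (block_offset fs (length fs))"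
    "W = companion_blocks fs * Y - Y * transpose_mat (companion_blocks fs)"
proof -
  let ?n = "block_offset fs (length fs)" and ?A = "companion_blocks fs"
  have A: "?A \<in> carrier_mat ?n ?n" by (rule companion_blocks_carrier)
  define solves where "solves j y \<longleftrightarrow> (\<forall>b. y b \<in> carrier_vec ?n) \<and> y 0 = 0\<^sub>v ?n \<and> (\<forall>b<degree (fs ! j).
       y b = ?A *\<^sub>v y (Suc b) + coeff (fs ! j) b \<cdot>\<^sub>v y (degree (fs ! j)) - col W (block_offset fs j + b))"
    for j y
  have "\<exists>y. solves j y" if j: "j < length fs" for j
  proof -
    have "\<exists>u v. (\<Sum>b<degree (fs ! j). monom 1 b * block_poly fs i (col W (block_offset fs j + b)))
       = u * fs ! i + v * fs ! j" if "i < length fs" for i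
      using ideal[OF that j] contract_block_poly[OF W that j] by simp
    moreover have "col W (block_offset fs j + b) \<in> carrier_vec ?n" for b
      using carrier_matD(1)[OF W] col_dim[of W "block_offset fs j + b"] by simp
    ultimately obtain y where "\<And>b. y b \<in> carrier_vec ?n" "y 0 = 0\<^sub>v ?n"
      "\<And>b. b < degree (fs ! j) \<Longrightarrow>
       y b = ?A *\<^sub>v y (Suc b) + coeff (fs ! j) b \<cdot>\<^sub>v y (degree (fs ! j)) - col W (block_offset fs j + b)"
      using horner_column[OF fs _ j, of "\<lambda>b. col W (block_offset fs j + b)"] by blast
    then show ?thesis unfolding solves_def by blast
  qed
  then have "\<exists>y. \<forall>j. j < length fs \<longrightarrow> solves j (y j)" by (intro choice) blast
  then obtain y where y: "\<And>j. j < length fs \<Longrightarrow> solves j (y j)" by blast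
  have yc: "y j b \<in> carrier_vec ?n" and y0: "y j 0 = 0\<^sub>v ?n" if "j < length fs" for j b
    using y[OF that] by (auto simp: solves_def)
  have yrec: "y j b = ?A *\<^sub>v y j (Suc b) + coeff (fs ! j) b \<cdot>\<^sub>v y j (degree (fs ! j)) - col W (block_offset fs j + b)"
    if "j < length fs" "b < degree (fs ! j)" for j b
    using y[OF that(1)] that(2) by (auto simp: solves_def)
  have "\<exists>c. \<forall>i<length fs. \<forall>a<degree (fs ! i). r < ?n \<longrightarrow> c $ (block_offset fs i + a) = y i (Suc a) $ r
     \<and> c \<in> carrier_vec ?n" for r
  proof -
    have "\<exists>v\<in>carrier_vec ?n. \<forall>i<length fs. block_poly fs i v = (\<Sum>a<degree (fs ! i). monom (y i (Suc a) $ r) a)"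
      using fs by (intro block_poly_vec_of_polys degree_lessI) (auto simp: coeff_sum sum.delta)
    then obtain v where v: "v \<in> carrier_vec ?n"
      "\<And>i. i < length fs \<Longrightarrow> block_poly fs i v = (\<Sum>a<degree (fs ! i). monom (y i (Suc a) $ r) a)" by blast
    have "v $ (block_offset fs i + a) = y i (Suc a) $ r" if "i < length fs" "a < degree (fs ! i)" for i a
      using arg_cong[OF v(2)[OF that(1)], of "\<lambda>q. coeff q a"] that
      by (simp add: coeff_block_poly coeff_sum sum.delta)
    with v(1) show ?thesis by blast
  qed
  then obtain c where c: "\<And>r i a. i < length fs \<Longrightarrow> a < degree (fs ! i) \<Longrightarrow> r < ?n \<Longrightarrow>
     c r $ (block_offset fs i + a) = y i (Suc a) $ r" by metis
  define Y where "Y = mat ?n ?n (\<lambda>(r, s). c r $ s)"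
  have Y: "Y \<in> carrier_mat ?n ?n" by (simp add: Y_def)
  have "W = ?A * Y - Y * transpose_mat ?A"
  proof (rule eq_matI)
    fix r s assume "r < dim_row (?A * Y - Y * transpose_mat ?A)" "s < dim_col (?A * Y - Y * transpose_mat ?A)"
    with A Y have r: "r < ?n" and s: "s < ?n" by auto
    from s obtain j b where j: "j < length fs" and b: "b < degree (fs ! j)" and sj: "s = block_offset fs j + b"
      by (rule block_offset_cases)
    let ?d = "degree (fs ! j)"
    have colY: "col Y (block_offset fs j + b) = y j (Suc b)" if "b < ?d" for b
      using that j yc[OF j, of "Suc b"] block_offset_less[OF j that]
      by (intro eq_vecI) (auto simp: Y_def c)
    have rowY: "row Y r $ (block_offset fs j + a) = y j (Suc a) $ r" if "a < ?d" for a
      using c[OF j that r] r block_offset_less[OF j that] by (simp add: Y_def)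
    have "(Y * transpose_mat ?A) $$ (r, s) = (?A *\<^sub>v row Y r) $ s"
      using A Y r s by (auto simp: comm_scalar_prod[of _ ?n])
    also have "\<dots> = coeff (block_poly fs j (?A *\<^sub>v row Y r)) b"
      using b by (simp add: coeff_block_poly sj)
    also have "\<dots> = (if b = 0 then 0 else row Y r $ (block_offset fs j + (b - 1)))
        - row Y r $ (block_offset fs j + (?d - 1)) * coeff (fs ! j) b"
      using fs[OF j] b Y r by (subst block_poly_companion[OF _ j])
        (auto simp: coeff_pCons coeff_block_poly split: nat.split)
    also have "row Y r $ (block_offset fs j + (?d - 1)) = y j ?d $ r"
      using rowY[of "?d - 1"] b by simp
    also have "(if b = 0 then 0 else row Y r $ (block_offset fs j + (b - 1))) = y j b $ r"
      using rowY[of "b - 1"] b r y0[OF j] by (cases b) auto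
    finally have 1: "(Y * transpose_mat ?A) $$ (r, s) = y j b $ r - y j ?d $ r * coeff (fs ! j) b" .
    have "col (?A * Y) s = ?A *\<^sub>v y j (Suc b)" unfolding sj colY[OF b, symmetric]
      using A Y s unfolding sj by (intro col_mult2) auto
    then have 2: "(?A * Y) $$ (r, s) = (?A *\<^sub>v y j (Suc b)) $ r"
      using A Y r s by (metis carrier_matD index_col index_mult_mat(2,3))
    have "y j b $ r = (?A *\<^sub>v y j (Suc b) + coeff (fs ! j) b \<cdot>\<^sub>v y j ?d - col W s) $ r"
      by (rule arg_cong[OF yrec[OF j b, folded sj], of "\<lambda>v. v $ r"])
    also have "\<dots> = (?A *\<^sub>v y j (Suc b)) $ r + coeff (fs ! j) b * y j ?d $ r - W $$ (r, s)"
      using A W r s carrier_vecD[OF yc[OF j]] by (simp del: index_mult_mat_vec)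
    finally have 3: "y j b $ r = (?A *\<^sub>v y j (Suc b)) $ r + coeff (fs ! j) b * y j ?d $ r - W $$ (r, s)" .
    have alg: "x - ((x + c * z - w) - z * c) = w" for x c z w :: 'a
      by (simp add: algebra_simps)
    have "(?A * Y - Y * transpose_mat ?A) $$ (r, s) = (?A * Y) $$ (r, s) - (Y * transpose_mat ?A) $$ (r, s)"
      using A Y r s by (intro index_minus_mat) auto
    also have "\<dots> = W $$ (r, s)" 
      by (subst 1, subst 2, subst 3) (rule alg)
    finally show "W $$ (r, s) = (?A * Y - Y * transpose_mat ?A) $$ (r, s)"
      by (rule sym)
  qed (use W A Y in auto)
  with Y show thesis by (rule that)
qed

lemma ex_inverse_mat_if_det_unit:
  fixes M :: "'a :: comm_ring_1 mat"
  assumes M: "M \<in> carrier_mat n n" and "det M dvd 1"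
  obtains N where "N \<in> carrier_mat n n" "M * N = 1\<^sub>m n" "N * M = 1\<^sub>m n"
proof -
  from assms(2) obtain c where c: "1 = det M * c" by (elim dvdE)
  have adj: "adj_mat M \<in> carrier_mat n n" by (rule adj_mat(1)[OF M])
  show thesis
  proof (rule that[of "c \<cdot>\<^sub>m adj_mat M"])
    show "M * (c \<cdot>\<^sub>m adj_mat M) = 1\<^sub>m n"
      using c unfolding mult_smult_distrib[OF M adj] adj_mat(2)[OF M]
      by (intro eq_matI) (auto simp: mult.commute)
    show "(c \<cdot>\<^sub>m adj_mat M) * M = 1\<^sub>m n"
      using c unfolding mult_smult_assoc_mat[OF adj M] adj_mat(3)[OF M]
      by (intro eq_matI) (auto simp: mult.commute)
  qed (use adj in auto)
qed

lemma commute_with_inverse_mat: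
  assumes G: "G \<in> carrier_mat n n" and H: "H \<in> carrier_mat n n" and A: "A \<in> carrier_mat n n"
    and inv: "G * H = 1\<^sub>m n" "H * G = 1\<^sub>m n" and comm: "G * A = A * G"
  shows "A * H = H * (A :: 'a :: comm_ring_1 mat)"
proof -
  note assoc = assoc_mult_mat[of _ n n _ n _ n]
  note [simp] = G H A mult_carrier_mat[of _ n n _ n]
  have "A * H = H * G * (A * H)" unfolding inv by (simp add: left_mult_one_mat[of _ n n])
  also have "\<dots> = H * (G * A) * H" by (simp add: assoc)
  also have "\<dots> = H * A * (G * H)" unfolding comm by (simp add: assoc)
  finally show ?thesis unfolding inv by (simp add: right_mult_one_mat[of _ n n])
qed

text \<open>The symmetric matrix \<open>T\<close> is invertible and \<open>T A\<^sup>T = A T\<close>, so \<open>X \<mapsto> X T\<close> turns \<open>A X - X A\<close> into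
  \<open>A Y - Y A\<^sup>T\<close>.\<close>

lemma commutator_if_contract_mult_hankel_in_ideal:
  fixes fs :: "'a :: field poly list"
  assumes fs: "\<And>i. i < length fs \<Longrightarrow> lead_coeff (fs ! i) = 1 \<and> 0 < degree (fs ! i)"
    and D: "D \<in> carrier_mat (block_offset fs (length fs)) (block_offset fs (length fs))"
    and ideal: "\<And>i j. i < length fs \<Longrightarrow> j < length fs \<Longrightarrow>
      \<exists>u v. contract fs (D * hankel_blocks fs) i j = u * fs ! i + v * fs ! j"
  obtains X where "X \<in> carrier_mat (block_offset fs (length fs)) (block_offset fs (length fs))"
    "D = companion_blocks fs * X - X * companion_blocks fs"
proof -
  let ?n = "block_offset fs (length fs)" and ?A = "companion_blocks fs" and ?T = "hankel_blocks fs"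
  have A: "?A \<in> carrier_mat ?n ?n" by (rule companion_blocks_carrier)
  have T: "?T \<in> carrier_mat ?n ?n" by (rule hankel_blocks_carrier)
  have At: "transpose_mat ?A \<in> carrier_mat ?n ?n" using A by simp
  have "det ?T \<noteq> 0" by (rule det_hankel_blocks_nonzero) (use fs in blast)
  then have "det ?T dvd 1" by (simp add: dvd_field_iff)
  then obtain S where S: "S \<in> carrier_mat ?n ?n" "?T * S = 1\<^sub>m ?n" "S * ?T = 1\<^sub>m ?n"
    by (rule ex_inverse_mat_if_det_unit[OF T])
  note [simp] = A T At S(1) D mult_carrier_mat[of _ ?n ?n _ ?n]
  note assoc = assoc_mult_mat[of _ ?n ?n _ ?n _ ?n]
  obtain Y where Y: "Y \<in> carrier_mat ?n ?n" "D * ?T = ?A * Y - Y * transpose_mat ?A"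
    using commutator_if_contract_in_ideal[OF fs, of "D * ?T"] ideal by (metis D T mult_carrier_mat)
  have "S * (?A * ?T) * S = S * (?T * transpose_mat ?A) * S"
    using companion_hankel_symmetric[OF fs] by simp
  then have SA: "S * ?A = transpose_mat ?A * S"
  proof -
    assume eq: "S * (?A * ?T) * S = S * (?T * transpose_mat ?A) * S"
    have "S * (?A * ?T) * S = S * ?A * (?T * S)" by (simp add: assoc)
    moreover have "S * (?T * transpose_mat ?A) * S = (S * ?T) * transpose_mat ?A * S" by (simp add: assoc)
    ultimately show ?thesis using eq S(2,3)
      by (simp add: right_mult_one_mat[of _ ?n ?n] left_mult_one_mat[of _ ?n ?n])
  qed
  have "D = D * (?T * S)" using S(2) by (simp add: right_mult_one_mat[of _ ?n ?n])
  also have "\<dots> = (D * ?T) * S" by (simp add: assoc)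
  also have "\<dots> = ?A * Y * S - Y * transpose_mat ?A * S"
    unfolding Y(2) using Y(1) by (intro minus_mult_distrib_mat[of _ ?n ?n _ _ ?n]) auto
  also have "\<dots> = ?A * (Y * S) - (Y * S) * ?A" using Y(1) SA by (simp add: assoc)
  finally show thesis using Y(1) by (intro that[of "Y * S"]) auto
qed

lemma contract_commutator_in_ideal:
  fixes fs :: "'a :: comm_ring_1 poly list"
  assumes fs: "\<And>i. i < length fs \<Longrightarrow> lead_coeff (fs ! i) = 1 \<and> 0 < degree (fs ! i)"
    and X: "X \<in> carrier_mat (block_offset fs (length fs)) (block_offset fs (length fs))"
    and ij: "i < length fs" "j < length fs"
  shows "\<exists>u v. contract fs ((companion_blocks fs * X - X * companion_blocks fs) * hankel_blocks fs) i j
    = u * fs ! i + v * fs ! j"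
proof -
  let ?n = "block_offset fs (length fs)" and ?A = "companion_blocks fs" and ?T = "hankel_blocks fs"
  have A: "?A \<in> carrier_mat ?n ?n" by (rule companion_blocks_carrier)
  have T: "?T \<in> carrier_mat ?n ?n" by (rule hankel_blocks_carrier)
  have At: "transpose_mat ?A \<in> carrier_mat ?n ?n" using A by simp
  note [simp] = A T At X mult_carrier_mat[of _ ?n ?n _ ?n]
  note assoc = assoc_mult_mat[of _ ?n ?n _ ?n _ ?n]
  have "(?A * X - X * ?A) * ?T = ?A * X * ?T - X * ?A * ?T"
    by (intro minus_mult_distrib_mat[of _ ?n ?n _ _ ?n]) auto
  also have "\<dots> = ?A * (X * ?T) - (X * ?T) * transpose_mat ?A"
    using companion_hankel_symmetric[OF fs] by (simp add: assoc)
  finally have "contract fs ((?A * X - X * ?A) * ?T) i j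
      = contract fs (?A * (X * ?T)) i j - contract fs ((X * ?T) * transpose_mat ?A) i j"
    using ij contract_minus[of "?A * (X * ?T)" fs "(X * ?T) * transpose_mat ?A" i j]
    by simp
  also have "\<dots> = (- top_row_poly fs (X * ?T) i j) * fs ! i
      + top_row_poly fs (transpose_mat (X * ?T)) j i * fs ! j"
    using ij fs contract_companion_left[of "X * ?T" fs i j] contract_companion_right[of "X * ?T" fs i j]
    by simp
  finally show ?thesis by blast
qed

section \<open>Reduction modulo \<open>\<pi>\<close>\<close>

text \<open>What is used of a local ring of length two with maximal ideal \<open>(\<pi>)\<close>: the kernel of \<open>red\<close> and the
  annihilator of \<open>\<pi>\<close> are both \<open>\<pi> R\<close>. Thus \<open>\<pi>\<^sup>2 = 0\<close>, and multiplication by \<open>\<pi>\<close> induces a bijection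
  from the residue field to \<open>\<pi> R\<close>.\<close>

locale residue_map = comm_ring_hom red for red :: "'r :: comm_ring_1 \<Rightarrow> 'k :: field" +
  fixes \<pi> :: 'r
  assumes surj_red: "surj red"
    and red_eq_0_iff: "red r = 0 \<longleftrightarrow> (\<exists>s. r = \<pi> * s)"
    and pi_mult_eq_0_iff: "\<pi> * r = 0 \<longleftrightarrow> red r = 0"
begin

sublocale map_poly_hom: map_poly_comm_ring_hom red ..

lemma red_pi [simp]: "red \<pi> = 0"
  using red_eq_0_iff[of \<pi>] by (metis mult.right_neutral)

lemma pi_mult_eq_iff: "\<pi> * r = \<pi> * s \<longleftrightarrow> red r = red s"
  using pi_mult_eq_0_iff[of "r - s"] by (simp add: hom_distribs right_diff_distrib)

lemma unit_if_red_nonzero: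
  assumes "red r \<noteq> 0"
  shows "r dvd 1"
proof -
  obtain s where s: "red s = inverse (red r)" using surj_red by (metis surjD)
  then have "red (r * s - 1) = 0" using assms by (simp add: hom_distribs)
  then obtain u where u: "r * s - 1 = \<pi> * u" using red_eq_0_iff by blast
  \<comment> \<open>\<open>1 - \<pi> u\<close> is the inverse of \<open>1 + \<pi> u\<close>, since \<open>\<pi>\<^sup>2 = 0\<close>.\<close>
  have "r * (s * (1 - \<pi> * u)) = (1 + \<pi> * u) * (1 - \<pi> * u)"
    using u by (simp add: mult.assoc[symmetric] diff_eq_eq add.commute)
  also have "\<dots> = 1 - (\<pi> * \<pi>) * (u * u)" by (simp add: algebra_simps)
  also have "\<pi> * \<pi> = 0" by (simp add: pi_mult_eq_0_iff)
  finally have "r * (s * (1 - \<pi> * u)) = 1" by simp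
  then show ?thesis by (metis dvdI)
qed

lemma smult_pi_eq_iff:
  "Polynomial.smult \<pi> f = Polynomial.smult \<pi> g \<longleftrightarrow> map_poly red f = map_poly red g"
  by (auto simp: poly_eq_iff pi_mult_eq_iff)

lemma map_poly_red_eq_0:
  assumes "map_poly red f = 0"
  shows "\<exists>g. f = Polynomial.smult \<pi> g"
proof -
  have "\<exists>s. coeff f i = \<pi> * s \<and> (coeff f i = 0 \<longrightarrow> s = 0)" for i
  proof (cases "coeff f i = 0")
    case False
    have "red (coeff f i) = 0" using assms by (metis coeff_0 coeff_map_poly_hom)
    with False show ?thesis using red_eq_0_iff by blast
  qed auto
  then obtain s where s: "\<And>i. coeff f i = \<pi> * s i" "\<And>i. coeff f i = 0 \<Longrightarrow> s i = 0" by metis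
  have "f = Polynomial.smult \<pi> (\<Sum>i\<le>degree f. monom (s i) i)"
    by (intro poly_eqI) (auto simp: coeff_sum s(1)[symmetric] coeff_eq_0)
  then show ?thesis by blast
qed

lemma smult_pi_mat_eq_iff:
  assumes "M \<in> carrier_mat n m" "N \<in> carrier_mat n m"
  shows "\<pi> \<cdot>\<^sub>m M = \<pi> \<cdot>\<^sub>m N \<longleftrightarrow> map_mat red M = map_mat red N"
  using assms by (auto simp: mat_eq_iff pi_mult_eq_iff)

lemma ex_smult_pi_mat:
  assumes M: "M \<in> carrier_mat n m" and "map_mat red M = 0\<^sub>m n m"
  shows "\<exists>K\<in>carrier_mat n m. M = \<pi> \<cdot>\<^sub>m K"
proof -
  have "\<exists>s. i < n \<longrightarrow> j < m \<longrightarrow> M $$ (i, j) = \<pi> * s" for i j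
  proof (cases "i < n \<and> j < m")
    case True
    then have "map_mat red M $$ (i, j) = 0" using assms(2) by simp
    then have "red (M $$ (i, j)) = 0" using M True by simp
    then show ?thesis using red_eq_0_iff by blast
  qed auto
  then obtain s where s: "\<And>i j. i < n \<Longrightarrow> j < m \<Longrightarrow> M $$ (i, j) = \<pi> * s i j" by metis
  show ?thesis using M s by (intro bexI[of _ "mat n m (\<lambda>(i, j). s i j)"]) (auto simp: mat_eq_iff)
qed

lemma ex_mat_lift:
  assumes "M \<in> carrier_mat n m"
  shows "\<exists>N\<in>carrier_mat n m. map_mat red N = M"
  using assms surj_f_inv_f[OF surj_red]
  by (intro bexI[of _ "map_mat (inv_into UNIV red) M"]) (auto simp: mat_eq_iff)

lemma degree_map_poly_red: "lead_coeff f = 1 \<Longrightarrow> degree (map_poly red f) = degree f"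
  by (rule antisym) (auto intro!: degree_map_poly_le le_degree)

lemma block_offset_red:
  assumes "\<And>f. f \<in> set fs \<Longrightarrow> lead_coeff f = 1" "i \<le> length fs"
  shows "block_offset (map (map_poly red) fs) i = block_offset fs i"
  unfolding block_offset_def using assms by (auto intro!: sum.cong simp: degree_map_poly_red)

lemma blockwise_red:
  assumes monic: "\<And>f. f \<in> set fs \<Longrightarrow> lead_coeff f = 1"
    and M: "\<And>f. M f \<in> carrier_mat (degree f) (degree f)"
    and M': "\<And>f. M' f \<in> carrier_mat (degree f) (degree f)"
    and red: "\<And>f. f \<in> set fs \<Longrightarrow> map_mat red (M f) = M' (map_poly red f)"
  shows "map_mat red (blockwise M fs) = blockwise M' (map (map_poly red) fs)"
proof (rule eq_matI)
  let ?n = "block_offset fs (length fs)" and ?fs = "map (map_poly red) fs"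
  have c: "blockwise M fs \<in> carrier_mat ?n ?n" by (rule blockwise_carrier[OF M])
  have c': "blockwise M' ?fs \<in> carrier_mat ?n ?n"
    using blockwise_carrier[OF M', of ?fs] block_offset_red[OF monic, where i = "length fs" and fs = fs] by simp
  fix r s assume "r < dim_row (blockwise M' ?fs)" "s < dim_col (blockwise M' ?fs)"
  with c' have rs: "r < ?n" "s < ?n" by auto
  from rs(1) obtain i a where i: "i < length fs" "a < degree (fs ! i)" "r = block_offset fs i + a"
    by (rule block_offset_cases)
  from rs(2) obtain j b where j: "j < length fs" "b < degree (fs ! j)" "s = block_offset fs j + b"
    by (rule block_offset_cases)
  have "map_mat red (blockwise M fs) $$ (r, s) = red (blockwise M fs $$ (r, s))" using c rs by simp
  also have "\<dots> = (if i = j then map_mat red (M (fs ! i)) $$ (a, b) else 0)"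
    unfolding i(3) j(3) using i(1,2) j(1,2) M[of "fs ! i"] by (auto simp: index_blockwise[OF M])
  also have "\<dots> = blockwise M' ?fs $$ (block_offset ?fs i + a, block_offset ?fs j + b)"
    using i(1,2) j(1,2) red monic by (subst index_blockwise[OF M']) (auto simp: degree_map_poly_red)
  also have "\<dots> = blockwise M' ?fs $$ (r, s)"
    using i(1) j(1) monic unfolding i(3) j(3) by (simp add: block_offset_red)
  finally show "map_mat red (blockwise M fs) $$ (r, s) = blockwise M' ?fs $$ (r, s)" .
qed (use blockwise_carrier[OF M, of fs] blockwise_carrier[OF M', of "map (map_poly red) fs"]
    block_offset_red[OF monic, where i = "length fs" and fs = fs] in auto)

lemma companion_blocks_red:
  assumes "\<And>f. f \<in> set fs \<Longrightarrow> lead_coeff f = 1"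
  shows "map_mat red (companion_blocks fs) = companion_blocks (map (map_poly red) fs)"
  using assms by (intro blockwise_red[OF _ companion_mat_carrier companion_mat_carrier])
    (auto simp: mat_eq_iff companion_mat_def Let_def degree_map_poly_red hom_distribs)

lemma hankel_blocks_red:
  assumes "\<And>f. f \<in> set fs \<Longrightarrow> lead_coeff f = 1"
  shows "map_mat red (hankel_blocks fs) = hankel_blocks (map (map_poly red) fs)"
  using assms by (intro blockwise_red[OF _ hankel_mat_carrier hankel_mat_carrier])
    (auto simp: mat_eq_iff hankel_mat_def degree_map_poly_red)

lemma contract_red:
  assumes "\<And>f. f \<in> set fs \<Longrightarrow> lead_coeff f = 1" "i < length fs" "j < length fs"
    "W \<in> carrier_mat (block_offset fs (length fs)) (block_offset fs (length fs))"
  shows "map_poly red (contract fs W i j) = contract (map (map_poly red) fs) (map_mat red W) i j"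
  unfolding contract_def map_poly_hom.hom_sum using assms
  by (intro sum.cong) (simp_all add: degree_map_poly_red block_offset_red block_offset_less)

lemma top_row_poly_red:
  assumes "\<And>f. f \<in> set fs \<Longrightarrow> lead_coeff f = 1" "i < length fs" "j < length fs" "0 < degree (fs ! i)"
    "W \<in> carrier_mat (block_offset fs (length fs)) (block_offset fs (length fs))"
  shows "map_poly red (top_row_poly fs W i j) = top_row_poly (map (map_poly red) fs) (map_mat red W) i j"
  unfolding top_row_poly_def map_poly_hom.hom_sum using assms
    block_offset_less[of i "length fs" "degree (fs ! i) - 1" fs]
  by (intro sum.cong) (simp_all add: degree_map_poly_red block_offset_red block_offset_less)

end

section \<open>Lifting matrices that commute with the companion blocks\<close>

lemma contract_smult_mat:
  assumes "W \<in> carrier_mat (block_offset fs (length fs)) (block_offset fs (length fs))"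
    and "i < length fs" "j < length fs"
  shows "contract fs (c \<cdot>\<^sub>m W) i j = Polynomial.smult c (contract fs W i j)"
proof -
  have "Polynomial.smult c (sum g S) = (\<Sum>x\<in>S. Polynomial.smult c (g x))" for g :: "nat \<Rightarrow> 'a poly" and S
    by (induction S rule: infinite_finite_induct) (auto simp: smult_add_right)
  then show ?thesis unfolding contract_def using assms
    by (simp add: smult_monom block_offset_less)
qed

context residue_map
begin

lemma mat_hom_minus:
  "M \<in> carrier_mat n m \<Longrightarrow> N \<in> carrier_mat n m \<Longrightarrow> map_mat red (M - N) = map_mat red M - map_mat red N"
  by (intro eq_matI) (auto simp: hom_distribs)

lemma mat_hom_transpose: "map_mat red (transpose_mat M) = transpose_mat (map_mat red M)"
  by (intro eq_matI) auto

text \<open>A lift \<open>Q\<close> of a matrix that commutes with \<open>A\<close> satisfies \<open>[Q, A0] = \<pi> K\<close>, and the obstruction \<open>K\<close>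
  is trivial modulo commutators. Contracting \<open>\<pi> K T = Q T A0\<^sup>T - A0 Q T\<close> gives
  \<open>\<pi> c = \<alpha> f\<^sub>i - \<beta> f\<^sub>j\<close>, where \<open>c\<close> is the contraction of \<open>K T\<close>. If, say, \<open>f\<^sub>j = h f\<^sub>i\<close>, the right-hand
  side is \<open>(\<alpha> - \<beta> h) f\<^sub>i\<close>. It vanishes over the field \<open>k\<close>, so \<open>\<alpha> - \<beta> h\<close> is itself a multiple of
  \<open>\<pi>\<close>, and cancelling \<open>\<pi>\<close> puts the reduction of \<open>c\<close> into the ideal \<open>(f\<^sub>i)\<close>.\<close>

lemma lift_commutes_up_to_commutator:
  fixes fs :: "'r poly list"
  defines "n \<equiv> block_offset fs (length fs)" and "A0 \<equiv> companion_blocks fs"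
    and "A \<equiv> companion_blocks (map (map_poly red) fs)"
  assumes fs: "\<And>f. f \<in> set fs \<Longrightarrow> lead_coeff f = 1 \<and> 0 < degree f"
    and chain: "\<And>f g. f \<in> set fs \<Longrightarrow> g \<in> set fs \<Longrightarrow> f dvd g \<or> g dvd f"
    and Q: "Q \<in> carrier_mat n n" and comm: "map_mat red Q * A = A * map_mat red Q"
  obtains X K where "X \<in> carrier_mat n n" "K \<in> carrier_mat n n"
    "Q * A0 - A0 * Q = \<pi> \<cdot>\<^sub>m K" "map_mat red K = A * X - X * A"
proof -
  let ?l = "length fs" and ?fs = "map (map_poly red) fs"
  have monic: "\<And>f. f \<in> set fs \<Longrightarrow> lead_coeff f = 1" using fs by blast
  have nk: "block_offset ?fs (length ?fs) = n"
    using block_offset_red[of fs, OF monic, of ?l] by (simp add: n_def)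
  define T where "T = hankel_blocks fs"
  define Tk where "Tk = hankel_blocks ?fs"
  have red_A: "map_mat red A0 = A" unfolding A0_def A_def using monic by (rule companion_blocks_red)
  have red_T: "map_mat red T = Tk" unfolding T_def Tk_def using monic by (rule hankel_blocks_red)
  have fs': "lead_coeff (fs ! i) = 1 \<and> 0 < degree (fs ! i)" if "i < ?l" for i using that fs by simp
  have fsk: "lead_coeff (?fs ! i) = 1 \<and> 0 < degree (?fs ! i)" if "i < length ?fs" for i
    using that fs' by (simp add: degree_map_poly_red)
  have A0: "A0 \<in> carrier_mat n n" unfolding A0_def n_def by (rule companion_blocks_carrier)
  have T: "T \<in> carrier_mat n n" unfolding T_def n_def by (rule hankel_blocks_carrier)
  have A: "A \<in> carrier_mat n n" using A0 red_A by auto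
  have Tk: "Tk \<in> carrier_mat n n" using T red_T by auto
  note [simp] = A0 T A Tk Q mult_carrier_mat[of _ n n _ n]
  have [simp]: "transpose_mat A0 \<in> carrier_mat n n" "transpose_mat A \<in> carrier_mat n n" by auto
  note assoc = assoc_mult_mat[of _ n n _ n _ n]
  have sym0: "A0 * T = T * transpose_mat A0" unfolding A0_def T_def by (rule companion_hankel_symmetric[OF fs'])
  have sym: "A * Tk = Tk * transpose_mat A" unfolding A_def Tk_def by (rule companion_hankel_symmetric[OF fsk])
  let ?Q = "map_mat red Q"
  have "map_mat red (Q * A0 - A0 * Q) = ?Q * A - A * ?Q"
    by (simp add: mat_hom_minus[of _ n n] mat_hom_mult[of _ n n _ n] red_A)
  then have "map_mat red (Q * A0 - A0 * Q) = 0\<^sub>m n n" unfolding comm by auto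
  then obtain K where K: "K \<in> carrier_mat n n" "Q * A0 - A0 * Q = \<pi> \<cdot>\<^sub>m K"
    using ex_smult_pi_mat[of "Q * A0 - A0 * Q" n n] by (auto simp: minus_carrier_mat)
  define G where "G = Q * T"
  have G: "G \<in> carrier_mat n n" by (simp add: G_def)
  have KT: "\<pi> \<cdot>\<^sub>m (K * T) = G * transpose_mat A0 - A0 * G"
  proof -
    have "\<pi> \<cdot>\<^sub>m (K * T) = (Q * A0 - A0 * Q) * T"
      unfolding K(2) using K(1) by (intro mult_smult_assoc_mat[of _ n n _ n, symmetric]) auto
    also have "\<dots> = Q * A0 * T - A0 * Q * T" by (intro minus_mult_distrib_mat[of _ n n _ _ n]) auto
    also have "\<dots> = G * transpose_mat A0 - A0 * G" unfolding G_def by (simp add: assoc sym0)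
    finally show ?thesis .
  qed
  define M where "M = map_mat red G"
  have M: "M \<in> carrier_mat n n" using G by (simp add: M_def)
  have commM: "M * transpose_mat A = A * M"
  proof -
    have M_eq: "M = ?Q * Tk" unfolding M_def G_def red_T[symmetric]
      by (intro mat_hom_mult[of _ n n _ n]) auto
    have "M * transpose_mat A = ?Q * A * Tk" unfolding M_eq by (simp add: assoc sym)
    also have "\<dots> = A * M" unfolding comm M_eq by (simp add: assoc)
    finally show ?thesis .
  qed
  have "\<exists>u v. contract ?fs (map_mat red K * Tk) i j = u * ?fs ! i + v * ?fs ! j"
    if ij: "i < length ?fs" "j < length ?fs" for i j
  proof -
    have ij': "i < ?l" "j < ?l" using ij by auto
    define \<alpha> where "\<alpha> = top_row_poly fs G i j"
    define \<beta> where "\<beta> = top_row_poly fs (transpose_mat G) j i"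
    have "Polynomial.smult \<pi> (contract fs (K * T) i j) = contract fs (G * transpose_mat A0 - A0 * G) i j"
      unfolding KT[symmetric] using ij' K(1) by (intro contract_smult_mat[symmetric]) (auto simp flip: n_def)
    also have "\<dots> = contract fs (G * transpose_mat A0) i j - contract fs (A0 * G) i j"
      using ij' G by (intro contract_minus) (auto simp flip: n_def)
    also have "\<dots> = \<alpha> * fs ! i - \<beta> * fs ! j"
      using ij' fs' G unfolding A0_def \<alpha>_def \<beta>_def
      by (subst contract_companion_right contract_companion_left; simp flip: n_def)+
    finally have c: "Polynomial.smult \<pi> (contract fs (K * T) i j) = \<alpha> * fs ! i - \<beta> * fs ! j" .
    have rc: "map_poly red (contract fs (K * T) i j) = contract ?fs (map_mat red K * Tk) i j"
      using ij' K(1) monic unfolding red_T[symmetric]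
      by (subst contract_red) (auto simp flip: n_def simp: mat_hom_mult[of _ n n _ n])
    have "contract ?fs (M * transpose_mat A) i j = contract ?fs (A * M) i j" unfolding commM ..
    then have "top_row_poly ?fs M i j * ?fs ! i = top_row_poly ?fs (transpose_mat M) j i * ?fs ! j"
      using ij fsk M nk contract_companion_right[of M ?fs i j] contract_companion_left[of M ?fs i j]
      by (simp flip: A_def)
    moreover have "top_row_poly ?fs M i j = map_poly red \<alpha>"
      "top_row_poly ?fs (transpose_mat M) j i = map_poly red \<beta>"
      unfolding \<alpha>_def \<beta>_def M_def using ij' fs' monic G
      by (simp_all add: top_row_poly_red n_def flip: mat_hom_transpose)
    ultimately have \<alpha>\<beta>: "map_poly red \<alpha> * ?fs ! i = map_poly red \<beta> * ?fs ! j" by simp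
    have nz: "?fs ! i \<noteq> 0" "?fs ! j \<noteq> 0" using fsk[OF ij(1)] fsk[OF ij(2)] by auto
    have "fs ! i dvd fs ! j \<or> fs ! j dvd fs ! i" using chain ij' by simp
    then show ?thesis
    proof
      assume "fs ! i dvd fs ! j"
      then obtain h where h: "fs ! j = fs ! i * h" by (elim dvdE)
      have "map_poly red (\<alpha> - \<beta> * h) * ?fs ! i = 0"
        using \<alpha>\<beta> ij' by (simp add: h hom_distribs algebra_simps)
      then have "map_poly red (\<alpha> - \<beta> * h) = 0" using nz by simp
      then obtain r where r: "\<alpha> - \<beta> * h = Polynomial.smult \<pi> r" using map_poly_red_eq_0 by blast
      have "Polynomial.smult \<pi> (contract fs (K * T) i j) = (\<alpha> - \<beta> * h) * fs ! i"
        unfolding c h by (simp add: algebra_simps)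
      also have "\<dots> = Polynomial.smult \<pi> (r * fs ! i)" unfolding r by simp
      finally have "contract ?fs (map_mat red K * Tk) i j = map_poly red r * ?fs ! i + 0 * ?fs ! j"
        unfolding rc[symmetric] smult_pi_eq_iff using ij' by (simp add: hom_distribs)
      then show ?thesis by blast
    next
      assume "fs ! j dvd fs ! i"
      then obtain h where h: "fs ! i = fs ! j * h" by (elim dvdE)
      have "map_poly red (\<alpha> * h - \<beta>) * ?fs ! j = 0"
        using \<alpha>\<beta> ij' by (simp add: h hom_distribs algebra_simps)
      then have "map_poly red (\<alpha> * h - \<beta>) = 0" using nz by simp
      then obtain r where r: "\<alpha> * h - \<beta> = Polynomial.smult \<pi> r" using map_poly_red_eq_0 by blast
      have "Polynomial.smult \<pi> (contract fs (K * T) i j) = (\<alpha> * h - \<beta>) * fs ! j"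
        unfolding c h by (simp add: algebra_simps)
      also have "\<dots> = Polynomial.smult \<pi> (r * fs ! j)" unfolding r by simp
      finally have "contract ?fs (map_mat red K * Tk) i j = 0 * ?fs ! i + map_poly red r * ?fs ! j"
        unfolding rc[symmetric] smult_pi_eq_iff using ij' by (simp add: hom_distribs)
      then show ?thesis by blast
    qed
  qed
  then obtain X where "X \<in> carrier_mat n n" "map_mat red K = A * X - X * A"
    using commutator_if_contract_mult_hankel_in_ideal[of ?fs "map_mat red K", OF fsk] K(1)
    unfolding nk Tk_def[symmetric] A_def[symmetric] by (metis map_carrier_mat)
  with K show thesis by (intro that[of X K])
qed

end

section \<open>Similarity of matrices that agree modulo \<open>\<pi>\<close>\<close>

lemma square_mat_eqI:
  assumes "M \<in> carrier_mat n n" "N \<in> carrier_mat n n" "\<And>i j. i < n \<Longrightarrow> j < n \<Longrightarrow> M $$ (i, j) = N $$ (i, j)"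
  shows "M = N"
  using assms by (intro eq_matI) auto

lemma index_square_mat:
  assumes "M \<in> carrier_mat n n" "N \<in> carrier_mat n n" "i < n" "j < n"
  shows "(M + N) $$ (i, j) = M $$ (i, j) + N $$ (i, j)" "(M - N) $$ (i, j) = M $$ (i, j) - N $$ (i, j)"
  using assms by auto

lemma index_square_mat':
  assumes "M \<in> carrier_mat n n" "i < n" "j < n"
  shows "(c \<cdot>\<^sub>m M) $$ (i, j) = c * M $$ (i, j)" "map_mat f M $$ (i, j) = f (M $$ (i, j))"
    "(- M) $$ (i, j) = - M $$ (i, j)"
  using assms by auto

context residue_map
begin

text \<open>A conjugating matrix \<open>Q\<close> reduces to a matrix \<open>g\<close> that commutes with \<open>A\<close>; comparing the multiples of
  \<open>\<pi>\<close> gives \<open>D' g - g D = K\<close> over \<open>k\<close>, where \<open>\<pi> K = [Q, A0]\<close>, and \<open>K\<close> is a commutator by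
  \<open>lift_commutes_up_to_commutator\<close>. Conversely a lift \<open>Q\<close> of \<open>g\<close> conjugates up to a commutator with \<open>A\<close>, which is
  absorbed by adding a multiple of \<open>\<pi>\<close> to \<open>Q\<close>.\<close>

lemma similar_deformations_iff:
  fixes fs :: "'r poly list"
  defines "n \<equiv> block_offset fs (length fs)" and "A0 \<equiv> companion_blocks fs"
    and "A \<equiv> companion_blocks (map (map_poly red) fs)"
  assumes fs: "\<And>f. f \<in> set fs \<Longrightarrow> lead_coeff f = 1 \<and> 0 < degree f"
    and chain: "\<And>f g. f \<in> set fs \<Longrightarrow> g \<in> set fs \<Longrightarrow> f dvd g \<or> g dvd f"
    and D: "D \<in> carrier_mat n n" and D': "D' \<in> carrier_mat n n"
  shows "similar_mat (A0 + \<pi> \<cdot>\<^sub>m D) (A0 + \<pi> \<cdot>\<^sub>m D') \<longleftrightarrow>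
    (\<exists>g\<in>carrier_mat n n. \<exists>h\<in>carrier_mat n n. \<exists>X\<in>carrier_mat n n.
       g * h = 1\<^sub>m n \<and> h * g = 1\<^sub>m n \<and> g * A = A * g \<and>
       g * map_mat red D * h - map_mat red D' = A * X - X * A)"
    (is "?L \<longleftrightarrow> ?R")
proof -
  have monic: "\<And>f. f \<in> set fs \<Longrightarrow> lead_coeff f = 1" using fs by blast
  have red_A: "map_mat red A0 = A" unfolding A0_def A_def using monic by (rule companion_blocks_red)
  have A0: "A0 \<in> carrier_mat n n" unfolding A0_def n_def by (rule companion_blocks_carrier)
  have A: "A \<in> carrier_mat n n" using A0 red_A by auto
  note [simp] = A0 A D D' mult_carrier_mat[of _ n n _ n] minus_carrier_mat
  note assoc = assoc_mult_mat[of _ n n _ n _ n]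
  note entry = index_square_mat[of _ n] index_square_mat'[of _ n]
    and opaque = index_mult_mat(1) index_add_mat(1) index_minus_mat(1) index_smult_mat(1) index_map_mat(1) index_uminus_mat(1)
  let ?D = "map_mat red D" and ?D' = "map_mat red D'"
  have red_def: "map_mat red (A0 + \<pi> \<cdot>\<^sub>m E) = A" if "E \<in> carrier_mat n n" for E
    using that unfolding red_A[symmetric] by (intro square_mat_eqI[of _ n]) (auto simp: entry hom_distribs simp del: opaque)
  show ?thesis
  proof
    assume ?L
    then obtain P Q where wit: "similar_mat_wit (A0 + \<pi> \<cdot>\<^sub>m D) (A0 + \<pi> \<cdot>\<^sub>m D') P Q"
      unfolding similar_mat_def by blast
    have c: "A0 + \<pi> \<cdot>\<^sub>m D \<in> carrier_mat n n" by simp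
    note w = similar_mat_witD2[OF c wit]
    have PQ [simp]: "P \<in> carrier_mat n n" "Q \<in> carrier_mat n n" using w by auto
    have "Q * (A0 + \<pi> \<cdot>\<^sub>m D) = (Q * P) * ((A0 + \<pi> \<cdot>\<^sub>m D') * Q)"
      unfolding w(3) using w(5) by (simp add: assoc)
    then have eq: "Q * (A0 + \<pi> \<cdot>\<^sub>m D) = (A0 + \<pi> \<cdot>\<^sub>m D') * Q"
      unfolding w(2) using w(5) by (simp add: left_mult_one_mat[of _ n n])
    let ?P = "map_mat red P" and ?Q = "map_mat red Q"
    have "?P * ?Q = 1\<^sub>m n" "?Q * ?P = 1\<^sub>m n"
      using arg_cong[OF w(1), of "map_mat red"] arg_cong[OF w(2), of "map_mat red"]
      by (simp_all add: mat_hom_mult[of _ n n _ n] mat_hom_one)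
    note inv = this
    have comm: "?Q * A = A * ?Q"
      using arg_cong[OF eq, of "map_mat red"] red_def[OF D] red_def[OF D']
      by (simp add: mat_hom_mult[of _ n n _ n])
    obtain X K where X: "X \<in> carrier_mat n n" and K: "K \<in> carrier_mat n n"
      "Q * A0 - A0 * Q = \<pi> \<cdot>\<^sub>m K" "map_mat red K = A * X - X * A"
      using lift_commutes_up_to_commutator[OF fs chain PQ(2)[unfolded n_def] comm[unfolded A_def]]
      unfolding n_def[symmetric] A_def[symmetric] A0_def[symmetric] by blast
    have exp: "Q * A0 + \<pi> \<cdot>\<^sub>m (Q * D) = A0 * Q + \<pi> \<cdot>\<^sub>m (D' * Q)"
      using eq mult_add_distrib_mat[of Q n n A0 n "\<pi> \<cdot>\<^sub>m D"] add_mult_distrib_mat[of A0 n n "\<pi> \<cdot>\<^sub>m D'" Q n]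
        mult_smult_distrib[of Q n n D n \<pi>] mult_smult_assoc_mat[of D' n n Q n \<pi>] by simp
    note [simp] = K(1) X
    have "\<pi> \<cdot>\<^sub>m (D' * Q - Q * D) = \<pi> \<cdot>\<^sub>m K"
    proof (rule square_mat_eqI[of _ n])
      fix i j assume ij: "i < n" "j < n"
      have "(Q * A0) $$ (i, j) - (A0 * Q) $$ (i, j) = \<pi> * K $$ (i, j)"
        using arg_cong[OF K(2), of "\<lambda>M. M $$ (i, j)"] ij by (simp del: opaque add: entry)
      moreover have "(Q * A0) $$ (i, j) + \<pi> * (Q * D) $$ (i, j) = (A0 * Q) $$ (i, j) + \<pi> * (D' * Q) $$ (i, j)"
        using arg_cong[OF exp, of "\<lambda>M. M $$ (i, j)"] ij by (simp del: opaque add: entry)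
      ultimately have "\<pi> * (D' * Q) $$ (i, j) - \<pi> * (Q * D) $$ (i, j) = \<pi> * K $$ (i, j)"
        by (simp add: algebra_simps del: opaque)
      then show "(\<pi> \<cdot>\<^sub>m (D' * Q - Q * D)) $$ (i, j) = (\<pi> \<cdot>\<^sub>m K) $$ (i, j)"
        using ij by (simp del: opaque add: entry right_diff_distrib)
    qed auto
    then have "map_mat red (D' * Q - Q * D) = map_mat red K"
      using smult_pi_mat_eq_iff[of "D' * Q - Q * D" n n K] by simp
    then have "?D' * ?Q - ?Q * ?D = A * X - X * A"
      unfolding K(3) by (simp add: mat_hom_minus[of _ n n] mat_hom_mult[of _ n n _ n])
    then have "(?D' * ?Q - ?Q * ?D) * ?P = (A * X - X * A) * ?P" by simp
    moreover have "(?D' * ?Q - ?Q * ?D) * ?P = ?D' * ?Q * ?P - ?Q * ?D * ?P"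
      by (intro minus_mult_distrib_mat[of _ n n _ _ n]) auto
    moreover have "(A * X - X * A) * ?P = A * X * ?P - X * A * ?P"
      using X by (intro minus_mult_distrib_mat[of _ n n _ _ n]) auto
    moreover have "?D' * ?Q * ?P = ?D'" using inv by (simp add: assoc right_mult_one_mat[of _ n n])
    moreover have "A * ?P = ?P * A"
      using inv comm by (intro commute_with_inverse_mat[of ?Q n ?P A]) simp_all
    ultimately have "?D' - ?Q * ?D * ?P = A * (X * ?P) - (X * ?P) * A"
      using X by (simp add: assoc)
    note diff = this
    define Z where "Z = - (X * ?P)"
    have Z [simp]: "Z \<in> carrier_mat n n" by (simp add: Z_def)
    have "A * Z = - (A * (X * ?P))" "Z * A = - ((X * ?P) * A)"
      unfolding Z_def using uminus_mult_right_mat[of A "X * ?P"] uminus_mult_left_mat[of "X * ?P" A]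
      by (simp_all add: carrier_matD[of _ n n])
    then have "?Q * ?D * ?P - ?D' = A * Z - Z * A"
    proof (intro square_mat_eqI[of _ n])
      fix i j assume ij: "i < n" "j < n"
      assume AZ: "A * Z = - (A * (X * ?P))" "Z * A = - ((X * ?P) * A)"
      show "(?Q * ?D * ?P - ?D') $$ (i, j) = (A * Z - Z * A) $$ (i, j)"
        unfolding AZ using arg_cong[OF diff, of "\<lambda>M. M $$ (i, j)"] ij
        by (simp del: opaque add: entry algebra_simps)
    qed auto
    then show ?R using inv comm Z by (intro bexI[of _ ?Q] bexI[of _ ?P] bexI[of _ Z] conjI) auto
  next
    assume ?R
    then obtain g h X where g: "g \<in> carrier_mat n n" and h: "h \<in> carrier_mat n n" and X: "X \<in> carrier_mat n n"
      and inv: "g * h = 1\<^sub>m n" "h * g = 1\<^sub>m n" and comm: "g * A = A * g"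
      and diff: "g * ?D * h - ?D' = A * X - X * A" by blast
    note [simp] = g h X
    obtain Q where Q: "Q \<in> carrier_mat n n" and red_Q: "map_mat red Q = g" using ex_mat_lift[OF g] by blast
    have comm': "map_mat red Q * A = A * map_mat red Q" using comm by (simp add: red_Q)
    obtain Y K where Y: "Y \<in> carrier_mat n n" and K: "K \<in> carrier_mat n n"
      "Q * A0 - A0 * Q = \<pi> \<cdot>\<^sub>m K" "map_mat red K = A * Y - Y * A"
      using lift_commutes_up_to_commutator[OF fs chain Q[unfolded n_def] comm'[unfolded A_def]]
      unfolding n_def[symmetric] A_def[symmetric] A0_def[symmetric] by blast
    \<comment> \<open>\<open>Q + \<pi> N\<close> conjugates exactly if over \<open>k\<close> the commutators \<open>[A, Y]\<close>, coming from \<open>Q\<close>,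
      and \<open>[A, X g]\<close>, coming from \<open>D\<close> and \<open>D'\<close>, add up to \<open>[A, N]\<close>.\<close>
    obtain N where N: "N \<in> carrier_mat n n" and red_N: "map_mat red N = X * g + Y"
      using ex_mat_lift[of "X * g + Y" n n] Y by auto
    note [simp] = Q Y K(1) N
    define Q' where "Q' = Q + \<pi> \<cdot>\<^sub>m N"
    have Q' [simp]: "Q' \<in> carrier_mat n n" by (simp add: Q'_def)
    have "map_mat red Q' = g" unfolding Q'_def red_Q[symmetric]
      by (intro square_mat_eqI[of _ n]) (auto simp: entry hom_distribs simp del: opaque)
    then have "red (det Q') = det g" by (simp flip: hom_det)
    moreover have "det g \<noteq> 0" using det_mult[OF g h] inv by auto
    ultimately have "det Q' dvd 1" using unit_if_red_nonzero by simp
    then obtain P where P: "P \<in> carrier_mat n n" "Q' * P = 1\<^sub>m n" "P * Q' = 1\<^sub>m n"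
      by (rule ex_inverse_mat_if_det_unit[OF Q'])
    have key: "Q' * (A0 + \<pi> \<cdot>\<^sub>m D) = (A0 + \<pi> \<cdot>\<^sub>m D') * Q'"
    proof -
      have 0: "(\<pi> \<cdot>\<^sub>m U) * (\<pi> \<cdot>\<^sub>m V) = 0\<^sub>m n n" if "U \<in> carrier_mat n n" "V \<in> carrier_mat n n" for U V
      proof -
        have "(\<pi> \<cdot>\<^sub>m U) * (\<pi> \<cdot>\<^sub>m V) = \<pi> \<cdot>\<^sub>m (\<pi> \<cdot>\<^sub>m (U * V))"
          using that mult_smult_assoc_mat[of U n n "\<pi> \<cdot>\<^sub>m V" n \<pi>] mult_smult_distrib[of U n n V n \<pi>] by simp
        also have "\<dots> = 0\<^sub>m n n"
        proof (rule square_mat_eqI[of _ n])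
          fix i j assume "i < n" "j < n"
          then show "(\<pi> \<cdot>\<^sub>m (\<pi> \<cdot>\<^sub>m (U * V))) $$ (i, j) = 0\<^sub>m n n $$ (i, j)"
            using that by (simp del: opaque add: entry pi_mult_eq_0_iff hom_distribs)
        qed (use that in auto)
        finally show ?thesis .
      qed
      have L: "Q' * (A0 + \<pi> \<cdot>\<^sub>m D) = (Q * A0 + \<pi> \<cdot>\<^sub>m (N * A0)) + \<pi> \<cdot>\<^sub>m (Q * D)"
      proof -
        have "Q' * (A0 + \<pi> \<cdot>\<^sub>m D) = Q' * A0 + Q' * (\<pi> \<cdot>\<^sub>m D)"
          by (intro mult_add_distrib_mat[of _ n n _ n]) auto
        also have "Q' * A0 = Q * A0 + (\<pi> \<cdot>\<^sub>m N) * A0" unfolding Q'_def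
          by (intro add_mult_distrib_mat[of _ n n _ _ n]) auto
        also have "(\<pi> \<cdot>\<^sub>m N) * A0 = \<pi> \<cdot>\<^sub>m (N * A0)" by (intro mult_smult_assoc_mat[of _ n n _ n]) auto
        also have "Q' * (\<pi> \<cdot>\<^sub>m D) = Q * (\<pi> \<cdot>\<^sub>m D) + (\<pi> \<cdot>\<^sub>m N) * (\<pi> \<cdot>\<^sub>m D)" unfolding Q'_def
          by (intro add_mult_distrib_mat[of _ n n _ _ n]) auto
        also have "(\<pi> \<cdot>\<^sub>m N) * (\<pi> \<cdot>\<^sub>m D) = 0\<^sub>m n n" by (intro 0) auto
        also have "Q * (\<pi> \<cdot>\<^sub>m D) = \<pi> \<cdot>\<^sub>m (Q * D)" by (intro mult_smult_distrib[of _ n n _ n]) auto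
        finally show ?thesis by (simp add: right_add_zero_mat[of _ n n])
      qed
      have R: "(A0 + \<pi> \<cdot>\<^sub>m D') * Q' = (A0 * Q + \<pi> \<cdot>\<^sub>m (A0 * N)) + \<pi> \<cdot>\<^sub>m (D' * Q)"
      proof -
        have "(A0 + \<pi> \<cdot>\<^sub>m D') * Q' = A0 * Q' + (\<pi> \<cdot>\<^sub>m D') * Q'"
          by (intro add_mult_distrib_mat[of _ n n _ _ n]) auto
        also have "A0 * Q' = A0 * Q + A0 * (\<pi> \<cdot>\<^sub>m N)" unfolding Q'_def
          by (intro mult_add_distrib_mat[of _ n n _ n]) auto
        also have "A0 * (\<pi> \<cdot>\<^sub>m N) = \<pi> \<cdot>\<^sub>m (A0 * N)" by (intro mult_smult_distrib[of _ n n _ n]) auto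
        also have "(\<pi> \<cdot>\<^sub>m D') * Q' = (\<pi> \<cdot>\<^sub>m D') * Q + (\<pi> \<cdot>\<^sub>m D') * (\<pi> \<cdot>\<^sub>m N)" unfolding Q'_def
          by (intro mult_add_distrib_mat[of _ n n _ n]) auto
        also have "(\<pi> \<cdot>\<^sub>m D') * (\<pi> \<cdot>\<^sub>m N) = 0\<^sub>m n n" by (intro 0) auto
        also have "(\<pi> \<cdot>\<^sub>m D') * Q = \<pi> \<cdot>\<^sub>m (D' * Q)" by (intro mult_smult_assoc_mat[of _ n n _ n]) auto
        finally show ?thesis by (simp add: right_add_zero_mat[of _ n n])
      qed
      have "(g * ?D * h - ?D') * g = g * ?D * h * g - ?D' * g"
        by (intro minus_mult_distrib_mat[of _ n n _ _ n]) auto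
      also have "g * ?D * h * g = g * ?D" using inv by (simp add: assoc right_mult_one_mat[of _ n n])
      finally have "g * ?D - ?D' * g = (A * X - X * A) * g" unfolding diff ..
      also have "\<dots> = A * X * g - X * A * g" by (intro minus_mult_distrib_mat[of _ n n _ _ n]) auto
      also have "\<dots> = A * (X * g) - (X * g) * A" by (simp add: assoc comm)
      finally have diff_g: "g * ?D - ?D' * g = A * (X * g) - (X * g) * A" .
      have redNA: "map_mat red (N * A0) = (X * g) * A + Y * A"
        unfolding mat_hom_mult[OF N A0] red_N red_A
        by (intro add_mult_distrib_mat[of _ n n _ _ n]) auto
      have redAN: "map_mat red (A0 * N) = A * (X * g) + A * Y"
        unfolding mat_hom_mult[OF A0 N] red_N red_A
        by (intro mult_add_distrib_mat[of _ n n _ n]) auto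
      have redQD: "map_mat red (Q * D) = g * ?D" "map_mat red (D' * Q) = ?D' * g"
        by (simp_all add: mat_hom_mult[of _ n n _ n] red_Q)
      show ?thesis unfolding L R
      proof (rule square_mat_eqI[of _ n])
        fix i j assume ij: "i < n" "j < n"
        have k: "(Q * A0) $$ (i, j) = (A0 * Q) $$ (i, j) + \<pi> * K $$ (i, j)"
          using arg_cong[OF K(2), of "\<lambda>M. M $$ (i, j)"] ij by (simp del: opaque add: entry algebra_simps)
        note ij_red = arg_cong[of "map_mat red _" _ "\<lambda>M. M $$ (i, j)"]
        have "red (K $$ (i, j) + (N * A0) $$ (i, j) + (Q * D) $$ (i, j))
            = red ((A0 * N) $$ (i, j) + (D' * Q) $$ (i, j))"
          using ij_red[OF redNA] ij_red[OF redAN] ij_red[OF redQD(1)] ij_red[OF redQD(2)] ij_red[OF K(3)]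
            arg_cong[OF diff_g, of "\<lambda>M. M $$ (i, j)"] ij
          by (simp del: opaque add: entry hom_distribs algebra_simps)
        then have "\<pi> * (K $$ (i, j) + (N * A0) $$ (i, j) + (Q * D) $$ (i, j))
            = \<pi> * ((A0 * N) $$ (i, j) + (D' * Q) $$ (i, j))"
          by (simp only: pi_mult_eq_iff)
        then show "(Q * A0 + \<pi> \<cdot>\<^sub>m (N * A0) + \<pi> \<cdot>\<^sub>m (Q * D)) $$ (i, j)
            = (A0 * Q + \<pi> \<cdot>\<^sub>m (A0 * N) + \<pi> \<cdot>\<^sub>m (D' * Q)) $$ (i, j)"
          using ij by (simp del: opaque add: entry k distrib_left add.assoc)
      qed auto
    qed
    have "A0 + \<pi> \<cdot>\<^sub>m D = (P * Q') * (A0 + \<pi> \<cdot>\<^sub>m D)" unfolding P(3) by (simp add: left_mult_one_mat[of _ n n])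
    also have "\<dots> = P * (A0 + \<pi> \<cdot>\<^sub>m D') * Q'" using P(1) by (simp add: assoc key)
    finally have "similar_mat_wit (A0 + \<pi> \<cdot>\<^sub>m D) (A0 + \<pi> \<cdot>\<^sub>m D') P Q'"
      using P by (intro similar_mat_witI[of _ _ n]) auto
    then show ?L unfolding similar_mat_def by blast
  qed
qed

end

text \<open>Matrices modulo commutators with \<open>A\<close> are the self-extensions of the module of \<open>A\<close>. That the map to
  matrices with entries in \<open>k[t]/(f\<^sub>i, f\<^sub>j)\<close> is well defined and injective on them is the content here.\<close>

lemma commutator_iff_contract_in_ideal:
  fixes fs :: "'a :: field poly list"
  defines "n \<equiv> block_offset fs (length fs)"
  assumes fs: "\<And>i. i < length fs \<Longrightarrow> lead_coeff (fs ! i) = 1 \<and> 0 < degree (fs ! i)"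
    and D: "D \<in> carrier_mat n n" and D': "D' \<in> carrier_mat n n"
  shows "(\<exists>X\<in>carrier_mat n n. D - D' = companion_blocks fs * X - X * companion_blocks fs) \<longleftrightarrow>
    (\<forall>i<length fs. \<forall>j<length fs. \<exists>u v.
       contract fs (D * hankel_blocks fs) i j - contract fs (D' * hankel_blocks fs) i j = u * fs ! i + v * fs ! j)"
    (is "?L \<longleftrightarrow> ?R")
proof -
  let ?T = "hankel_blocks fs"
  have T: "?T \<in> carrier_mat n n" unfolding n_def by (rule hankel_blocks_carrier)
  have DT: "D * ?T \<in> carrier_mat n n" "D' * ?T \<in> carrier_mat n n" using D D' T by auto
  have eq: "contract fs (D * ?T) i j - contract fs (D' * ?T) i j = contract fs ((D - D') * ?T) i j"
    if "i < length fs" "j < length fs" for i j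
    using that contract_minus[of "D * ?T" fs "D' * ?T" i j] DT minus_mult_distrib_mat[OF D D' T]
    by (simp flip: n_def)
  have DD: "D - D' \<in> carrier_mat n n" using D' by (rule minus_carrier_mat)
  show ?thesis
  proof
    assume ?L
    then show ?R using contract_commutator_in_ideal[OF fs] by (auto simp: eq n_def)
  next
    assume ?R
    then have "\<exists>u v. contract fs ((D - D') * ?T) i j = u * fs ! i + v * fs ! j"
      if "i < length fs" "j < length fs" for i j using that eq by simp
    then show ?L
      using commutator_if_contract_mult_hankel_in_ideal[OF fs DD[unfolded n_def]] unfolding n_def by blast
  qed
qed

context residue_map
begin

text \<open>Conjugating \<open>(A0 + \<pi> D)\<^sup>T\<close> by \<open>T\<close> gives \<open>A0 + \<pi> D'\<close> with \<open>D' T = T D\<^sup>T = (D T)\<^sup>T\<close>. Hence the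
  contractions of \<open>D' T\<close> are those of \<open>D T\<close> with the indices exchanged: transposing the matrix over \<open>R\<close>
  corresponds to transposing the matrix of contractions.\<close>

lemma similar_transpose_iff:
  fixes fs :: "'r poly list"
  defines "n \<equiv> block_offset fs (length fs)" and "A0 \<equiv> companion_blocks fs"
    and "gs \<equiv> map (map_poly red) fs"
  assumes fs: "\<And>f. f \<in> set fs \<Longrightarrow> lead_coeff f = 1 \<and> 0 < degree f"
    and chain: "\<And>f g. f \<in> set fs \<Longrightarrow> g \<in> set fs \<Longrightarrow> f dvd g \<or> g dvd f"
    and D: "D \<in> carrier_mat n n" and B: "B = A0 + \<pi> \<cdot>\<^sub>m D"
  shows "similar_mat B (transpose_mat B) \<longleftrightarrow>
    (\<exists>g\<in>carrier_mat n n. \<exists>h\<in>carrier_mat n n.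
       g * h = 1\<^sub>m n \<and> h * g = 1\<^sub>m n \<and> g * companion_blocks gs = companion_blocks gs * g \<and>
       (\<forall>i<length gs. \<forall>j<length gs. \<exists>u v.
          contract gs (g * map_mat red D * h * hankel_blocks gs) i j
          - contract gs (map_mat red D * hankel_blocks gs) j i = u * gs ! i + v * gs ! j))"
proof -
  have monic: "\<And>f. f \<in> set fs \<Longrightarrow> lead_coeff f = 1" using fs by blast
  define A where "A = companion_blocks gs"
  define T where "T = hankel_blocks fs"
  define Tk where "Tk = hankel_blocks gs"
  have red_T: "map_mat red T = Tk" unfolding T_def Tk_def gs_def using monic by (rule hankel_blocks_red)
  have nk: "block_offset gs (length gs) = n"
    using block_offset_red[of fs, OF monic, of "length fs"] by (simp add: n_def gs_def)
  have fs': "lead_coeff (fs ! i) = 1 \<and> 0 < degree (fs ! i)" if "i < length fs" for i using that fs by simp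
  have gs: "lead_coeff (gs ! i) = 1 \<and> 0 < degree (gs ! i)" if "i < length gs" for i
    using that fs' by (simp add: degree_map_poly_red gs_def)
  have A0: "A0 \<in> carrier_mat n n" unfolding A0_def n_def by (rule companion_blocks_carrier)
  have A: "A \<in> carrier_mat n n" unfolding A_def nk[symmetric] by (rule companion_blocks_carrier)
  have T: "T \<in> carrier_mat n n" unfolding T_def n_def by (rule hankel_blocks_carrier)
  have Tk: "Tk \<in> carrier_mat n n" using T red_T by auto
  have "red (det T) \<noteq> 0" unfolding hom_det[symmetric] red_T Tk_def
    by (rule det_hankel_blocks_nonzero) (use gs in blast)
  then obtain S where S: "S \<in> carrier_mat n n" "T * S = 1\<^sub>m n" "S * T = 1\<^sub>m n"
    using ex_inverse_mat_if_det_unit[OF T] unit_if_red_nonzero by blast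
  have Dt: "transpose_mat D \<in> carrier_mat n n" using D by simp
  note [simp] = A0 A T Tk S(1) D Dt mult_carrier_mat[of _ n n _ n] minus_carrier_mat
  note assoc = assoc_mult_mat[of _ n n _ n _ n]
  define D' where "D' = T * transpose_mat D * S"
  have D' [simp]: "D' \<in> carrier_mat n n" by (simp add: D'_def)
  have A0t: "transpose_mat A0 \<in> carrier_mat n n" by simp
  have sym0: "A0 * T = T * transpose_mat A0" unfolding A0_def T_def by (rule companion_hankel_symmetric[OF fs'])
  have Bt: "transpose_mat B = transpose_mat A0 + \<pi> \<cdot>\<^sub>m transpose_mat D"
    unfolding B by (auto simp: mat_eq_iff carrier_matD[OF A0] carrier_matD[OF D])
  have conj: "A0 + \<pi> \<cdot>\<^sub>m D' = T * transpose_mat B * S"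
  proof -
    have "T * transpose_mat B = T * transpose_mat A0 + T * (\<pi> \<cdot>\<^sub>m transpose_mat D)"
      unfolding Bt by (intro mult_add_distrib_mat[of _ n n _ n]) auto
    also have "T * (\<pi> \<cdot>\<^sub>m transpose_mat D) = \<pi> \<cdot>\<^sub>m (T * transpose_mat D)"
      by (intro mult_smult_distrib[of _ n n _ n]) auto
    finally have "T * transpose_mat B * S = A0 * T * S + \<pi> \<cdot>\<^sub>m (T * transpose_mat D) * S"
      unfolding sym0[symmetric] by (simp add: add_mult_distrib_mat[of _ n n _ _ n])
    also have "A0 * T * S = A0" using S by (simp add: assoc right_mult_one_mat[of _ n n])
    also have "\<pi> \<cdot>\<^sub>m (T * transpose_mat D) * S = \<pi> \<cdot>\<^sub>m D'" unfolding D'_def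
      by (intro mult_smult_assoc_mat[of _ n n _ n]) auto
    finally show ?thesis ..
  qed
  have "similar_mat_wit (A0 + \<pi> \<cdot>\<^sub>m D') (transpose_mat B) T S"
    using S(2,3) conj by (intro similar_mat_witI[of _ _ n]) (auto simp: Bt)
  then have "similar_mat (A0 + \<pi> \<cdot>\<^sub>m D') (transpose_mat B)" unfolding similar_mat_def by blast
  then have "similar_mat B (transpose_mat B) \<longleftrightarrow> similar_mat (A0 + \<pi> \<cdot>\<^sub>m D) (A0 + \<pi> \<cdot>\<^sub>m D')"
    unfolding B[symmetric] by (meson similar_mat_trans similar_mat_sym)
  also have "\<dots> \<longleftrightarrow> (\<exists>g\<in>carrier_mat n n. \<exists>h\<in>carrier_mat n n. \<exists>X\<in>carrier_mat n n.
       g * h = 1\<^sub>m n \<and> h * g = 1\<^sub>m n \<and> g * A = A * g \<and>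
       g * map_mat red D * h - map_mat red D' = A * X - X * A)"
    unfolding A0_def A_def gs_def n_def
    by (rule similar_deformations_iff[OF fs chain D[unfolded n_def] D'[unfolded n_def]])
  also have "\<dots> \<longleftrightarrow> (\<exists>g\<in>carrier_mat n n. \<exists>h\<in>carrier_mat n n.
       g * h = 1\<^sub>m n \<and> h * g = 1\<^sub>m n \<and> g * A = A * g \<and>
       (\<exists>X\<in>carrier_mat n n. g * map_mat red D * h - map_mat red D' = A * X - X * A))"
    by blast
  also have "\<dots> \<longleftrightarrow> (\<exists>g\<in>carrier_mat n n. \<exists>h\<in>carrier_mat n n.
       g * h = 1\<^sub>m n \<and> h * g = 1\<^sub>m n \<and> g * A = A * g \<and>
       (\<forall>i<length gs. \<forall>j<length gs. \<exists>u v.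
          contract gs (g * map_mat red D * h * Tk) i j
          - contract gs (map_mat red D * Tk) j i = u * gs ! i + v * gs ! j))"
  proof -
    have "map_mat red D' * Tk = transpose_mat (map_mat red D * Tk)"
    proof -
      have "map_mat red D' * Tk = map_mat red (D' * T)" unfolding red_T[symmetric]
        by (simp add: mat_hom_mult[of _ n n _ n])
      also have "D' * T = T * transpose_mat D" unfolding D'_def
        using S(3) by (simp add: assoc right_mult_one_mat[of _ n n])
      also have "\<dots> = transpose_mat (D * T)"
        using transpose_mult[OF D T] transpose_hankel_blocks[of fs] by (simp add: T_def)
      finally show ?thesis unfolding mat_hom_transpose by (simp add: mat_hom_mult[of _ n n _ n] red_T)
    qed
    then have swap: "contract gs (map_mat red D' * Tk) i j = contract gs (map_mat red D * Tk) j i"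
      if "i < length gs" "j < length gs" for i j
      using that contract_transpose[of "map_mat red D * Tk" gs i j] nk by simp
    have "(\<exists>X\<in>carrier_mat n n. g * map_mat red D * h - map_mat red D' = A * X - X * A) \<longleftrightarrow>
       (\<forall>i<length gs. \<forall>j<length gs. \<exists>u v.
          contract gs (g * map_mat red D * h * Tk) i j
          - contract gs (map_mat red D * Tk) j i = u * gs ! i + v * gs ! j)"
      if "g \<in> carrier_mat n n" "h \<in> carrier_mat n n" for g h
      using commutator_iff_contract_in_ideal[of gs "g * map_mat red D * h" "map_mat red D'", OF gs]
        that swap unfolding nk A_def Tk_def by auto
    then show ?thesis by (intro bex_cong refl) blast
  qed
  finally show ?thesis unfolding A_def Tk_def .
qed

end

section \<open>Coordinates of an extension\<close>

definition coefficient_linear ::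
  "('r :: comm_ring_1 poly, 'm) module \<Rightarrow> nat \<Rightarrow> ('r vec \<Rightarrow> 'm) \<Rightarrow> bool" where
  "coefficient_linear M n \<sigma> \<longleftrightarrow> (\<forall>v\<in>carrier_vec n. \<sigma> v \<in> carrier M \<and>
     (\<forall>r. \<sigma> (r \<cdot>\<^sub>v v) = [:r:] \<odot>\<^bsub>M\<^esub> \<sigma> v) \<and>
     (\<forall>w\<in>carrier_vec n. \<sigma> (v + w) = \<sigma> v \<oplus>\<^bsub>M\<^esub> \<sigma> w))"

lemma coefficient_linearI:
  assumes "\<And>v. v \<in> carrier_vec n \<Longrightarrow> \<sigma> v \<in> carrier M"
    "\<And>v r. v \<in> carrier_vec n \<Longrightarrow> \<sigma> (r \<cdot>\<^sub>v v) = [:r:] \<odot>\<^bsub>M\<^esub> \<sigma> v"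
    "\<And>v w. v \<in> carrier_vec n \<Longrightarrow> w \<in> carrier_vec n \<Longrightarrow> \<sigma> (v + w) = \<sigma> v \<oplus>\<^bsub>M\<^esub> \<sigma> w"
  shows "coefficient_linear M n \<sigma>"
  using assms by (simp add: coefficient_linear_def)

lemma coefficient_linearD:
  assumes "coefficient_linear M n \<sigma>" "v \<in> carrier_vec n"
  shows "\<sigma> v \<in> carrier M" "\<sigma> (r \<cdot>\<^sub>v v) = [:r:] \<odot>\<^bsub>M\<^esub> \<sigma> v"
    "w \<in> carrier_vec n \<Longrightarrow> \<sigma> (v + w) = \<sigma> v \<oplus>\<^bsub>M\<^esub> \<sigma> w"
  using assms by (auto simp: coefficient_linear_def)

lemma coefficient_linear_expand:
  assumes "Module.module class_ring M" and \<sigma>: "coefficient_linear M n \<sigma>" and v: "v \<in> carrier_vec n"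
  shows "\<sigma> v = (\<Oplus>\<^bsub>M\<^esub>i\<in>{..<n}. [:v $ i:] \<odot>\<^bsub>M\<^esub> \<sigma> (unit_vec n i))"
proof -
  interpret M: Module.module class_ring M by fact
  have sm: "p \<odot>\<^bsub>M\<^esub> x \<in> carrier M" if "x \<in> carrier M" for p x using that M.smult_closed by simp
  have unit: "[:v $ i:] \<odot>\<^bsub>M\<^esub> \<sigma> (unit_vec n i) \<in> carrier M" for i
    using coefficient_linearD(1)[OF \<sigma>] by (intro sm) simp
  let ?w = "\<lambda>m. vec n (\<lambda>i. if i < m then v $ i else 0)"
  have claim: "\<sigma> (?w m) = (\<Oplus>\<^bsub>M\<^esub>i\<in>{..<m}. [:v $ i:] \<odot>\<^bsub>M\<^esub> \<sigma> (unit_vec n i))" if "m \<le> n" for m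
    using that
  proof (induction m)
    case 0
    have "?w 0 = 0 \<cdot>\<^sub>v 0\<^sub>v n" by (intro eq_vecI) auto
    then have "\<sigma> (?w 0) = [:0:] \<odot>\<^bsub>M\<^esub> \<sigma> (0\<^sub>v n)" using coefficient_linearD(2)[OF \<sigma>, of "0\<^sub>v n" 0] by simp
    also have "\<dots> = \<zero>\<^bsub>M\<^esub>" using M.smult_l_null coefficient_linearD(1)[OF \<sigma>, of "0\<^sub>v n"] by simp
    finally show ?case by simp
  next
    case (Suc m)
    have "?w (Suc m) = v $ m \<cdot>\<^sub>v unit_vec n m + ?w m"
      using Suc.prems by (intro eq_vecI) (auto simp: less_Suc_eq)
    then have "\<sigma> (?w (Suc m)) = \<sigma> (v $ m \<cdot>\<^sub>v unit_vec n m) \<oplus>\<^bsub>M\<^esub> \<sigma> (?w m)"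
      using coefficient_linearD(3)[OF \<sigma>, of "v $ m \<cdot>\<^sub>v unit_vec n m" "?w m"] by simp
    also have "\<sigma> (v $ m \<cdot>\<^sub>v unit_vec n m) = [:v $ m:] \<odot>\<^bsub>M\<^esub> \<sigma> (unit_vec n m)"
      using coefficient_linearD(2)[OF \<sigma>] by simp
    finally show ?case using Suc unit unfolding lessThan_Suc by (simp add: M.finsum_insert)
  qed
  have "?w n = v" using v by (intro eq_vecI) auto
  with claim[of n] show ?thesis by simp
qed

lemma coefficient_linear_eqI:
  assumes "Module.module class_ring M" "coefficient_linear M n \<sigma>" "coefficient_linear M n \<tau>"
    and "\<And>i. i < n \<Longrightarrow> \<sigma> (unit_vec n i) = \<tau> (unit_vec n i)" and "v \<in> carrier_vec n"
  shows "\<sigma> v = \<tau> v"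
proof -
  interpret M: Module.module class_ring M by fact
  have "[:v $ i:] \<odot>\<^bsub>M\<^esub> \<tau> (unit_vec n i) \<in> carrier M" for i
    using coefficient_linearD(1)[OF assms(3)] M.smult_closed by simp
  then show ?thesis
    unfolding coefficient_linear_expand[OF assms(1,2,5)] coefficient_linear_expand[OF assms(1,3,5)]
    using assms(4) by (intro M.finsum_cong') auto
qed

lemma coefficient_linear_comb:
  assumes "Module.module class_ring M" and b: "\<And>i. i < n \<Longrightarrow> b i \<in> carrier M"
  shows "coefficient_linear M n (\<lambda>v. \<Oplus>\<^bsub>M\<^esub>i\<in>{..<n}. [:v $ i:] \<odot>\<^bsub>M\<^esub> b i)"
    and "j < n \<Longrightarrow> (\<Oplus>\<^bsub>M\<^esub>i\<in>{..<n}. [:unit_vec n j $ i:] \<odot>\<^bsub>M\<^esub> b i) = b j"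
proof -
  interpret M: Module.module class_ring M by fact
  have sm: "p \<odot>\<^bsub>M\<^esub> b i \<in> carrier M" if "i < n" for p i using that b M.smult_closed by simp
  show "coefficient_linear M n (\<lambda>v. \<Oplus>\<^bsub>M\<^esub>i\<in>{..<n}. [:v $ i:] \<odot>\<^bsub>M\<^esub> b i)"
  proof (rule coefficient_linearI)
    fix v w :: "'a vec" and r assume v: "v \<in> carrier_vec n" and w: "w \<in> carrier_vec n"
    show "(\<Oplus>\<^bsub>M\<^esub>i\<in>{..<n}. [:v $ i:] \<odot>\<^bsub>M\<^esub> b i) \<in> carrier M" using sm by (intro M.finsum_closed) auto
    have "[:r:] \<odot>\<^bsub>M\<^esub> (\<Oplus>\<^bsub>M\<^esub>i\<in>{..<n}. [:v $ i:] \<odot>\<^bsub>M\<^esub> b i)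
        = (\<Oplus>\<^bsub>M\<^esub>i\<in>{..<n}. [:r:] \<odot>\<^bsub>M\<^esub> ([:v $ i:] \<odot>\<^bsub>M\<^esub> b i))"
      using sm by (intro M.finsum_smult_ldistr) auto
    also have "\<dots> = (\<Oplus>\<^bsub>M\<^esub>i\<in>{..<n}. [:(r \<cdot>\<^sub>v v) $ i:] \<odot>\<^bsub>M\<^esub> b i)"
    proof (intro M.finsum_cong' refl)
      fix i assume "i \<in> {..<n}"
      then show "[:r:] \<odot>\<^bsub>M\<^esub> ([:v $ i:] \<odot>\<^bsub>M\<^esub> b i) = [:(r \<cdot>\<^sub>v v) $ i:] \<odot>\<^bsub>M\<^esub> b i"
        using M.smult_assoc1[of "[:r:]" "[:v $ i:]" "b i"] b v by (simp add: mult.commute)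
    qed (use sm in auto)
    finally show "(\<Oplus>\<^bsub>M\<^esub>i\<in>{..<n}. [:(r \<cdot>\<^sub>v v) $ i:] \<odot>\<^bsub>M\<^esub> b i)
        = [:r:] \<odot>\<^bsub>M\<^esub> (\<Oplus>\<^bsub>M\<^esub>i\<in>{..<n}. [:v $ i:] \<odot>\<^bsub>M\<^esub> b i)" ..
    have "(\<Oplus>\<^bsub>M\<^esub>i\<in>{..<n}. [:(v + w) $ i:] \<odot>\<^bsub>M\<^esub> b i)
        = (\<Oplus>\<^bsub>M\<^esub>i\<in>{..<n}. [:v $ i:] \<odot>\<^bsub>M\<^esub> b i \<oplus>\<^bsub>M\<^esub> [:w $ i:] \<odot>\<^bsub>M\<^esub> b i)"
    proof (intro M.finsum_cong' refl)
      fix i assume "i \<in> {..<n}"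
      then show "[:(v + w) $ i:] \<odot>\<^bsub>M\<^esub> b i = [:v $ i:] \<odot>\<^bsub>M\<^esub> b i \<oplus>\<^bsub>M\<^esub> [:w $ i:] \<odot>\<^bsub>M\<^esub> b i"
        using M.smult_l_distr[of "[:v $ i:]" "[:w $ i:]" "b i"] b v w by simp
    qed (use sm in auto)
    also have "\<dots> = (\<Oplus>\<^bsub>M\<^esub>i\<in>{..<n}. [:v $ i:] \<odot>\<^bsub>M\<^esub> b i) \<oplus>\<^bsub>M\<^esub> (\<Oplus>\<^bsub>M\<^esub>i\<in>{..<n}. [:w $ i:] \<odot>\<^bsub>M\<^esub> b i)"
      using sm by (intro M.finsum_addf) auto
    finally show "(\<Oplus>\<^bsub>M\<^esub>i\<in>{..<n}. [:(v + w) $ i:] \<odot>\<^bsub>M\<^esub> b i)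
        = (\<Oplus>\<^bsub>M\<^esub>i\<in>{..<n}. [:v $ i:] \<odot>\<^bsub>M\<^esub> b i) \<oplus>\<^bsub>M\<^esub> (\<Oplus>\<^bsub>M\<^esub>i\<in>{..<n}. [:w $ i:] \<odot>\<^bsub>M\<^esub> b i)" .
  qed
  assume j: "j < n"
  have "(\<Oplus>\<^bsub>M\<^esub>i\<in>{..<n}. [:unit_vec n j $ i:] \<odot>\<^bsub>M\<^esub> b i) = (\<Oplus>\<^bsub>M\<^esub>i\<in>{..<n}. if j = i then b i else \<zero>\<^bsub>M\<^esub>)"
  proof (intro M.finsum_cong' refl)
    fix i assume "i \<in> {..<n}"
    then show "[:unit_vec n j $ i:] \<odot>\<^bsub>M\<^esub> b i = (if j = i then b i else \<zero>\<^bsub>M\<^esub>)"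
      using b j M.smult_one[of "b i"] M.smult_l_null[of "b i"] by (auto simp flip: one_pCons)
  qed (use b in auto)
  also have "\<dots> = b j" using j b by (intro M.finsum_singleton) auto
  finally show "(\<Oplus>\<^bsub>M\<^esub>i\<in>{..<n}. [:unit_vec n j $ i:] \<odot>\<^bsub>M\<^esub> b i) = b j" .
qed

text \<open>An \<open>R[t]\<close>-module structure on \<open>k\<^sup>n\<close> is determined by the action of the constants and of \<open>t\<close>. With
  \<open>red = id\<close> the predicate describes the \<open>k[t]\<close>-module of \<open>A\<close>, and in general its restriction to \<open>R[t]\<close>.\<close>

definition module_of_matrix ::
  "('r :: comm_ring_1 \<Rightarrow> 'k :: comm_ring_1) \<Rightarrow> 'k mat \<Rightarrow> ('r poly, 'k vec) module \<Rightarrow> bool" where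
  "module_of_matrix red A N \<longleftrightarrow> comm_ring_hom red \<and> A \<in> carrier_mat (dim_row A) (dim_row A) \<and>
     carrier N = carrier_vec (dim_row A) \<and> add N = (+) \<and> zero N = 0\<^sub>v (dim_row A) \<and>
     (\<forall>v\<in>carrier_vec (dim_row A). (\<forall>r. [:r:] \<odot>\<^bsub>N\<^esub> v = red r \<cdot>\<^sub>v v) \<and> monom 1 1 \<odot>\<^bsub>N\<^esub> v = A *\<^sub>v v)"

text \<open>The \<open>R\<close>-linear map \<open>s\<close> from \<open>R\<^sup>n\<close> lifts the reduction \<open>R\<^sup>n \<rightarrow> k\<^sup>n\<close> through the middle term. It fails
  to commute with \<open>t\<close> by the matrix \<open>D\<close>, and \<open>U\<close> records multiplication by \<open>\<pi>\<close> on the middle term.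
  With \<open>red = id\<close> and \<open>\<pi> = 0\<close> these are coordinates of an extension of \<open>k[t]\<close>-modules, where \<open>U = 0\<close>
  always works; the middle term is free over \<open>R\<close> when \<open>U = 1\<close>. Using one notion for both rings
  makes restriction of scalars and Baer sums a matter of comparing \<open>U\<close> and \<open>D\<close>.\<close>

definition extension_coordinates ::
  "('r :: comm_ring_1 \<Rightarrow> 'k :: comm_ring_1) \<Rightarrow> 'r \<Rightarrow> 'r mat \<Rightarrow> ('r poly, 'k vec, 'm, 'k vec) extension
    \<Rightarrow> ('r vec \<Rightarrow> 'm) \<Rightarrow> 'k mat \<Rightarrow> 'k mat \<Rightarrow> bool" where
  "extension_coordinates red \<pi> A0 X s U D \<longleftrightarrow> coefficient_linear (middle X) (dim_row A0) s \<and>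
     (\<forall>v\<in>carrier_vec (dim_row A0). proj X (s v) = map_vec red v \<and>
        monom 1 1 \<odot>\<^bsub>middle X\<^esub> s v = s (A0 *\<^sub>v v) \<oplus>\<^bsub>middle X\<^esub> incl X (D *\<^sub>v map_vec red v) \<and>
        [:\<pi>:] \<odot>\<^bsub>middle X\<^esub> s v = incl X (U *\<^sub>v map_vec red v))"

lemma extension_coordinatesD:
  assumes "extension_coordinates red \<pi> A0 X s U D" "A0 \<in> carrier_mat n n"
  shows "coefficient_linear (middle X) n s"
    and "v \<in> carrier_vec n \<Longrightarrow> proj X (s v) = map_vec red v"
    and "v \<in> carrier_vec n \<Longrightarrow>
      monom 1 1 \<odot>\<^bsub>middle X\<^esub> s v = s (A0 *\<^sub>v v) \<oplus>\<^bsub>middle X\<^esub> incl X (D *\<^sub>v map_vec red v)"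
    and "v \<in> carrier_vec n \<Longrightarrow> [:\<pi>:] \<odot>\<^bsub>middle X\<^esub> s v = incl X (U *\<^sub>v map_vec red v)"
proof -
  have dim: "dim_row A0 = n" using assms(2) by simp
  note co = assms(1)[unfolded extension_coordinates_def dim]
  show "coefficient_linear (middle X) n s" by (rule conjunct1[OF co])
  assume "v \<in> carrier_vec n"
  note v = bspec[OF conjunct2[OF co] this]
  show "proj X (s v) = map_vec red v" by (rule conjunct1[OF v])
  show "monom 1 1 \<odot>\<^bsub>middle X\<^esub> s v = s (A0 *\<^sub>v v) \<oplus>\<^bsub>middle X\<^esub> incl X (D *\<^sub>v map_vec red v)"
    by (rule conjunct1[OF conjunct2[OF v]])
  show "[:\<pi>:] \<odot>\<^bsub>middle X\<^esub> s v = incl X (U *\<^sub>v map_vec red v)"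
    by (rule conjunct2[OF conjunct2[OF v]])
qed

text \<open>Coordinates depend only on the equivalence class: compose \<open>s\<close> with the map of middle terms.\<close>

lemma extension_coordinates_transport:
  assumes coords: "extension_coordinates red \<pi> A0 X s U D" and A0: "A0 \<in> carrier_mat n n"
    and D: "D \<in> carrier_mat n n" and U: "U \<in> carrier_mat n n" and N: "carrier N = carrier_vec n"
    and incl: "\<And>a. a \<in> carrier N \<Longrightarrow> incl X a \<in> carrier (middle X)"
    and equiv: "ext_equiv class_ring N X Y"
  shows "\<exists>s. extension_coordinates red \<pi> A0 Y s U D"
proof -
  from equiv obtain \<phi> where \<phi>: "\<phi> \<in> LinearCombinations.module_hom class_ring (middle X) (middle Y)"
    and \<phi>_comm: "(\<forall>a\<in>carrier N. \<phi> (incl X a) = incl Y a) \<and>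
      (\<forall>m\<in>carrier (middle X). proj Y (\<phi> m) = proj X m)"
    unfolding ext_equiv_def by (rule bexE)
  have \<phi>_incl: "\<phi> (incl X a) = incl Y a" if "a \<in> carrier N" for a using \<phi>_comm that by simp
  have \<phi>_proj: "proj Y (\<phi> m) = proj X m" if "m \<in> carrier (middle X)" for m using \<phi>_comm that by simp
  have \<phi>c: "\<phi> m \<in> carrier (middle Y)" if "m \<in> carrier (middle X)" for m
    using LinearCombinations.module_hom_closed[OF \<phi>] that by blast
  have \<phi>s: "\<phi> (p \<odot>\<^bsub>middle X\<^esub> m) = p \<odot>\<^bsub>middle Y\<^esub> \<phi> m" if "m \<in> carrier (middle X)" for p m
    using LinearCombinations.module_hom_smult[OF \<phi> _ that] by simp
  note \<phi>a = LinearCombinations.module_hom_add[OF \<phi>]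
  have dim: "dim_row A0 = n" using A0 by simp
  note co = extension_coordinatesD[OF coords A0]
  note sD = coefficient_linearD[OF co(1)]
  have "extension_coordinates red \<pi> A0 Y (\<phi> \<circ> s) U D"
    unfolding extension_coordinates_def dim
  proof (intro conjI ballI)
    show "coefficient_linear (middle Y) n (\<phi> \<circ> s)"
      unfolding comp_def
    proof (rule coefficient_linearI)
      fix v w :: "'a vec" and r assume v: "v \<in> carrier_vec n" and w: "w \<in> carrier_vec n"
      show "\<phi> (s v) \<in> carrier (middle Y)" by (intro \<phi>c sD(1) v)
      show "\<phi> (s (r \<cdot>\<^sub>v v)) = [:r:] \<odot>\<^bsub>middle Y\<^esub> \<phi> (s v)"
        unfolding sD(2)[OF v] by (intro \<phi>s sD(1) v)
      show "\<phi> (s (v + w)) = \<phi> (s v) \<oplus>\<^bsub>middle Y\<^esub> \<phi> (s w)"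
        unfolding sD(3)[OF v w] by (intro \<phi>a sD(1) v w)
    qed
    fix v :: "'a vec" assume v: "v \<in> carrier_vec n"
    have c: "D *\<^sub>v map_vec red v \<in> carrier N" "U *\<^sub>v map_vec red v \<in> carrier N" "A0 *\<^sub>v v \<in> carrier_vec n"
      unfolding N by (intro mult_mat_vec_carrier[OF D] mult_mat_vec_carrier[OF U] mult_mat_vec_carrier[OF A0]; use v in simp)+
    have sv: "s v \<in> carrier (middle X)" by (rule sD(1)[OF v])
    show "proj Y ((\<phi> \<circ> s) v) = map_vec red v" using co(2)[OF v] \<phi>_proj[OF sv] by simp
    from co(3)[OF v] show "monom 1 1 \<odot>\<^bsub>middle Y\<^esub> (\<phi> \<circ> s) v = (\<phi> \<circ> s) (A0 *\<^sub>v v) \<oplus>\<^bsub>middle Y\<^esub> incl Y (D *\<^sub>v map_vec red v)"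
      unfolding comp_def \<phi>s[OF sv, symmetric] \<phi>_incl[OF c(1), symmetric]
      by (simp only: \<phi>a[OF sD(1)[OF c(3)] incl[OF c(1)]])
    from co(4)[OF v] show "[:\<pi>:] \<odot>\<^bsub>middle Y\<^esub> (\<phi> \<circ> s) v = incl Y (U *\<^sub>v map_vec red v)"
      unfolding comp_def \<phi>s[OF sv, symmetric] \<phi>_incl[OF c(2), symmetric] by simp
  qed
  then show ?thesis by blast
qed

section \<open>Baer sums\<close>

locale module_extension =
  fixes S :: "'s ring" and N :: "('s, 'n) module" and Q :: "('s, 'q) module"
    and X :: "('s, 'n, 'm, 'q) extension"
  assumes is_extension: "is_extension S N Q X"
begin

sublocale N: Module.module S N + Q: Module.module S Q + M: Module.module S "middle X"
  using is_extension by (simp_all add: is_extension_def)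

sublocale incl: mod_hom S N "middle X" "incl X"
  using is_extension by (simp add: is_extension_def mod_hom_def mod_hom_axioms_def)

sublocale proj: mod_hom S "middle X" Q "proj X"
  using is_extension by (simp add: is_extension_def mod_hom_def mod_hom_axioms_def)

lemma incl_eq_iff: "a \<in> carrier N \<Longrightarrow> b \<in> carrier N \<Longrightarrow> incl X a = incl X b \<longleftrightarrow> a = b"
  using is_extension by (auto simp: is_extension_def inj_on_def)

lemma range_incl: "incl X ` carrier N = {m \<in> carrier (middle X). proj X m = \<zero>\<^bsub>Q\<^esub>}"
  using is_extension by (simp add: is_extension_def a_kernel_def')

lemma proj_incl [simp]: "a \<in> carrier N \<Longrightarrow> proj X (incl X a) = \<zero>\<^bsub>Q\<^esub>"
  using range_incl by auto

lemma proj_neg_incl [simp]: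
  assumes "a \<in> carrier N"
  shows "proj X (\<ominus>\<^bsub>middle X\<^esub> incl X a) = \<zero>\<^bsub>Q\<^esub>"
  using proj_incl[OF N.a_inv_closed[OF assms]] incl.f_neg[OF assms] by simp

lemma proj_surj:
  assumes "q \<in> carrier Q"
  shows "\<exists>m\<in>carrier (middle X). proj X m = q"
proof -
  have "q \<in> proj X ` carrier (middle X)" using is_extension assms by (simp add: is_extension_def)
  then show ?thesis by (elim imageE) blast
qed

lemma ex_incl_diff:
  assumes "m \<in> carrier (middle X)" "m' \<in> carrier (middle X)" "proj X m = proj X m'"
  shows "\<exists>a\<in>carrier N. m = m' \<oplus>\<^bsub>middle X\<^esub> incl X a"
proof -
  let ?M = "middle X"
  have "proj X (m \<ominus>\<^bsub>?M\<^esub> m') = \<zero>\<^bsub>Q\<^esub>" using assms by (simp add: Q.r_neg a_minus_def)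
  then have "m \<ominus>\<^bsub>?M\<^esub> m' \<in> incl X ` carrier N" unfolding range_incl using assms by simp
  then obtain a where a: "m \<ominus>\<^bsub>?M\<^esub> m' = incl X a" "a \<in> carrier N" by (rule imageE)
  have "m = m' \<oplus>\<^bsub>?M\<^esub> (m \<ominus>\<^bsub>?M\<^esub> m')"
    using assms M.a_lcomm[of m' m "\<ominus>\<^bsub>?M\<^esub> m'"] by (simp add: a_minus_def M.r_neg)
  with a show ?thesis by auto
qed

end

text \<open>The Baer sum is handled through representatives: \<open>coset z\<close> for \<open>z\<close> in the fibre product.\<close>

locale extension_pair = X: module_extension S N Q X + Y: module_extension S N Q Y
  for S :: "'s ring" and N :: "('s, 'n) module" and Q :: "('s, 'q) module"
    and X :: "('s, 'n, 'm, 'q) extension" and Y :: "('s, 'n, 'm2, 'q) extension"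
begin

abbreviation "F \<equiv> fibre_product X Y"
abbreviation "H \<equiv> antidiagonal N X Y"
abbreviation "coset z \<equiv> H +>\<^bsub>F\<^esub> z"

lemma fibre_product_simps:
  "z \<in> carrier F \<longleftrightarrow> fst z \<in> carrier (middle X) \<and> snd z \<in> carrier (middle Y) \<and> proj X (fst z) = proj Y (snd z)"
  "z \<oplus>\<^bsub>F\<^esub> w = (fst z \<oplus>\<^bsub>middle X\<^esub> fst w, snd z \<oplus>\<^bsub>middle Y\<^esub> snd w)"
  "\<zero>\<^bsub>F\<^esub> = (\<zero>\<^bsub>middle X\<^esub>, \<zero>\<^bsub>middle Y\<^esub>)"
  "c \<odot>\<^bsub>F\<^esub> z = (c \<odot>\<^bsub>middle X\<^esub> fst z, c \<odot>\<^bsub>middle Y\<^esub> snd z)"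
  by (auto simp: fibre_product_def direct_sum_def split: prod.splits)

sublocale F: abelian_group F
proof (rule abelian_groupI)
  fix z assume z: "z \<in> carrier F"
  show "\<exists>w\<in>carrier F. w \<oplus>\<^bsub>F\<^esub> z = \<zero>\<^bsub>F\<^esub>"
    by (rule bexI[of _ "(\<ominus>\<^bsub>middle X\<^esub> fst z, \<ominus>\<^bsub>middle Y\<^esub> snd z)"])
      (use z in \<open>auto simp: fibre_product_simps X.M.l_neg Y.M.l_neg\<close>)
next
  fix z w assume "z \<in> carrier F" "w \<in> carrier F"
  then show "z \<oplus>\<^bsub>F\<^esub> w = w \<oplus>\<^bsub>F\<^esub> z"
    using X.M.a_comm[of "fst z" "fst w"] Y.M.a_comm[of "snd z" "snd w"] by (simp add: fibre_product_simps)
qed (auto simp: fibre_product_simps X.M.a_assoc Y.M.a_assoc)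

lemma antidiagonal_neg:
  assumes "a \<in> carrier N"
  shows "(\<ominus>\<^bsub>middle X\<^esub> incl X a, incl Y a) \<in> H"
proof -
  have "(\<ominus>\<^bsub>middle X\<^esub> incl X a, incl Y a) = (incl X (\<ominus>\<^bsub>N\<^esub> a), \<ominus>\<^bsub>middle Y\<^esub> incl Y (\<ominus>\<^bsub>N\<^esub> a))"
    using assms by simp
  then show ?thesis using assms unfolding antidiagonal_def by blast
qed

lemma antidiagonal_subset: "H \<subseteq> carrier F"
  by (auto simp: antidiagonal_def fibre_product_simps simp del: Y.proj.f_neg)

sublocale H: abelian_subgroup H F
proof (rule abelian_subgroupI3[OF additive_subgroup.intro])
  show "abelian_group F" ..
  show "subgroup H (add_monoid F)"
  proof (rule F.add.subgroupI)
    show "H \<subseteq> carrier F" by (rule antidiagonal_subset)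
    show "H \<noteq> {}" using antidiagonal_neg[OF X.N.zero_closed] by blast
    fix z assume "z \<in> H"
    then obtain a where a: "a \<in> carrier N" "z = (incl X a, \<ominus>\<^bsub>middle Y\<^esub> incl Y a)"
      by (auto simp: antidiagonal_def)
    let ?w = "(\<ominus>\<^bsub>middle X\<^esub> incl X a, incl Y a)"
    have "?w \<in> carrier F" "z \<in> carrier F"
      using a by (auto simp: fibre_product_simps simp del: X.proj.f_neg Y.proj.f_neg)
    moreover have "?w \<oplus>\<^bsub>F\<^esub> z = \<zero>\<^bsub>F\<^esub>"
      using a by (simp add: fibre_product_simps X.M.l_neg Y.M.r_neg)
    ultimately have "\<ominus>\<^bsub>F\<^esub> z = ?w" by (intro F.minus_equality)
    then show "\<ominus>\<^bsub>F\<^esub> z \<in> H" using antidiagonal_neg[OF a(1)] by simp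
    fix z' assume "z' \<in> H"
    then obtain b where b: "b \<in> carrier N" "z' = (incl X b, \<ominus>\<^bsub>middle Y\<^esub> incl Y b)"
      by (auto simp: antidiagonal_def)
    have "z \<oplus>\<^bsub>F\<^esub> z' = (incl X (a \<oplus>\<^bsub>N\<^esub> b), \<ominus>\<^bsub>middle Y\<^esub> incl Y (a \<oplus>\<^bsub>N\<^esub> b))"
      using a b by (simp add: fibre_product_simps Y.M.minus_add)
    then show "z \<oplus>\<^bsub>F\<^esub> z' \<in> H" unfolding antidiagonal_def
      by (rule image_eqI) (rule X.N.a_closed[OF a(1) b(1)])
  qed
qed

lemma coset_eqI:
  assumes "h \<in> H" "z \<in> carrier F"
  shows "coset (h \<oplus>\<^bsub>F\<^esub> z) = coset z"
proof -
  have "h \<oplus>\<^bsub>F\<^esub> z \<in> coset z" using assms by (auto simp: a_r_coset_def')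
  then show ?thesis using F.a_repr_independence[OF _ assms(2) H.a_subgroup] by simp
qed

lemma coset_shift:
  assumes z: "(x, y) \<in> carrier F" and a: "a \<in> carrier N" and b: "b \<in> carrier N"
  shows "coset (x \<oplus>\<^bsub>middle X\<^esub> incl X a, y \<oplus>\<^bsub>middle Y\<^esub> incl Y b)
    = coset (x \<oplus>\<^bsub>middle X\<^esub> incl X (a \<oplus>\<^bsub>N\<^esub> b), y)"
proof -
  let ?w = "(x \<oplus>\<^bsub>middle X\<^esub> incl X (a \<oplus>\<^bsub>N\<^esub> b), y)"
  have xy: "x \<in> carrier (middle X)" "y \<in> carrier (middle Y)" using z by (auto simp: fibre_product_simps)
  have w: "?w \<in> carrier F" using z a b by (auto simp: fibre_product_simps)
  have "(\<ominus>\<^bsub>middle X\<^esub> incl X b, incl Y b) \<oplus>\<^bsub>F\<^esub> ?w = (x \<oplus>\<^bsub>middle X\<^esub> incl X a, y \<oplus>\<^bsub>middle Y\<^esub> incl Y b)"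
  proof -
    have "\<ominus>\<^bsub>middle X\<^esub> incl X b \<oplus>\<^bsub>middle X\<^esub> (x \<oplus>\<^bsub>middle X\<^esub> (incl X a \<oplus>\<^bsub>middle X\<^esub> incl X b))
        = (\<ominus>\<^bsub>middle X\<^esub> incl X b \<oplus>\<^bsub>middle X\<^esub> incl X b) \<oplus>\<^bsub>middle X\<^esub> (x \<oplus>\<^bsub>middle X\<^esub> incl X a)"
      using a b xy by (simp add: X.M.a_ac)
    then show ?thesis using a b xy
      by (simp add: fibre_product_simps X.M.l_neg Y.M.a_comm)
  qed
  then show ?thesis using coset_eqI[OF antidiagonal_neg[OF b] w] by simp
qed

lemma baer_sum_simps:
  "carrier (middle (baer_sum N X Y)) = a_rcosets\<^bsub>F\<^esub> H"
  "z \<in> carrier F \<Longrightarrow> w \<in> carrier F \<Longrightarrow> coset z \<oplus>\<^bsub>middle (baer_sum N X Y)\<^esub> coset w = coset (z \<oplus>\<^bsub>F\<^esub> w)"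
  "incl (baer_sum N X Y) a = coset (incl X a, \<zero>\<^bsub>middle Y\<^esub>)"
  by (simp_all add: baer_sum_def quotient_module_def H.a_rcos_sum)

lemma coset_closed: "z \<in> carrier F \<Longrightarrow> coset z \<in> carrier (middle (baer_sum N X Y))"
  unfolding baer_sum_simps using F.a_rcosetsI[OF antidiagonal_subset] by simp

text \<open>A scalar multiple of a coset is a union of cosets, which coincide because the antidiagonal is
  closed under scalars.\<close>

lemma smult_coset:
  assumes z: "z \<in> carrier F" and r: "r \<in> carrier S"
  shows "r \<odot>\<^bsub>middle (baer_sum N X Y)\<^esub> coset z = coset (r \<odot>\<^bsub>F\<^esub> z)"
proof -
  have "coset (r \<odot>\<^bsub>F\<^esub> w) = coset (r \<odot>\<^bsub>F\<^esub> z)" if "w \<in> coset z" for w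
  proof -
    from that obtain h where h: "h \<in> H" "w = h \<oplus>\<^bsub>F\<^esub> z" by (auto simp: a_r_coset_def')
    then obtain a where a: "a \<in> carrier N" "h = (incl X a, \<ominus>\<^bsub>middle Y\<^esub> incl Y a)"
      by (auto simp: antidiagonal_def)
    have rz: "r \<odot>\<^bsub>F\<^esub> z \<in> carrier F" using z r by (simp add: fibre_product_simps)
    have "(incl X (r \<odot>\<^bsub>N\<^esub> a), \<ominus>\<^bsub>middle Y\<^esub> incl Y (r \<odot>\<^bsub>N\<^esub> a)) \<in> H"
      using a r unfolding antidiagonal_def by blast
    then have "r \<odot>\<^bsub>F\<^esub> h \<in> H" using a r by (simp add: fibre_product_simps Y.M.smult_r_minus)
    moreover have "r \<odot>\<^bsub>F\<^esub> w = r \<odot>\<^bsub>F\<^esub> h \<oplus>\<^bsub>F\<^esub> r \<odot>\<^bsub>F\<^esub> z"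
      using a z r unfolding h(2)
      by (simp add: fibre_product_simps X.M.smult_r_distr Y.M.smult_r_distr)
    ultimately show ?thesis using coset_eqI[OF _ rz] by simp
  qed
  then have "(\<Union>w\<in>coset z. coset (r \<odot>\<^bsub>F\<^esub> w)) = (\<Union>w\<in>coset z. coset (r \<odot>\<^bsub>F\<^esub> z))"
    by (intro SUP_cong refl)
  also have "\<dots> = coset (r \<odot>\<^bsub>F\<^esub> z)" using H.a_rcos_self[OF z] by (simp only: UN_constant) auto
  finally show ?thesis by (simp add: baer_sum_def quotient_module_def)
qed

lemma proj_coset:
  assumes z: "z \<in> carrier F"
  shows "proj (baer_sum N X Y) (coset z) = proj X (fst z)"
proof -
  have "proj X (fst w) = proj X (fst z)" if "w \<in> coset z" for w
    using that z by (auto simp: a_r_coset_def' antidiagonal_def fibre_product_simps)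
  moreover have "z \<in> coset z" using z by (rule H.a_rcos_self)
  ultimately have "(\<lambda>z. proj X (fst z)) ` coset z = {proj X (fst z)}" by blast
  then show ?thesis by (simp add: baer_sum_def)
qed

end

text \<open>The pair of the two sections maps to the fibre product. Modulo the antidiagonal the two error
  terms in the submodule add up, both for \<open>t\<close> and for \<open>\<pi>\<close>.\<close>

lemma extension_coordinates_baer_sum:
  fixes red :: "'r :: comm_ring_1 \<Rightarrow> 'k :: comm_ring_1"
  assumes N: "carrier N = carrier_vec n" "add N = (+)"
    and X: "is_extension class_ring N N X" and Y: "is_extension class_ring N N Y"
    and A0: "A0 \<in> carrier_mat n n"
    and U: "U \<in> carrier_mat n n" "U' \<in> carrier_mat n n" and D: "D \<in> carrier_mat n n" "D' \<in> carrier_mat n n"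
    and cX: "extension_coordinates red \<pi> A0 X s U D" and cY: "extension_coordinates red \<pi> A0 Y s' U' D'"
  shows "\<exists>s. extension_coordinates red \<pi> A0 (baer_sum N X Y) s (U + U') (D + D')"
    and "a \<in> carrier N \<Longrightarrow> incl (baer_sum N X Y) a \<in> carrier (middle (baer_sum N X Y))"
proof -
  interpret extension_pair class_ring N N X Y
    using X Y by (simp add: extension_pair_def module_extension_def)
  let ?B = "baer_sum N X Y"
  note co = extension_coordinatesD[OF cX A0] and co' = extension_coordinatesD[OF cY A0]
  note sD = coefficient_linearD[OF co(1)] and sD' = coefficient_linearD[OF co'(1)]
  have F: "(s v, s' v) \<in> carrier F" if "v \<in> carrier_vec n" for v
    using sD(1)[OF that] sD'(1)[OF that] co(2)[OF that] co'(2)[OF that] by (simp add: fibre_product_simps)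
  have dim: "dim_row A0 = n" using A0 by simp
  have "extension_coordinates red \<pi> A0 ?B (\<lambda>v. coset (s v, s' v)) (U + U') (D + D')"
    unfolding extension_coordinates_def dim
  proof (intro conjI ballI)
    show "coefficient_linear (middle ?B) n (\<lambda>v. coset (s v, s' v))"
    proof (rule coefficient_linearI)
      fix v w :: "'r vec" and r assume v: "v \<in> carrier_vec n" and w: "w \<in> carrier_vec n"
      show "coset (s v, s' v) \<in> carrier (middle ?B)" by (intro coset_closed F v)
      show "coset (s (r \<cdot>\<^sub>v v), s' (r \<cdot>\<^sub>v v)) = [:r:] \<odot>\<^bsub>middle ?B\<^esub> coset (s v, s' v)"
        unfolding sD(2)[OF v] sD'(2)[OF v]
        by (subst smult_coset[OF F[OF v]]) (simp_all add: fibre_product_simps)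
      show "coset (s (v + w), s' (v + w)) = coset (s v, s' v) \<oplus>\<^bsub>middle ?B\<^esub> coset (s w, s' w)"
        unfolding sD(3)[OF v w] sD'(3)[OF v w] baer_sum_simps(2)[OF F[OF v] F[OF w]]
        by (simp add: fibre_product_simps)
    qed
    fix v :: "'r vec" assume v: "v \<in> carrier_vec n"
    let ?v = "map_vec red v"
    have rv: "?v \<in> carrier_vec n" using v by simp
    have Av: "A0 *\<^sub>v v \<in> carrier_vec n" by (rule mult_mat_vec_carrier[OF A0 v])
    have DN: "D *\<^sub>v ?v \<in> carrier N" "D' *\<^sub>v ?v \<in> carrier N" "U *\<^sub>v ?v \<in> carrier N" "U' *\<^sub>v ?v \<in> carrier N"
      unfolding N using mult_mat_vec_carrier[OF D(1) rv] mult_mat_vec_carrier[OF D(2) rv]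
        mult_mat_vec_carrier[OF U(1) rv] mult_mat_vec_carrier[OF U(2) rv] by blast+
    have sums: "(D + D') *\<^sub>v ?v = D *\<^sub>v ?v \<oplus>\<^bsub>N\<^esub> D' *\<^sub>v ?v" "(U + U') *\<^sub>v ?v = U *\<^sub>v ?v \<oplus>\<^bsub>N\<^esub> U' *\<^sub>v ?v"
      unfolding N by (rule add_mult_distrib_mat_vec[OF D rv], rule add_mult_distrib_mat_vec[OF U rv])
    show "proj ?B (coset (s v, s' v)) = ?v"
      using proj_coset[OF F[OF v]] co(2)[OF v] by simp
    have incl: "incl ?B a = coset (incl X a, \<zero>\<^bsub>middle Y\<^esub>)" for a by (simp add: baer_sum_simps)
    have zF: "(incl X a, \<zero>\<^bsub>middle Y\<^esub>) \<in> carrier F" if "a \<in> carrier N" for a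
      using that by (simp add: fibre_product_simps)
    have "monom 1 1 \<odot>\<^bsub>middle ?B\<^esub> coset (s v, s' v)
        = coset (s (A0 *\<^sub>v v) \<oplus>\<^bsub>middle X\<^esub> incl X (D *\<^sub>v ?v), s' (A0 *\<^sub>v v) \<oplus>\<^bsub>middle Y\<^esub> incl Y (D' *\<^sub>v ?v))"
      unfolding co(3)[OF v, symmetric] co'(3)[OF v, symmetric]
      by (subst smult_coset[OF F[OF v]]) (simp_all add: fibre_product_simps)
    also have "\<dots> = coset (s (A0 *\<^sub>v v) \<oplus>\<^bsub>middle X\<^esub> incl X ((D + D') *\<^sub>v ?v), s' (A0 *\<^sub>v v))"
      unfolding sums by (rule coset_shift[OF F[OF Av] DN(1,2)])
    also have "\<dots> = coset (s (A0 *\<^sub>v v), s' (A0 *\<^sub>v v)) \<oplus>\<^bsub>middle ?B\<^esub> incl ?B ((D + D') *\<^sub>v ?v)"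
    proof -
      have "(D + D') *\<^sub>v ?v \<in> carrier N" unfolding sums using DN by simp
      then show ?thesis unfolding incl using baer_sum_simps(2)[OF F[OF Av] zF] sD'(1)[OF Av]
        by (simp add: fibre_product_simps)
    qed
    finally show "monom 1 1 \<odot>\<^bsub>middle ?B\<^esub> coset (s v, s' v)
        = coset (s (A0 *\<^sub>v v), s' (A0 *\<^sub>v v)) \<oplus>\<^bsub>middle ?B\<^esub> incl ?B ((D + D') *\<^sub>v ?v)" .
    have zz: "(\<zero>\<^bsub>middle X\<^esub>, \<zero>\<^bsub>middle Y\<^esub>) \<in> carrier F" by (simp add: fibre_product_simps)
    have UN: "(U + U') *\<^sub>v ?v \<in> carrier N" unfolding sums by (rule X.N.a_closed[OF DN(3,4)])
    have "[:\<pi>:] \<odot>\<^bsub>middle ?B\<^esub> coset (s v, s' v) = coset (incl X (U *\<^sub>v ?v), incl Y (U' *\<^sub>v ?v))"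
      by (subst smult_coset[OF F[OF v]]) (simp_all add: fibre_product_simps co(4)[OF v] co'(4)[OF v])
    also have "\<dots> = coset (\<zero>\<^bsub>middle X\<^esub> \<oplus>\<^bsub>middle X\<^esub> incl X (U *\<^sub>v ?v), \<zero>\<^bsub>middle Y\<^esub> \<oplus>\<^bsub>middle Y\<^esub> incl Y (U' *\<^sub>v ?v))"
      by (simp only: X.M.l_zero[OF X.incl.f_im[OF DN(3)]] Y.M.l_zero[OF Y.incl.f_im[OF DN(4)]])
    also have "\<dots> = coset (\<zero>\<^bsub>middle X\<^esub> \<oplus>\<^bsub>middle X\<^esub> incl X ((U + U') *\<^sub>v ?v), \<zero>\<^bsub>middle Y\<^esub>)"
      unfolding sums by (rule coset_shift[OF zz DN(3,4)])
    also have "\<dots> = incl ?B ((U + U') *\<^sub>v ?v)"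
      unfolding incl by (simp only: X.M.l_zero[OF X.incl.f_im[OF UN]])
    finally show "[:\<pi>:] \<odot>\<^bsub>middle ?B\<^esub> coset (s v, s' v) = incl ?B ((U + U') *\<^sub>v ?v)" .
  qed
  then show "\<exists>s. extension_coordinates red \<pi> A0 (baer_sum N X Y) s (U + U') (D + D')"
    by (rule exI[of _ "\<lambda>v. coset (s v, s' v)"])
  show "incl ?B a \<in> carrier (middle ?B)" if "a \<in> carrier N"
    unfolding baer_sum_simps(3) by (rule coset_closed) (use that in \<open>simp add: fibre_product_simps\<close>)
qed

section \<open>Existence of coordinates over the residue field\<close>

lemma coefficient_linear_smult:
  fixes M :: "('r :: comm_ring_1 poly, 'm) module"
  assumes "Module.module class_ring M" and \<sigma>: "coefficient_linear M n \<sigma>"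
  shows "coefficient_linear M n (\<lambda>v. p \<odot>\<^bsub>M\<^esub> \<sigma> v)"
proof -
  interpret M: Module.module class_ring M by fact
  note D = coefficient_linearD[OF \<sigma>]
  show ?thesis
  proof (rule coefficient_linearI)
    fix v w :: "'r vec" and r assume v: "v \<in> carrier_vec n" and w: "w \<in> carrier_vec n"
    show "p \<odot>\<^bsub>M\<^esub> \<sigma> v \<in> carrier M" using M.smult_closed[OF _ D(1)[OF v]] by simp
    show "p \<odot>\<^bsub>M\<^esub> \<sigma> (r \<cdot>\<^sub>v v) = [:r:] \<odot>\<^bsub>M\<^esub> (p \<odot>\<^bsub>M\<^esub> \<sigma> v)"
      unfolding D(2)[OF v] using M.smult_assoc1[OF _ _ D(1)[OF v], of p "[:r:]"]
        M.smult_assoc1[OF _ _ D(1)[OF v], of "[:r:]" p] by (simp add: mult.commute)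
    show "p \<odot>\<^bsub>M\<^esub> \<sigma> (v + w) = p \<odot>\<^bsub>M\<^esub> \<sigma> v \<oplus>\<^bsub>M\<^esub> p \<odot>\<^bsub>M\<^esub> \<sigma> w"
      unfolding D(3)[OF v w] using M.smult_r_distr[OF _ D(1)[OF v] D(1)[OF w], of p] by simp
  qed
qed

lemma coefficient_linear_add:
  fixes M :: "('r :: comm_ring_1 poly, 'm) module"
  assumes "Module.module class_ring M" and \<sigma>: "coefficient_linear M n \<sigma>" and \<tau>: "coefficient_linear M n \<tau>"
  shows "coefficient_linear M n (\<lambda>v. \<sigma> v \<oplus>\<^bsub>M\<^esub> \<tau> v)"
proof -
  interpret M: Module.module class_ring M by fact
  note D = coefficient_linearD[OF \<sigma>] and E = coefficient_linearD[OF \<tau>]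
  show ?thesis
  proof (rule coefficient_linearI)
    fix v w :: "'r vec" and r assume v: "v \<in> carrier_vec n" and w: "w \<in> carrier_vec n"
    note c = D(1)[OF v] E(1)[OF v] D(1)[OF w] E(1)[OF w]
    show "\<sigma> v \<oplus>\<^bsub>M\<^esub> \<tau> v \<in> carrier M" using c by simp
    show "\<sigma> (r \<cdot>\<^sub>v v) \<oplus>\<^bsub>M\<^esub> \<tau> (r \<cdot>\<^sub>v v) = [:r:] \<odot>\<^bsub>M\<^esub> (\<sigma> v \<oplus>\<^bsub>M\<^esub> \<tau> v)"
      unfolding D(2)[OF v] E(2)[OF v] using M.smult_r_distr[OF _ c(1,2), of "[:r:]"] by simp
    show "\<sigma> (v + w) \<oplus>\<^bsub>M\<^esub> \<tau> (v + w) = (\<sigma> v \<oplus>\<^bsub>M\<^esub> \<tau> v) \<oplus>\<^bsub>M\<^esub> (\<sigma> w \<oplus>\<^bsub>M\<^esub> \<tau> w)"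
      unfolding D(3)[OF v w] E(3)[OF v w] using c by (simp add: M.a_ac)
  qed
qed

lemma mult_mat_smult_vec:
  fixes B :: "'a :: comm_ring_1 mat"
  assumes "B \<in> carrier_mat n m" "v \<in> carrier_vec m"
  shows "B *\<^sub>v (r \<cdot>\<^sub>v v) = r \<cdot>\<^sub>v (B *\<^sub>v v)"
  using assms by (intro eq_vecI) (auto simp: scalar_prod_def sum_distrib_left mult.left_commute intro!: sum.cong)

lemma mult_mat_unit_vec:
  fixes B :: "'a :: comm_ring_1 mat"
  assumes "B \<in> carrier_mat n m" "j < m"
  shows "B *\<^sub>v unit_vec m j = col B j"
  using assms by (intro eq_vecI) (auto simp: scalar_prod_right_unit)

lemma coefficient_linear_comp_mat:
  fixes M :: "('r :: comm_ring_1 poly, 'm) module"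
  assumes \<sigma>: "coefficient_linear M n \<sigma>" and B: "B \<in> carrier_mat n n"
  shows "coefficient_linear M n (\<lambda>v. \<sigma> (B *\<^sub>v v))"
proof (rule coefficient_linearI)
  note D = coefficient_linearD[OF \<sigma>]
  fix v w :: "'r vec" and r assume v: "v \<in> carrier_vec n" and w: "w \<in> carrier_vec n"
  note c = mult_mat_vec_carrier[OF B v] mult_mat_vec_carrier[OF B w]
  show "\<sigma> (B *\<^sub>v v) \<in> carrier M" by (rule D(1)[OF c(1)])
  have "B *\<^sub>v (r \<cdot>\<^sub>v v) = r \<cdot>\<^sub>v (B *\<^sub>v v)" by (rule mult_mat_smult_vec[OF B v])
  then show "\<sigma> (B *\<^sub>v (r \<cdot>\<^sub>v v)) = [:r:] \<odot>\<^bsub>M\<^esub> \<sigma> (B *\<^sub>v v)" using D(2)[OF c(1)] by simp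
  show "\<sigma> (B *\<^sub>v (v + w)) = \<sigma> (B *\<^sub>v v) \<oplus>\<^bsub>M\<^esub> \<sigma> (B *\<^sub>v w)"
    unfolding mult_add_distrib_mat_vec[OF B v w] by (rule D(3)[OF c])
qed

lemma module_of_matrixD:
  assumes "module_of_matrix red A N" "A \<in> carrier_mat n n"
  shows "comm_ring_hom red" "carrier N = carrier_vec n" "add N = (+)" "zero N = 0\<^sub>v n"
    and "v \<in> carrier_vec n \<Longrightarrow> [:r:] \<odot>\<^bsub>N\<^esub> v = red r \<cdot>\<^sub>v v"
    and "v \<in> carrier_vec n \<Longrightarrow> monom 1 1 \<odot>\<^bsub>N\<^esub> v = A *\<^sub>v v"
  using assms by (simp_all add: module_of_matrix_def)

lemma coefficient_linear_reduction:
  fixes red :: "'r :: comm_ring_1 \<Rightarrow> 'k :: comm_ring_1"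
  assumes N: "module_of_matrix red A N" and A: "A \<in> carrier_mat n n" and D: "D \<in> carrier_mat n n"
    and X: "is_extension class_ring N N X"
  shows "coefficient_linear (middle X) n (\<lambda>v. incl X (D *\<^sub>v map_vec red v))"
proof (rule coefficient_linearI)
  interpret X: module_extension class_ring N N X by (rule module_extension.intro[OF X])
  note N = module_of_matrixD[OF N A]
  interpret comm_ring_hom red by (rule N(1))
  fix v w :: "'r vec" and r assume v: "v \<in> carrier_vec n" and w: "w \<in> carrier_vec n"
  have c: "D *\<^sub>v map_vec red v \<in> carrier_vec n" "D *\<^sub>v map_vec red w \<in> carrier_vec n"
    by (rule mult_mat_vec_carrier[OF D], use v w in simp)+
  show "incl X (D *\<^sub>v map_vec red v) \<in> carrier (middle X)" using c N by simp
  have "D *\<^sub>v map_vec red (r \<cdot>\<^sub>v v) = D *\<^sub>v (red r \<cdot>\<^sub>v map_vec red v)"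
    using v by (intro arg_cong[of _ _ "(*\<^sub>v) D"] eq_vecI) (auto simp: hom_distribs)
  also have "\<dots> = [:r:] \<odot>\<^bsub>N\<^esub> (D *\<^sub>v map_vec red v)"
    unfolding N(5)[OF c(1)] by (rule mult_mat_smult_vec[OF D]) (use v in simp)
  finally show "incl X (D *\<^sub>v map_vec red (r \<cdot>\<^sub>v v)) = [:r:] \<odot>\<^bsub>middle X\<^esub> incl X (D *\<^sub>v map_vec red v)"
    using X.incl.f_smult[of "[:r:]" "D *\<^sub>v map_vec red v"] c(1) N(2) by simp
  have "D *\<^sub>v map_vec red (v + w) = D *\<^sub>v (map_vec red v + map_vec red w)"
    using v w by (intro arg_cong[of _ _ "(*\<^sub>v) D"] eq_vecI) (auto simp: hom_distribs)
  also have "\<dots> = (D *\<^sub>v map_vec red v) \<oplus>\<^bsub>N\<^esub> (D *\<^sub>v map_vec red w)"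
    unfolding N(3) by (rule mult_add_distrib_mat_vec[OF D]) (use v w in simp_all)
  finally show "incl X (D *\<^sub>v map_vec red (v + w))
      = incl X (D *\<^sub>v map_vec red v) \<oplus>\<^bsub>middle X\<^esub> incl X (D *\<^sub>v map_vec red w)"
    using X.incl.f_add[of "D *\<^sub>v map_vec red v" "D *\<^sub>v map_vec red w"] c N(2) by simp
qed

lemma ex_mat_of_columns:
  assumes "\<And>j. j < n \<Longrightarrow> x j \<in> carrier_vec n"
  obtains M where "M \<in> carrier_mat n n" "\<And>j. j < n \<Longrightarrow> M *\<^sub>v unit_vec n j = (x j :: 'a :: comm_ring_1 vec)"
proof (rule that)
  let ?M = "mat_of_cols n (map x [0..<n])"
  show M: "?M \<in> carrier_mat n n" by auto
  show "?M *\<^sub>v unit_vec n j = x j" if "j < n" for j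
    using mult_mat_unit_vec[OF M that] col_mat_of_cols[of j "map x [0..<n]" n] assms that by simp
qed

text \<open>Over \<open>k\<close> a linear section exists: lift the unit vectors arbitrarily. The defect of \<open>t\<close> on the lifts
  lies in the kernel of the projection and supplies the columns of \<open>D\<close>.\<close>

lemma ex_extension_coordinates:
  fixes N :: "('k :: comm_ring_1 poly, 'k vec) module"
  assumes N: "module_of_matrix id A N" and A: "A \<in> carrier_mat n n"
    and X: "is_extension class_ring N N X"
  shows "\<exists>s. \<exists>D\<in>carrier_mat n n. extension_coordinates id 0 A X s (0\<^sub>m n n) D"
proof -
  interpret X: module_extension class_ring N N X by (rule module_extension.intro[OF X])
  note ND = module_of_matrixD[OF N A]
  have modM: "Module.module class_ring (middle X)" ..
  have modN: "Module.module class_ring N" ..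
  have "\<exists>m\<in>carrier (middle X). proj X m = unit_vec n j" for j
    using X.proj_surj[of "unit_vec n j"] ND(2) by simp
  then obtain m where m: "\<And>j. m j \<in> carrier (middle X)" "\<And>j. proj X (m j) = unit_vec n j" by metis
  define s where "s v = (\<Oplus>\<^bsub>middle X\<^esub>i\<in>{..<n}. [:v $ i:] \<odot>\<^bsub>middle X\<^esub> m i)" for v
  have s: "coefficient_linear (middle X) n s" unfolding s_def
    by (rule coefficient_linear_comb(1)[OF modM m(1)])
  have s_unit: "s (unit_vec n j) = m j" if "j < n" for j unfolding s_def
    by (rule coefficient_linear_comb(2)[OF modM m(1) that])
  note sD = coefficient_linearD[OF s]
  have proj_lin: "coefficient_linear N n (\<lambda>v. proj X (s v))"
  proof (rule coefficient_linearI)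
    fix v w :: "'k vec" and r assume v: "v \<in> carrier_vec n" and w: "w \<in> carrier_vec n"
    show "proj X (s v) \<in> carrier N" by (rule X.proj.f_im[OF sD(1)[OF v]])
    show "proj X (s (r \<cdot>\<^sub>v v)) = [:r:] \<odot>\<^bsub>N\<^esub> proj X (s v)"
      unfolding sD(2)[OF v] by (rule X.proj.f_smult[OF _ sD(1)[OF v]]) simp
    show "proj X (s (v + w)) = proj X (s v) \<oplus>\<^bsub>N\<^esub> proj X (s w)"
      unfolding sD(3)[OF v w] by (rule X.proj.f_add[OF sD(1)[OF v] sD(1)[OF w]])
  qed
  have id_lin: "coefficient_linear N n (\<lambda>v. v)"
    by (rule coefficient_linearI) (simp_all add: ND)
  have proj_s: "proj X (s v) = v" if "v \<in> carrier_vec n" for v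
    by (rule coefficient_linear_eqI[OF modN proj_lin id_lin _ that]) (simp add: s_unit m)
  have "\<exists>a\<in>carrier N. monom 1 1 \<odot>\<^bsub>middle X\<^esub> m j = s (A *\<^sub>v unit_vec n j) \<oplus>\<^bsub>middle X\<^esub> incl X a" for j
  proof (rule X.ex_incl_diff)
    have Au: "A *\<^sub>v unit_vec n j \<in> carrier_vec n" by (rule mult_mat_vec_carrier[OF A]) simp
    show "monom 1 1 \<odot>\<^bsub>middle X\<^esub> m j \<in> carrier (middle X)" using X.M.smult_closed[OF _ m(1)] by simp
    show "s (A *\<^sub>v unit_vec n j) \<in> carrier (middle X)" by (rule sD(1)[OF Au])
    have "proj X (monom 1 1 \<odot>\<^bsub>middle X\<^esub> m j) = monom 1 1 \<odot>\<^bsub>N\<^esub> unit_vec n j"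
      using X.proj.f_smult[OF _ m(1), of "monom 1 1" j] m(2) by simp
    also have "\<dots> = proj X (s (A *\<^sub>v unit_vec n j))" using proj_s[OF Au] ND(6) by simp
    finally show "proj X (monom 1 1 \<odot>\<^bsub>middle X\<^esub> m j) = proj X (s (A *\<^sub>v unit_vec n j))" .
  qed
  then obtain a where a: "\<And>j. a j \<in> carrier N"
    "\<And>j. monom 1 1 \<odot>\<^bsub>middle X\<^esub> m j = s (A *\<^sub>v unit_vec n j) \<oplus>\<^bsub>middle X\<^esub> incl X (a j)" by metis
  have "a j \<in> carrier_vec n" if "j < n" for j using a(1) ND(2) by simp
  then obtain D where D: "D \<in> carrier_mat n n" "\<And>j. j < n \<Longrightarrow> D *\<^sub>v unit_vec n j = a j"
    by (rule ex_mat_of_columns[of n a]) auto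
  have id_vec: "map_vec id v = v" for v :: "'k vec" by (intro eq_vecI) auto
  have t_lin: "coefficient_linear (middle X) n (\<lambda>v. monom 1 1 \<odot>\<^bsub>middle X\<^esub> s v)"
    by (rule coefficient_linear_smult[OF modM s])
  have r_lin: "coefficient_linear (middle X) n (\<lambda>v. s (A *\<^sub>v v) \<oplus>\<^bsub>middle X\<^esub> incl X (D *\<^sub>v map_vec id v))"
    by (rule coefficient_linear_add[OF modM coefficient_linear_comp_mat[OF s A]
          coefficient_linear_reduction[OF N A D(1) X]])
  have t: "monom 1 1 \<odot>\<^bsub>middle X\<^esub> s v = s (A *\<^sub>v v) \<oplus>\<^bsub>middle X\<^esub> incl X (D *\<^sub>v map_vec id v)"
    if "v \<in> carrier_vec n" for v
    by (rule coefficient_linear_eqI[OF modM t_lin r_lin _ that]) (simp add: s_unit a D id_vec del: One_nat_def)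
  have z: "[:0:] \<odot>\<^bsub>middle X\<^esub> s v = incl X (0\<^sub>m n n *\<^sub>v map_vec id v)" if "v \<in> carrier_vec n" for v
  proof -
    have "[:0:] \<odot>\<^bsub>middle X\<^esub> s v = \<zero>\<^bsub>middle X\<^esub>" using X.M.smult_l_null[OF sD(1)[OF that]] by simp
    moreover have "0\<^sub>m n n *\<^sub>v map_vec id v = \<zero>\<^bsub>N\<^esub>" using that ND(4) by (intro eq_vecI) auto
    ultimately show ?thesis using X.incl.f0_is_0 by simp
  qed
  have "extension_coordinates id 0 A X s (0\<^sub>m n n) D"
    unfolding extension_coordinates_def using A s proj_s t z by (simp add: id_vec)
  with D(1) show ?thesis by blast
qed

lemma mat_module_simps:
  fixes A :: "'a :: comm_ring_1 mat"
  assumes "A \<in> carrier_mat n n"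
  shows "carrier (mat_module A) = carrier_vec n" "add (mat_module A) = (+)" "zero (mat_module A) = 0\<^sub>v n"
    and "v \<in> carrier_vec n \<Longrightarrow> [:r:] \<odot>\<^bsub>mat_module A\<^esub> v = r \<cdot>\<^sub>v v"
    and "v \<in> carrier_vec n \<Longrightarrow> monom 1 1 \<odot>\<^bsub>mat_module A\<^esub> v = A *\<^sub>v v"
proof -
  have dim: "dim_row A = n" using assms by simp
  show "carrier (mat_module A) = carrier_vec n" "add (mat_module A) = (+)" "zero (mat_module A) = 0\<^sub>v n"
    by (simp_all add: mat_module_def dim)
  assume v: "v \<in> carrier_vec n"
  have A0: "A ^\<^sub>m 0 *\<^sub>v v = v" using v dim by simp
  have "A ^\<^sub>m 1 = A" using assms by simp
  then have A1: "A ^\<^sub>m Suc 0 *\<^sub>v v = A *\<^sub>v v" by simp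
  show "[:r:] \<odot>\<^bsub>mat_module A\<^esub> v = r \<cdot>\<^sub>v v"
    using v A0 by (intro eq_vecI) (auto simp: mat_module_def dim)
  have deg: "degree (monom 1 1 :: 'a poly) = Suc 0" by (simp add: degree_monom_eq)
  show "monom 1 1 \<odot>\<^bsub>mat_module A\<^esub> v = A *\<^sub>v v"
    unfolding mat_module_def One_nat_def deg[unfolded One_nat_def]
    by (intro eq_vecI) (simp_all add: deg[unfolded One_nat_def] dim A1 del: pow_mat.simps index_mult_mat_vec)
qed

section \<open>The matrix of the variable in a lifted basis\<close>

context residue_map
begin

lemma ex_vec_lift:
  assumes "v \<in> carrier_vec n"
  shows "\<exists>w\<in>carrier_vec n. map_vec red w = v"
  using assms surj_f_inv_f[OF surj_red]
  by (intro bexI[of _ "map_vec (inv_into UNIV red) v"]) (auto intro!: eq_vecI)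

text \<open>A basis lifting the unit vectors differs from the section \<open>s\<close> by a matrix \<open>V\<close> with values in the
  submodule, so it comes from the corrected section \<open>\<sigma> = s + V\<close>, whose defect for \<open>t\<close> is \<open>D + [A, V]\<close>.
  Because \<open>U = 1\<close>, elements of the submodule are \<open>\<pi>\<close>-multiples of values of \<open>\<sigma>\<close>; hence this defect
  becomes a matrix \<open>\<pi> K\<close> in the basis.\<close>

lemma matrix_of_basis:
  assumes N: "module_of_matrix red A N" and A: "A \<in> carrier_mat n n"
    and A0: "A0 \<in> carrier_mat n n" and red_A0: "map_mat red A0 = A" and D: "D \<in> carrier_mat n n"
    and X: "is_extension class_ring N N X"
    and coords: "extension_coordinates red \<pi> A0 X s (1\<^sub>m n) D"
    and basis: "is_coeff_basis (middle X) n b"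
    and proj_b: "\<And>j. j < n \<Longrightarrow> proj X (b j) = unit_vec n j"
    and B: "B \<in> carrier_mat n n"
    and tb: "\<And>j. j < n \<Longrightarrow> monom 1 1 \<odot>\<^bsub>middle X\<^esub> b j = (\<Oplus>\<^bsub>middle X\<^esub>i\<in>{..<n}. [:B $$ (i, j):] \<odot>\<^bsub>middle X\<^esub> b i)"
  obtains K V where "K \<in> carrier_mat n n" "V \<in> carrier_mat n n"
    "B = A0 + \<pi> \<cdot>\<^sub>m K" "map_mat red K = D + (A * V - V * A)"
proof -
  interpret X: module_extension class_ring N N X by (rule module_extension.intro[OF X])
  note ND = module_of_matrixD[OF N A]
  note co = extension_coordinatesD[OF coords A0]
  note sD = coefficient_linearD[OF co(1)]
  have modM: "Module.module class_ring (middle X)" ..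
  have red_unit: "map_vec red (unit_vec n j) = unit_vec n j" for j
    by (intro eq_vecI) (auto simp: unit_vec_def)
  have bc: "b j \<in> carrier (middle X)" if "j < n" for j
    using basis that by (simp add: is_coeff_basis_def)
  have "\<exists>a\<in>carrier N. b j = s (unit_vec n j) \<oplus>\<^bsub>middle X\<^esub> incl X a" if "j < n" for j
    by (rule X.ex_incl_diff[OF bc[OF that]]) (simp_all add: sD(1) proj_b[OF that] co(2) red_unit)
  then have "\<forall>j. \<exists>a. j < n \<longrightarrow> a \<in> carrier_vec n \<and> b j = s (unit_vec n j) \<oplus>\<^bsub>middle X\<^esub> incl X a"
    unfolding ND(2) by auto
  from choice[OF this] obtain a where a: "\<And>j. j < n \<Longrightarrow> a j \<in> carrier_vec n"
    "\<And>j. j < n \<Longrightarrow> b j = s (unit_vec n j) \<oplus>\<^bsub>middle X\<^esub> incl X (a j)" by auto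
  obtain V where V: "V \<in> carrier_mat n n" "\<And>j. j < n \<Longrightarrow> V *\<^sub>v unit_vec n j = a j"
    by (rule ex_mat_of_columns[of n a]) (use a in auto)
  define \<sigma> where "\<sigma> c = s c \<oplus>\<^bsub>middle X\<^esub> incl X (V *\<^sub>v map_vec red c)" for c
  have \<sigma>: "coefficient_linear (middle X) n \<sigma>" unfolding \<sigma>_def
    by (rule coefficient_linear_add[OF modM co(1) coefficient_linear_reduction[OF N A V(1) X]])
  note \<sigma>D = coefficient_linearD[OF \<sigma>]
  have \<sigma>_unit: "\<sigma> (unit_vec n j) = b j" if "j < n" for j
    unfolding \<sigma>_def red_unit V(2)[OF that] a(2)[OF that] by (rule refl)
  have comb: "\<sigma> c = (\<Oplus>\<^bsub>middle X\<^esub>i\<in>{..<n}. [:c $ i:] \<odot>\<^bsub>middle X\<^esub> b i)" if "c \<in> carrier_vec n" for c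
  proof -
    have "[:c $ i:] \<odot>\<^bsub>middle X\<^esub> b i \<in> carrier (middle X)" if "i < n" for i
      using X.M.smult_closed[OF _ bc[OF that]] by simp
    then show ?thesis unfolding coefficient_linear_expand[OF modM \<sigma> that]
      by (intro X.M.finsum_cong') (auto simp: \<sigma>_unit)
  qed
  \<comment> \<open>\<open>x j\<close> is column \<open>j\<close> of \<open>D + [A, V]\<close>, and \<open>y j\<close> lifts it to \<open>R\<close>.\<close>
  define x where "x j = D *\<^sub>v unit_vec n j + (A *\<^sub>v a j - V *\<^sub>v (A *\<^sub>v unit_vec n j))" for j
  have xc: "x j \<in> carrier_vec n" if "j < n" for j
    unfolding x_def using D A V(1) a(1)[OF that] by (intro add_carrier_vec minus_carrier_vec mult_mat_vec_carrier) auto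
  have "\<exists>y. j < n \<longrightarrow> y \<in> carrier_vec n \<and> map_vec red y = x j" for j
    using ex_vec_lift[OF xc[of j]] by (cases "j < n") auto
  then have "\<forall>j. \<exists>y. j < n \<longrightarrow> y \<in> carrier_vec n \<and> map_vec red y = x j" by (rule allI)
  from choice[OF this] obtain y where y: "\<And>j. j < n \<Longrightarrow> y j \<in> carrier_vec n"
    "\<And>j. j < n \<Longrightarrow> map_vec red (y j) = x j" by auto
  obtain K where K: "K \<in> carrier_mat n n" "\<And>j. j < n \<Longrightarrow> K *\<^sub>v unit_vec n j = y j"
    by (rule ex_mat_of_columns[of n y]) (use y in auto)
  have colB: "col B j = A0 *\<^sub>v unit_vec n j + \<pi> \<cdot>\<^sub>v y j" if j: "j < n" for j
  proof -
    let ?M = "middle X" and ?u = "unit_vec n j :: 'r vec" and ?uk = "unit_vec n j :: 'k vec"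
    have A0u: "A0 *\<^sub>v ?u \<in> carrier_vec n" by (rule mult_mat_vec_carrier[OF A0]) simp
    have \<pi>y: "\<pi> \<cdot>\<^sub>v y j \<in> carrier_vec n" using y(1)[OF j] by simp
    have red_A0u: "map_vec red (A0 *\<^sub>v ?u) = A *\<^sub>v ?uk"
      using mult_mat_vec_hom[OF A0, of ?u] by (simp add: red_A0 red_unit)
    have Auk: "A *\<^sub>v ?uk \<in> carrier_vec n" by (rule mult_mat_vec_carrier[OF A]) simp
    have carr: "V *\<^sub>v (A *\<^sub>v ?uk) \<in> carrier N" "D *\<^sub>v ?uk \<in> carrier N" "A *\<^sub>v a j \<in> carrier N" "x j \<in> carrier N"
      unfolding ND(2) using mult_mat_vec_carrier[OF V(1) Auk] mult_mat_vec_carrier[OF D, of ?uk]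
        mult_mat_vec_carrier[OF A a(1)[OF j]] xc[OF j] by simp_all
    have "[:\<pi>:] \<odot>\<^bsub>?M\<^esub> \<sigma> (y j) = [:\<pi>:] \<odot>\<^bsub>?M\<^esub> s (y j) \<oplus>\<^bsub>?M\<^esub> [:\<pi>:] \<odot>\<^bsub>?M\<^esub> incl X (V *\<^sub>v x j)"
      unfolding \<sigma>_def y(2)[OF j] using X.incl.f_im[of "V *\<^sub>v x j"] mult_mat_vec_carrier[OF V(1) xc[OF j]] ND(2)
      by (intro X.M.smult_r_distr sD(1) y(1) j) simp_all
    also have "[:\<pi>:] \<odot>\<^bsub>?M\<^esub> s (y j) = incl X (x j)"
      using co(4)[OF y(1)[OF j]] xc[OF j] by (simp add: y(2)[OF j])
    also have "[:\<pi>:] \<odot>\<^bsub>?M\<^esub> incl X (V *\<^sub>v x j) = \<zero>\<^bsub>?M\<^esub>"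
    proof -
      have c: "V *\<^sub>v x j \<in> carrier_vec n" by (rule mult_mat_vec_carrier[OF V(1) xc[OF j]])
      have "[:\<pi>:] \<odot>\<^bsub>?M\<^esub> incl X (V *\<^sub>v x j) = incl X ([:\<pi>:] \<odot>\<^bsub>N\<^esub> (V *\<^sub>v x j))"
        using X.incl.f_smult[of "[:\<pi>:]" "V *\<^sub>v x j"] c ND(2) by simp
      also have "[:\<pi>:] \<odot>\<^bsub>N\<^esub> (V *\<^sub>v x j) = \<zero>\<^bsub>N\<^esub>"
      proof -
        have "red \<pi> \<cdot>\<^sub>v w = 0\<^sub>v n" if "w \<in> carrier_vec n" for w using that by (intro eq_vecI) auto
        from this[OF c] show ?thesis unfolding ND(4) ND(5)[OF c] .
      qed
      finally show ?thesis by (simp only: X.incl.f0_is_0)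
    qed
    finally have \<pi>\<sigma>: "\<sigma> (\<pi> \<cdot>\<^sub>v y j) = incl X (x j)"
      unfolding \<sigma>D(2)[OF y(1)[OF j]] using X.incl.f_im[OF carr(4)] by simp
    have "\<sigma> (A0 *\<^sub>v ?u + \<pi> \<cdot>\<^sub>v y j) = s (A0 *\<^sub>v ?u) \<oplus>\<^bsub>?M\<^esub> incl X (V *\<^sub>v (A *\<^sub>v ?uk)) \<oplus>\<^bsub>?M\<^esub> incl X (x j)"
      unfolding \<sigma>D(3)[OF A0u \<pi>y] \<pi>\<sigma> by (simp add: \<sigma>_def red_A0u)
    also have "\<dots> = s (A0 *\<^sub>v ?u) \<oplus>\<^bsub>?M\<^esub> incl X (V *\<^sub>v (A *\<^sub>v ?uk) \<oplus>\<^bsub>N\<^esub> x j)"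
      using X.M.a_assoc[OF sD(1)[OF A0u] X.incl.f_im[OF carr(1)] X.incl.f_im[OF carr(4)]] carr by simp
    also have "V *\<^sub>v (A *\<^sub>v ?uk) \<oplus>\<^bsub>N\<^esub> x j = D *\<^sub>v ?uk \<oplus>\<^bsub>N\<^esub> A *\<^sub>v a j"
    proof -
      have "p + (q + (r - p)) = q + r" if "p \<in> carrier_vec n" "q \<in> carrier_vec n" "r \<in> carrier_vec n"
        for p q r :: "'k vec" using that by (intro eq_vecI) auto
      from this[OF carr(1-3)[unfolded ND(2)]] show ?thesis unfolding ND(3) x_def .
    qed
    also have "s (A0 *\<^sub>v ?u) \<oplus>\<^bsub>?M\<^esub> incl X (D *\<^sub>v ?uk \<oplus>\<^bsub>N\<^esub> A *\<^sub>v a j)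
        = (s (A0 *\<^sub>v ?u) \<oplus>\<^bsub>?M\<^esub> incl X (D *\<^sub>v ?uk)) \<oplus>\<^bsub>?M\<^esub> incl X (A *\<^sub>v a j)"
      using X.M.a_assoc[OF sD(1)[OF A0u] X.incl.f_im[OF carr(2)] X.incl.f_im[OF carr(3)]] carr by simp
    also have "s (A0 *\<^sub>v ?u) \<oplus>\<^bsub>?M\<^esub> incl X (D *\<^sub>v ?uk) = monom 1 1 \<odot>\<^bsub>?M\<^esub> s ?u"
      using co(3)[of ?u] by (simp add: red_unit del: One_nat_def)
    also have "incl X (A *\<^sub>v a j) = monom 1 1 \<odot>\<^bsub>?M\<^esub> incl X (a j)"
      unfolding ND(6)[OF a(1)[OF j], symmetric] by (rule X.incl.f_smult) (use a(1)[OF j] ND(2) in simp_all)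
    also have "monom 1 1 \<odot>\<^bsub>?M\<^esub> s ?u \<oplus>\<^bsub>?M\<^esub> monom 1 1 \<odot>\<^bsub>?M\<^esub> incl X (a j) = monom 1 1 \<odot>\<^bsub>?M\<^esub> b j"
      unfolding a(2)[OF j] using a(1)[OF j] ND(2)
      by (intro X.M.smult_r_distr[symmetric] sD(1) X.incl.f_im) simp_all
    finally have "monom 1 1 \<odot>\<^bsub>?M\<^esub> b j = \<sigma> (A0 *\<^sub>v ?u + \<pi> \<cdot>\<^sub>v y j)" by (rule sym)
    moreover have "monom 1 1 \<odot>\<^bsub>?M\<^esub> b j = \<sigma> (col B j)"
    proof -
      have cB: "col B j \<in> carrier_vec n" using B by (simp add: carrier_vecI)
      have "(\<Oplus>\<^bsub>?M\<^esub>i\<in>{..<n}. [:B $$ (i, j):] \<odot>\<^bsub>?M\<^esub> b i) = (\<Oplus>\<^bsub>?M\<^esub>i\<in>{..<n}. [:col B j $ i:] \<odot>\<^bsub>?M\<^esub> b i)"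
        using B j X.M.smult_closed[OF _ bc] by (intro X.M.finsum_cong') auto
      then show ?thesis unfolding tb[OF j] comb[OF cB] .
    qed
    \<comment> \<open>Both vectors are coordinates of \<open>t b\<^sub>j\<close>, which are unique.\<close>
    moreover define coords_of_tb where "coords_of_tb c \<longleftrightarrow> c \<in> carrier_vec n \<and>
      monom 1 1 \<odot>\<^bsub>?M\<^esub> b j = (\<Oplus>\<^bsub>?M\<^esub>i\<in>{..<n}. [:c $ i:] \<odot>\<^bsub>?M\<^esub> b i)" for c
    have "\<exists>!c. coords_of_tb c"
      using basis X.M.smult_closed[OF _ bc[OF j], of "monom 1 1"]
      unfolding is_coeff_basis_def coords_of_tb_def by simp
    moreover have cB: "col B j \<in> carrier_vec n" using B by (simp add: carrier_vecI)
    moreover have cA: "A0 *\<^sub>v ?u + \<pi> \<cdot>\<^sub>v y j \<in> carrier_vec n" using A0u \<pi>y by simp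
    ultimately have "coords_of_tb (col B j)" "coords_of_tb (A0 *\<^sub>v ?u + \<pi> \<cdot>\<^sub>v y j)"
      unfolding coords_of_tb_def using comb[OF cB] comb[OF cA] by simp_all
    with \<open>\<exists>!c. coords_of_tb c\<close> show ?thesis by blast
  qed
  show thesis
  proof (rule that[OF K(1) V(1)])
    show "B = A0 + \<pi> \<cdot>\<^sub>m K"
    proof (rule mat_col_eqI)
      fix j assume "j < dim_col (A0 + \<pi> \<cdot>\<^sub>m K)"
      with K have j: "j < n" by simp
      have "col K j = y j" using mult_mat_unit_vec[OF K(1) j] K(2)[OF j] by simp
      moreover have "col (A0 + \<pi> \<cdot>\<^sub>m K) j = col A0 j + \<pi> \<cdot>\<^sub>v col K j"
        using A0 K(1) j by (intro eq_vecI) auto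
      ultimately show "col B j = col (A0 + \<pi> \<cdot>\<^sub>m K) j"
        using colB[OF j] mult_mat_unit_vec[OF A0 j] by simp
    qed (use B A0 K(1) in auto)
    show "map_mat red K = D + (A * V - V * A)"
    proof (rule mat_col_eqI)
      fix j assume "j < dim_col (D + (A * V - V * A))"
      with A have j: "j < n" by simp
      have "col (map_mat red K) j = map_vec red (col K j)" using K(1) j by (intro eq_vecI) auto
      also have "\<dots> = x j" using mult_mat_unit_vec[OF K(1) j] K(2)[OF j] y(2)[OF j] by simp
      also have "\<dots> = col D j + (A *\<^sub>v col V j - V *\<^sub>v col A j)"
        unfolding x_def V(2)[OF j, symmetric] mult_mat_unit_vec[OF V(1) j] mult_mat_unit_vec[OF D j]
          mult_mat_unit_vec[OF A j] by (rule refl)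
      also have "\<dots> = col (D + (A * V - V * A)) j"
        using D A V(1) j by (intro eq_vecI) auto
      finally show "col (map_mat red K) j = col (D + (A * V - V * A)) j" .
    qed (use D A V(1) K(1) in auto)
  qed
qed

lemma extension_coordinates_restrict:
  assumes coords: "extension_coordinates id 0 A X s (0\<^sub>m n n) D" and A: "A \<in> carrier_mat n n"
    and A0: "A0 \<in> carrier_mat n n" and red_A0: "map_mat red A0 = A"
  shows "extension_coordinates red \<pi> A0 (restrict_extension (map_poly red) X) (\<lambda>v. s (map_vec red v)) (0\<^sub>m n n) D"
proof -
  note co = extension_coordinatesD[OF coords A]
  note sD = coefficient_linearD[OF co(1)]
  let ?X = "restrict_extension (map_poly red) X"
  have smult: "p \<odot>\<^bsub>middle ?X\<^esub> m = map_poly red p \<odot>\<^bsub>middle X\<^esub> m" for p m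
    by (simp add: restrict_extension_def restrict_scalars_def)
  have rest: "carrier (middle ?X) = carrier (middle X)" "add (middle ?X) = add (middle X)"
    "incl ?X = incl X" "proj ?X = proj X"
    by (simp_all add: restrict_extension_def restrict_scalars_def)
  have dim: "dim_row A0 = n" using A0 by simp
  have id_vec: "map_vec id v = v" for v :: "'k vec" by (intro eq_vecI) auto
  have C: "map_poly red [:r:] = [:red r:]" for r
    by (intro poly_eqI) (simp add: coeff_pCons split: nat.split)
  show ?thesis unfolding extension_coordinates_def dim
  proof (intro conjI ballI)
    show "coefficient_linear (middle ?X) n (\<lambda>v. s (map_vec red v))"
    proof (rule coefficient_linearI)
      fix v w :: "'r vec" and r assume v: "v \<in> carrier_vec n" and w: "w \<in> carrier_vec n"
      have v': "map_vec red v \<in> carrier_vec n" and w': "map_vec red w \<in> carrier_vec n" using v w by simp_all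
      show "s (map_vec red v) \<in> carrier (middle ?X)" unfolding rest by (rule sD(1)[OF v'])
      have "map_vec red (r \<cdot>\<^sub>v v) = red r \<cdot>\<^sub>v map_vec red v" using v by (intro eq_vecI) (auto simp: hom_distribs)
      then show "s (map_vec red (r \<cdot>\<^sub>v v)) = [:r:] \<odot>\<^bsub>middle ?X\<^esub> s (map_vec red v)"
        unfolding smult C using sD(2)[OF v'] by simp
      have "map_vec red (v + w) = map_vec red v + map_vec red w" using v w by (intro eq_vecI) (auto simp: hom_distribs)
      then show "s (map_vec red (v + w)) = s (map_vec red v) \<oplus>\<^bsub>middle ?X\<^esub> s (map_vec red w)"
        unfolding rest using sD(3)[OF v' w'] by simp
    qed
    fix v :: "'r vec" assume v: "v \<in> carrier_vec n"
    have v': "map_vec red v \<in> carrier_vec n" using v by simp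
    show "proj ?X (s (map_vec red v)) = map_vec red v" unfolding rest using co(2)[OF v'] by (simp add: id_vec)
    have "map_poly red (monom 1 1) = monom 1 1" by simp
    then show "monom 1 1 \<odot>\<^bsub>middle ?X\<^esub> s (map_vec red v)
        = s (map_vec red (A0 *\<^sub>v v)) \<oplus>\<^bsub>middle ?X\<^esub> incl ?X (D *\<^sub>v map_vec red v)"
      unfolding smult rest mult_mat_vec_hom[OF A0 v] red_A0 using co(3)[OF v'] by (simp add: id_vec)
    show "[:\<pi>:] \<odot>\<^bsub>middle ?X\<^esub> s (map_vec red v) = incl ?X (0\<^sub>m n n *\<^sub>v map_vec red v)"
      unfolding smult rest C using co(4)[OF v'] by (simp add: id_vec)
  qed
qed

end

section \<open>Modules of companion blocks\<close>

text \<open>The module \<open>\<Oplus> k[t]/(f\<^sub>i)\<close> on coordinate vectors. Computations take place in the components: a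
  vector is determined by its block polynomials modulo the \<open>f\<^sub>i\<close>.\<close>

locale companion_module =
  fixes fs :: "'k :: field poly list" and N :: "('k poly, 'k vec) module" and n :: nat and A :: "'k mat"
  assumes fs: "\<And>i. i < length fs \<Longrightarrow> lead_coeff (fs ! i) = 1 \<and> 0 < degree (fs ! i)"
    and n_def: "n = block_offset fs (length fs)" and A_def: "A = companion_blocks fs"
    and module_N: "Module.module class_ring N" and matrix_N: "module_of_matrix id A N"
begin

sublocale N: Module.module class_ring N by (rule module_N)

lemma A: "A \<in> carrier_mat n n"
  unfolding A_def n_def by (rule companion_blocks_carrier)

lemmas ND = module_of_matrixD[OF matrix_N A]

lemma smult_closed: "v \<in> carrier_vec n \<Longrightarrow> h \<odot>\<^bsub>N\<^esub> v \<in> carrier_vec n"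
  using N.smult_closed[of h v] ND(2) by simp

lemma smult_pCons:
  assumes v: "v \<in> carrier_vec n"
  shows "pCons a q \<odot>\<^bsub>N\<^esub> v = a \<cdot>\<^sub>v v + A *\<^sub>v (q \<odot>\<^bsub>N\<^esub> v)"
proof -
  have "pCons a q = [:a:] + monom 1 1 * q" by (simp add: monom_altdef)
  then have "pCons a q \<odot>\<^bsub>N\<^esub> v = [:a:] \<odot>\<^bsub>N\<^esub> v \<oplus>\<^bsub>N\<^esub> (monom 1 1 * q) \<odot>\<^bsub>N\<^esub> v"
    using N.smult_l_distr[of "[:a:]" "monom 1 1 * q" v] v ND(2) by simp
  also have "(monom 1 1 * q) \<odot>\<^bsub>N\<^esub> v = monom 1 1 \<odot>\<^bsub>N\<^esub> (q \<odot>\<^bsub>N\<^esub> v)"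
    using N.smult_assoc1[of "monom 1 1" q v] v ND(2) by simp
  also have "\<dots> = A *\<^sub>v (q \<odot>\<^bsub>N\<^esub> v)" by (rule ND(6)[OF smult_closed[OF v]])
  finally show ?thesis unfolding ND(5)[OF v] ND(3) by simp
qed

lemma smult_0: "v \<in> carrier_vec n \<Longrightarrow> 0 \<odot>\<^bsub>N\<^esub> v = 0\<^sub>v n"
  using N.smult_l_null[of v] ND(2,4) by simp

lemma block_poly_0: "i < length fs \<Longrightarrow> block_poly fs i (0\<^sub>v n) = 0"
  using block_offset_less[of i "length fs" _ fs]
  by (intro poly_eqI) (simp add: coeff_block_poly n_def)

lemma block_poly_A_cong:
  assumes v: "v \<in> carrier_vec n" and i: "i < length fs"
  shows "[block_poly fs i (A *\<^sub>v v) = pCons 0 (block_poly fs i v)] (mod fs ! i)"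
  using block_poly_companion[OF v[unfolded n_def] i] fs[OF i]
  unfolding A_def cong_iff_dvd_diff by (simp add: dvd_smult)

lemma block_poly_smult_cong:
  assumes v: "v \<in> carrier_vec n" and i: "i < length fs"
  shows "[block_poly fs i (h \<odot>\<^bsub>N\<^esub> v) = h * block_poly fs i v] (mod fs ! i)"
proof (induction h rule: pCons_induct)
  case 0
  then show ?case using v i by (simp add: smult_0 block_poly_0)
next
  case (pCons a q)
  have qv: "q \<odot>\<^bsub>N\<^esub> v \<in> carrier_vec n" by (rule smult_closed[OF v])
  have "block_poly fs i (pCons a q \<odot>\<^bsub>N\<^esub> v)
      = Polynomial.smult a (block_poly fs i v) + block_poly fs i (A *\<^sub>v (q \<odot>\<^bsub>N\<^esub> v))"
    unfolding smult_pCons[OF v] using v i qv mult_mat_vec_carrier[OF A qv]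
    by (simp add: block_poly_add block_poly_smult n_def)
  also have "[\<dots> = Polynomial.smult a (block_poly fs i v) + pCons 0 (block_poly fs i (q \<odot>\<^bsub>N\<^esub> v))] (mod fs ! i)"
    by (rule cong_add[OF cong_refl block_poly_A_cong[OF qv i]])
  also have "[Polynomial.smult a (block_poly fs i v) + pCons 0 (block_poly fs i (q \<odot>\<^bsub>N\<^esub> v))
      = Polynomial.smult a (block_poly fs i v) + [:0, 1:] * (q * block_poly fs i v)] (mod fs ! i)"
    unfolding pCons_as_mult[of "block_poly fs i (q \<odot>\<^bsub>N\<^esub> v)"]
    by (rule cong_add[OF cong_refl cong_mult[OF cong_refl pCons.IH]])
  also have "Polynomial.smult a (block_poly fs i v) + [:0, 1:] * (q * block_poly fs i v)
      = pCons a q * block_poly fs i v" by simp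
  finally show ?case .
qed

lemma vec_eqI_cong:
  assumes v: "v \<in> carrier_vec n" and w: "w \<in> carrier_vec n"
    and "\<And>i. i < length fs \<Longrightarrow> [block_poly fs i v = block_poly fs i w] (mod fs ! i)"
  shows "v = w"
proof -
  have "block_poly fs i v = block_poly fs i w" if i: "i < length fs" for i
    using assms(3)[OF i] degree_block_poly[of fs i] fs[OF i] unfolding cong_def
    by (simp add: mod_poly_less)
  then show ?thesis using vec_eq_iff_block_poly[OF v[unfolded n_def] w[unfolded n_def]] by blast
qed

definition generator :: "nat \<Rightarrow> 'k vec" where
  "generator i = unit_vec n (block_offset fs i)"

lemma generator_closed: "generator i \<in> carrier_vec n"
  by (simp add: generator_def)

lemma block_poly_generator:
  assumes i: "i < length fs" and j: "j < length fs"
  shows "block_poly fs i (generator j) = (if i = j then 1 else 0)"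
proof (rule poly_eqI)
  fix a
  have "block_offset fs i + a = block_offset fs j \<longleftrightarrow> i = j \<and> a = 0" if "a < degree (fs ! i)"
  proof -
    have "0 < degree (fs ! j)" using fs[OF j] by simp
    then show ?thesis
      using that block_offset_less[of i j a fs] block_offset_less[of j i 0 fs]
      by (cases i j rule: linorder_cases) auto
  qed
  then show "coeff (block_poly fs i (generator j)) a = coeff (if i = j then 1 else 0) a"
    using fs[OF i] block_offset_less[OF i, of a fs, folded n_def]
    by (auto simp: coeff_block_poly generator_def unit_vec_def coeff_1)
qed

lemma smult_generator_cong:
  assumes "i < length fs" "j < length fs"
  shows "[block_poly fs i (h \<odot>\<^bsub>N\<^esub> generator j) = (if i = j then h else 0)] (mod fs ! i)"
  using block_poly_smult_cong[OF generator_closed assms(1), of h j] block_poly_generator[OF assms]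
  by (simp split: if_splits)

lemma smult_generator_self:
  assumes j: "j < length fs"
  shows "fs ! j \<odot>\<^bsub>N\<^esub> generator j = 0\<^sub>v n"
proof (rule vec_eqI_cong[OF smult_closed[OF generator_closed]])
  fix i assume i: "i < length fs"
  show "[block_poly fs i (fs ! j \<odot>\<^bsub>N\<^esub> generator j) = block_poly fs i (0\<^sub>v n)] (mod fs ! i)"
    using smult_generator_cong[OF i j, of "fs ! j"] by (auto simp: block_poly_0[OF i] cong_def)
qed simp

text \<open>The columns of the symmetric matrix are the Horner polynomials applied to the generators. They
  arise because the defect of \<open>f\<^sub>j\<close> on a section involves exactly these truncations of \<open>f\<^sub>j\<close>.\<close>

lemma col_hankel_eq_smult:
  assumes j: "j < length fs" and a: "a < degree (fs ! j)"
  shows "poly_shift (Suc a) (fs ! j) \<odot>\<^bsub>N\<^esub> generator j = col (hankel_blocks fs) (block_offset fs j + a)"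
proof (rule vec_eqI_cong[OF smult_closed[OF generator_closed]])
  show "col (hankel_blocks fs) (block_offset fs j + a) \<in> carrier_vec n"
    using hankel_blocks_carrier[of fs] by (simp add: n_def carrier_vecI)
  fix i assume i: "i < length fs"
  show "[block_poly fs i (poly_shift (Suc a) (fs ! j) \<odot>\<^bsub>N\<^esub> generator j)
      = block_poly fs i (col (hankel_blocks fs) (block_offset fs j + a))] (mod fs ! i)"
    using smult_generator_cong[OF i j] block_poly_col_hankel[OF i j a] by simp
qed

end

locale companion_extension = companion_module fs N n A
  for fs :: "'k :: field poly list" and N n A +
  fixes X :: "('k poly, 'k vec, 'm, 'k vec) extension" and s :: "'k vec \<Rightarrow> 'm" and U D :: "'k mat"
  assumes is_ext: "is_extension class_ring N N X"
    and coords: "extension_coordinates id 0 A X s U D" and D: "D \<in> carrier_mat n n"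
begin

sublocale X: module_extension class_ring N N X by (rule module_extension.intro[OF is_ext])

lemmas co = extension_coordinatesD[OF coords A]
lemmas sD = coefficient_linearD[OF co(1)]

lemma id_vec: "map_vec id v = (v :: 'k vec)"
  by (intro eq_vecI) auto

lemma s_0: "s (0\<^sub>v n) = \<zero>\<^bsub>middle X\<^esub>"
proof -
  have "s (0 \<cdot>\<^sub>v 0\<^sub>v n) = \<zero>\<^bsub>middle X\<^esub>"
    using sD(2)[of "0\<^sub>v n" 0] X.M.smult_l_null[OF sD(1)[of "0\<^sub>v n"]] by simp
  moreover have "0 \<cdot>\<^sub>v 0\<^sub>v n = (0\<^sub>v n :: 'k vec)" by (intro eq_vecI) auto
  ultimately show ?thesis by simp
qed

text \<open>Since \<open>t s = s t + D\<close> on the section, moving a power of \<open>t\<close> past \<open>s\<close> gives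
  \<open>t\<^sup>m s = s t\<^sup>m + \<Sum> t\<^sup>a D t ^ (m - 1 - a)\<close>, the sum over \<open>a < m\<close>. Summing over the terms of \<open>h\<close>
  collects the truncations \<open>h div t ^ (a + 1)\<close> to the right of \<open>t\<^sup>a D\<close>.\<close>

lemma smult_section:
  assumes v: "v \<in> carrier_vec n" and "length (coeffs h) \<le> m"
  shows "\<exists>\<delta>\<in>carrier_vec n. h \<odot>\<^bsub>middle X\<^esub> s v = s (h \<odot>\<^bsub>N\<^esub> v) \<oplus>\<^bsub>middle X\<^esub> incl X \<delta> \<and>
    (\<forall>i<length fs. [block_poly fs i \<delta>
       = (\<Sum>a<m. monom 1 a * block_poly fs i (D *\<^sub>v (poly_shift (Suc a) h \<odot>\<^bsub>N\<^esub> v)))] (mod fs ! i))"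
  using assms(2)
proof (induction h arbitrary: m rule: pCons_induct)
  case 0
  have "0 \<odot>\<^bsub>middle X\<^esub> s v = s (0 \<odot>\<^bsub>N\<^esub> v) \<oplus>\<^bsub>middle X\<^esub> incl X (0\<^sub>v n)"
    using X.M.smult_l_null[OF sD(1)[OF v]] s_0 smult_0[OF v] X.incl.f0_is_0 ND(4) by simp
  moreover have "D *\<^sub>v 0\<^sub>v n = 0\<^sub>v n" using D by (intro eq_vecI) auto
  ultimately show ?case using smult_0[OF v] by (intro bexI[of _ "0\<^sub>v n"]) (auto simp: block_poly_0)
next
  case (pCons a q)
  then obtain m' where m: "m = Suc m'" "length (coeffs q) \<le> m'"
    by (cases m) (auto simp: cCons_def split: if_splits)
  let ?M = "middle X" and ?t = "monom 1 1 :: 'k poly"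
  from pCons.IH[OF m(2)] obtain \<delta> where \<delta>: "\<delta> \<in> carrier_vec n"
    and eq: "q \<odot>\<^bsub>?M\<^esub> s v = s (q \<odot>\<^bsub>N\<^esub> v) \<oplus>\<^bsub>?M\<^esub> incl X \<delta>"
    and cong: "\<And>i. i < length fs \<Longrightarrow> [block_poly fs i \<delta>
       = (\<Sum>a<m'. monom 1 a * block_poly fs i (D *\<^sub>v (poly_shift (Suc a) q \<odot>\<^bsub>N\<^esub> v)))] (mod fs ! i)"
    by auto
  let ?qv = "q \<odot>\<^bsub>N\<^esub> v"
  have qv: "?qv \<in> carrier_vec n" by (rule smult_closed[OF v])
  have Dqv: "D *\<^sub>v ?qv \<in> carrier_vec n" by (rule mult_mat_vec_carrier[OF D qv])
  have Aqv: "A *\<^sub>v ?qv \<in> carrier_vec n" by (rule mult_mat_vec_carrier[OF A qv])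
  have A\<delta>: "A *\<^sub>v \<delta> \<in> carrier_vec n" by (rule mult_mat_vec_carrier[OF A \<delta>])
  define \<delta>' where "\<delta>' = D *\<^sub>v ?qv + A *\<^sub>v \<delta>"
  have \<delta>': "\<delta>' \<in> carrier_vec n" using Dqv A\<delta> by (simp add: \<delta>'_def)
  have inclc: "incl X w \<in> carrier ?M" if "w \<in> carrier_vec n" for w
    using X.incl.f_im[of w] that ND(2) by simp
  have "pCons a q = [:a:] + ?t * q" by (simp add: monom_altdef)
  then have "pCons a q \<odot>\<^bsub>?M\<^esub> s v = [:a:] \<odot>\<^bsub>?M\<^esub> s v \<oplus>\<^bsub>?M\<^esub> (?t * q) \<odot>\<^bsub>?M\<^esub> s v"
    using X.M.smult_l_distr[of "[:a:]" "?t * q" "s v"] sD(1)[OF v] by simp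
  also have "(?t * q) \<odot>\<^bsub>?M\<^esub> s v = ?t \<odot>\<^bsub>?M\<^esub> (s ?qv \<oplus>\<^bsub>?M\<^esub> incl X \<delta>)"
    using X.M.smult_assoc1[of ?t q "s v"] sD(1)[OF v] eq by simp
  also have "\<dots> = ?t \<odot>\<^bsub>?M\<^esub> s ?qv \<oplus>\<^bsub>?M\<^esub> ?t \<odot>\<^bsub>?M\<^esub> incl X \<delta>"
    by (rule X.M.smult_r_distr[OF _ sD(1)[OF qv] inclc[OF \<delta>]]) simp
  also have "?t \<odot>\<^bsub>?M\<^esub> incl X \<delta> = incl X (A *\<^sub>v \<delta>)"
    unfolding ND(6)[OF \<delta>, symmetric] by (rule X.incl.f_smult[symmetric]) (use \<delta> ND(2) in simp_all)
  also have "?t \<odot>\<^bsub>?M\<^esub> s ?qv = s (A *\<^sub>v ?qv) \<oplus>\<^bsub>?M\<^esub> incl X (D *\<^sub>v ?qv)"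
    using co(3)[OF qv] unfolding id_vec .
  also have "[:a:] \<odot>\<^bsub>?M\<^esub> s v = s (a \<cdot>\<^sub>v v)" by (rule sD(2)[OF v, symmetric])
  also have "s (a \<cdot>\<^sub>v v) \<oplus>\<^bsub>?M\<^esub> (s (A *\<^sub>v ?qv) \<oplus>\<^bsub>?M\<^esub> incl X (D *\<^sub>v ?qv) \<oplus>\<^bsub>?M\<^esub> incl X (A *\<^sub>v \<delta>))
      = (s (a \<cdot>\<^sub>v v) \<oplus>\<^bsub>?M\<^esub> s (A *\<^sub>v ?qv)) \<oplus>\<^bsub>?M\<^esub> (incl X (D *\<^sub>v ?qv) \<oplus>\<^bsub>?M\<^esub> incl X (A *\<^sub>v \<delta>))"
    using sD(1) v Aqv inclc[OF Dqv] inclc[OF A\<delta>] by (simp add: X.M.a_assoc)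
  also have "s (a \<cdot>\<^sub>v v) \<oplus>\<^bsub>?M\<^esub> s (A *\<^sub>v ?qv) = s (pCons a q \<odot>\<^bsub>N\<^esub> v)"
    unfolding smult_pCons[OF v] by (rule sD(3)[symmetric]) (use v Aqv in simp_all)
  also have "incl X (D *\<^sub>v ?qv) \<oplus>\<^bsub>?M\<^esub> incl X (A *\<^sub>v \<delta>) = incl X \<delta>'"
    unfolding \<delta>'_def using X.incl.f_add[of "D *\<^sub>v ?qv" "A *\<^sub>v \<delta>"] Dqv A\<delta> ND(2,3) by simp
  finally have 1: "pCons a q \<odot>\<^bsub>?M\<^esub> s v = s (pCons a q \<odot>\<^bsub>N\<^esub> v) \<oplus>\<^bsub>?M\<^esub> incl X \<delta>'" .
  have shift: "poly_shift (Suc 0) (pCons a q) = q" "poly_shift (Suc (Suc b)) (pCons a q) = poly_shift (Suc b) q" for b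
    by (auto intro!: poly_eqI simp: coeff_poly_shift)
  have 2: "[block_poly fs i \<delta>'
       = (\<Sum>b<m. monom 1 b * block_poly fs i (D *\<^sub>v (poly_shift (Suc b) (pCons a q) \<odot>\<^bsub>N\<^esub> v)))] (mod fs ! i)"
    if i: "i < length fs" for i
  proof -
    let ?S = "\<Sum>a<m'. monom 1 a * block_poly fs i (D *\<^sub>v (poly_shift (Suc a) q \<odot>\<^bsub>N\<^esub> v))"
    have "block_poly fs i \<delta>' = block_poly fs i (D *\<^sub>v ?qv) + block_poly fs i (A *\<^sub>v \<delta>)"
      unfolding \<delta>'_def using Dqv A\<delta> i by (intro block_poly_add) (simp_all add: n_def)
    also have "[\<dots> = block_poly fs i (D *\<^sub>v ?qv) + pCons 0 (block_poly fs i \<delta>)] (mod fs ! i)"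
      by (rule cong_add[OF cong_refl block_poly_A_cong[OF \<delta> i]])
    also have "[block_poly fs i (D *\<^sub>v ?qv) + pCons 0 (block_poly fs i \<delta>)
        = block_poly fs i (D *\<^sub>v ?qv) + [:0, 1:] * ?S] (mod fs ! i)"
      unfolding pCons_as_mult[of "block_poly fs i \<delta>"]
      by (rule cong_add[OF cong_refl cong_mult[OF cong_refl cong[OF i]]])
    also have "block_poly fs i (D *\<^sub>v ?qv) + [:0, 1:] * ?S
       = (\<Sum>b<m. monom 1 b * block_poly fs i (D *\<^sub>v (poly_shift (Suc b) (pCons a q) \<odot>\<^bsub>N\<^esub> v)))"
    proof -
      have "monom 1 (Suc b) = [:0, 1:] * (monom 1 b :: 'k poly)" for b by (simp add: monom_Suc)
      then show ?thesis unfolding m(1) sum.lessThan_Suc_shift sum_distrib_left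
        by (simp add: shift mult.assoc del: mult_pCons_left)
    qed
    finally show ?thesis .
  qed
  from \<delta>' 1 2 show ?case by blast
qed

text \<open>For \<open>h = f\<^sub>j\<close> and the generator of the \<open>j\<close>-th summand, the truncations give the columns of \<open>T\<close>, so
  the defect of \<open>f\<^sub>j\<close> is \<open>\<Sum> t\<^sup>a\<close> times column \<open>a\<close> of \<open>D T\<close>, whose components are contractions. This is
  where the matrix of an extension meets the symmetric matrix \<open>T\<close>.\<close>

lemma smult_section_generator:
  assumes j: "j < length fs"
  obtains \<delta> where "\<delta> \<in> carrier_vec n" "fs ! j \<odot>\<^bsub>middle X\<^esub> s (generator j) = incl X \<delta>"
    "\<And>i. i < length fs \<Longrightarrow> [block_poly fs i \<delta> = contract fs (D * hankel_blocks fs) i j] (mod fs ! i)"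
proof -
  let ?T = "hankel_blocks fs" and ?d = "degree (fs ! j)"
  have T: "?T \<in> carrier_mat n n" unfolding n_def by (rule hankel_blocks_carrier)
  have "fs ! j \<noteq> 0" using fs[OF j] by auto
  then have len: "length (coeffs (fs ! j)) \<le> Suc ?d" by (simp add: length_coeffs_degree)
  obtain \<delta> where \<delta>: "\<delta> \<in> carrier_vec n"
    and eq: "fs ! j \<odot>\<^bsub>middle X\<^esub> s (generator j) = s (fs ! j \<odot>\<^bsub>N\<^esub> generator j) \<oplus>\<^bsub>middle X\<^esub> incl X \<delta>"
    and cong: "\<And>i. i < length fs \<Longrightarrow> [block_poly fs i \<delta> = (\<Sum>a<Suc ?d. monom 1 a *
       block_poly fs i (D *\<^sub>v (poly_shift (Suc a) (fs ! j) \<odot>\<^bsub>N\<^esub> generator j)))] (mod fs ! i)"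
    using smult_section[OF generator_closed len] by blast
  show thesis
  proof (rule that[OF \<delta>])
    show "fs ! j \<odot>\<^bsub>middle X\<^esub> s (generator j) = incl X \<delta>"
      unfolding eq smult_generator_self[OF j] s_0 using X.incl.f_im[of \<delta>] \<delta> ND(2) by simp
    fix i assume i: "i < length fs"
    have "poly_shift (Suc ?d) (fs ! j) = 0" by (intro poly_eqI) (simp add: coeff_poly_shift coeff_eq_0)
    moreover have "D *\<^sub>v 0\<^sub>v n = 0\<^sub>v n" using D by (intro eq_vecI) auto
    ultimately have "(\<Sum>a<Suc ?d. monom 1 a *
        block_poly fs i (D *\<^sub>v (poly_shift (Suc a) (fs ! j) \<odot>\<^bsub>N\<^esub> generator j)))
      = (\<Sum>a<?d. monom 1 a * block_poly fs i (D *\<^sub>v (poly_shift (Suc a) (fs ! j) \<odot>\<^bsub>N\<^esub> generator j)))"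
      using smult_0[OF generator_closed] block_poly_0[OF i] by simp
    also have "\<dots> = (\<Sum>a<?d. monom 1 a * block_poly fs i (col (D * ?T) (block_offset fs j + a)))"
    proof (intro sum.cong refl)
      fix a assume "a \<in> {..<?d}"
      then have a: "a < ?d" by simp
      have "block_offset fs j + a < n" unfolding n_def by (rule block_offset_less[OF j a])
      then show "monom 1 a * block_poly fs i (D *\<^sub>v (poly_shift (Suc a) (fs ! j) \<odot>\<^bsub>N\<^esub> generator j))
          = monom 1 a * block_poly fs i (col (D * ?T) (block_offset fs j + a))"
        using col_hankel_eq_smult[OF j a] col_mult2[OF D T] by simp
    qed
    also have "\<dots> = contract fs (D * ?T) i j"
      using D T i j by (intro contract_block_poly[symmetric]) (simp_all add: n_def)
    finally show "[block_poly fs i \<delta> = contract fs (D * ?T) i j] (mod fs ! i)" using cong[OF i] by simp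
  qed
qed

lemma finsum_generators:
  assumes "m \<le> length fs"
  shows "\<exists>w\<in>carrier_vec n. (\<Oplus>\<^bsub>middle X\<^esub>i\<in>{..<m}. \<epsilon> i \<odot>\<^bsub>middle X\<^esub> incl X (generator i)) = incl X w \<and>
    (\<forall>i<length fs. [block_poly fs i w = (if i < m then \<epsilon> i else 0)] (mod fs ! i))"
  using assms
proof (induction m)
  case 0
  then show ?case using X.incl.f0_is_0 ND(4)
    by (intro bexI[of _ "0\<^sub>v n"]) (auto simp: block_poly_0)
next
  case (Suc m)
  let ?M = "middle X"
  from Suc obtain w where w: "w \<in> carrier_vec n"
    and eq: "(\<Oplus>\<^bsub>?M\<^esub>i\<in>{..<m}. \<epsilon> i \<odot>\<^bsub>?M\<^esub> incl X (generator i)) = incl X w"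
    and cong: "\<And>i. i < length fs \<Longrightarrow> [block_poly fs i w = (if i < m then \<epsilon> i else 0)] (mod fs ! i)"
    by auto
  have m: "m < length fs" using Suc.prems by simp
  let ?g = "\<epsilon> m \<odot>\<^bsub>N\<^esub> generator m"
  have g: "?g \<in> carrier_vec n" by (rule smult_closed[OF generator_closed])
  have inclg: "\<epsilon> i \<odot>\<^bsub>?M\<^esub> incl X (generator i) \<in> carrier ?M" for i
    using X.M.smult_closed[of "\<epsilon> i" "incl X (generator i)"] X.incl.f_im[of "generator i"] generator_closed ND(2)
    by simp
  have "(\<Oplus>\<^bsub>?M\<^esub>i\<in>{..<Suc m}. \<epsilon> i \<odot>\<^bsub>?M\<^esub> incl X (generator i)) = \<epsilon> m \<odot>\<^bsub>?M\<^esub> incl X (generator m) \<oplus>\<^bsub>?M\<^esub> incl X w"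
    unfolding lessThan_Suc using inclg eq by (subst X.M.finsum_insert) auto
  also have "\<epsilon> m \<odot>\<^bsub>?M\<^esub> incl X (generator m) = incl X ?g"
    by (rule X.incl.f_smult[symmetric]) (use generator_closed ND(2) in simp_all)
  also have "incl X ?g \<oplus>\<^bsub>?M\<^esub> incl X w = incl X (?g + w)"
    using X.incl.f_add[of ?g w] g w ND(2,3) by simp
  finally have 1: "(\<Oplus>\<^bsub>?M\<^esub>i\<in>{..<Suc m}. \<epsilon> i \<odot>\<^bsub>?M\<^esub> incl X (generator i)) = incl X (?g + w)" .
  have 2: "[block_poly fs i (?g + w) = (if i < Suc m then \<epsilon> i else 0)] (mod fs ! i)" if i: "i < length fs" for i
  proof -
    have "block_poly fs i (?g + w) = block_poly fs i ?g + block_poly fs i w"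
      using g w i by (intro block_poly_add) (simp_all add: n_def)
    also have "[\<dots> = (if i = m then \<epsilon> m else 0) + (if i < m then \<epsilon> i else 0)] (mod fs ! i)"
      by (rule cong_add[OF smult_generator_cong[OF i m] cong[OF i]])
    also have "(if i = m then \<epsilon> m else 0) + (if i < m then \<epsilon> i else 0) = (if i < Suc m then \<epsilon> i else 0)"
      by (auto simp: less_Suc_eq)
    finally show ?thesis .
  qed
  from g w 1 2 show ?case by (intro bexI[of _ "?g + w"]) auto
qed

end

section \<open>The action of automorphisms\<close>

context companion_module
begin

lemma module_aut_matrix:
  assumes g: "g \<in> module_aut class_ring N"
  obtains G H where "G \<in> carrier_mat n n" "H \<in> carrier_mat n n" "G * H = 1\<^sub>m n" "H * G = 1\<^sub>m n"
    "G * A = A * G" "\<And>v. v \<in> carrier_vec n \<Longrightarrow> g v = G *\<^sub>v v"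
proof -
  have hom: "g \<in> LinearCombinations.module_hom class_ring N N" and bij: "bij_betw g (carrier N) (carrier N)"
    using g by (simp_all add: module_aut_def)
  have gc: "g v \<in> carrier_vec n" if "v \<in> carrier_vec n" for v
    using funcset_mem[OF LinearCombinations.module_hom_closed[OF hom], of v] that by (simp add: ND(2))
  have ga: "g (v + w) = g v + g w" if "v \<in> carrier_vec n" "w \<in> carrier_vec n" for v w
    using LinearCombinations.module_hom_add[OF hom, of v w] that by (simp add: ND(2,3))
  have gs: "g (h \<odot>\<^bsub>N\<^esub> v) = h \<odot>\<^bsub>N\<^esub> g v" if "v \<in> carrier_vec n" for h v
    using LinearCombinations.module_hom_smult[OF hom, of h v] that by (simp add: ND(2))
  obtain G where G: "G \<in> carrier_mat n n" "\<And>j. j < n \<Longrightarrow> G *\<^sub>v unit_vec n j = g (unit_vec n j)"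
    by (rule ex_mat_of_columns[of n "\<lambda>j. g (unit_vec n j)"]) (auto intro: gc)
  have lin_g: "coefficient_linear N n g"
  proof (rule coefficient_linearI)
    fix v w :: "'k vec" and r assume v: "v \<in> carrier_vec n" and w: "w \<in> carrier_vec n"
    show "g v \<in> carrier N" unfolding ND(2) by (rule gc[OF v])
    show "g (r \<cdot>\<^sub>v v) = [:r:] \<odot>\<^bsub>N\<^esub> g v" using gs[OF v, of "[:r:]"] ND(5)[OF v] by simp
    show "g (v + w) = g v \<oplus>\<^bsub>N\<^esub> g w" unfolding ND(3) by (rule ga[OF v w])
  qed
  have lin_G: "coefficient_linear N n (\<lambda>v. G *\<^sub>v v)"
  proof (rule coefficient_linearI)
    fix v w :: "'k vec" and r assume v: "v \<in> carrier_vec n" and w: "w \<in> carrier_vec n"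
    have Gv: "G *\<^sub>v v \<in> carrier_vec n" by (rule mult_mat_vec_carrier[OF G(1) v])
    show "G *\<^sub>v v \<in> carrier N" unfolding ND(2) by (rule Gv)
    show "G *\<^sub>v (r \<cdot>\<^sub>v v) = [:r:] \<odot>\<^bsub>N\<^esub> (G *\<^sub>v v)"
      unfolding ND(5)[OF Gv] using mult_mat_smult_vec[OF G(1) v] by simp
    show "G *\<^sub>v (v + w) = G *\<^sub>v v \<oplus>\<^bsub>N\<^esub> G *\<^sub>v w"
      unfolding ND(3) by (rule mult_add_distrib_mat_vec[OF G(1) v w])
  qed
  have gG: "g v = G *\<^sub>v v" if "v \<in> carrier_vec n" for v
    by (rule coefficient_linear_eqI[OF module_N lin_g lin_G _ that]) (simp add: G(2))
  have "det G \<noteq> 0"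
  proof
    assume "det G = 0"
    then obtain v where v: "v \<in> carrier_vec n" "v \<noteq> 0\<^sub>v n" "G *\<^sub>v v = 0\<^sub>v n"
      using det_0_iff_vec_prod_zero_field[OF G(1)] by auto
    have "G *\<^sub>v 0\<^sub>v n = 0\<^sub>v n" using G(1) by (intro eq_vecI) auto
    then have "g v = g (0\<^sub>v n)" using gG v by simp
    then show False using bij v unfolding bij_betw_def inj_on_def ND(2) by auto
  qed
  then have "det G dvd 1" by (simp add: dvd_field_iff)
  then obtain H where H: "H \<in> carrier_mat n n" "G * H = 1\<^sub>m n" "H * G = 1\<^sub>m n"
    by (rule ex_inverse_mat_if_det_unit[OF G(1)])
  have comm: "G * A = A * G"
  proof (rule mat_col_eqI)
    fix j assume "j < dim_col (A * G)"
    with G have j: "j < n" by simp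
    let ?u = "unit_vec n j :: 'k vec"
    have u: "?u \<in> carrier_vec n" by simp
    have "col (G * A) j = G *\<^sub>v (A *\<^sub>v ?u)"
      using col_mult2[OF G(1) A j] mult_mat_unit_vec[OF A j] by simp
    also have "\<dots> = g (monom 1 1 \<odot>\<^bsub>N\<^esub> ?u)"
      unfolding ND(6)[OF u] using gG[OF mult_mat_vec_carrier[OF A u]] by simp
    also have "\<dots> = A *\<^sub>v (G *\<^sub>v ?u)"
      unfolding gs[OF u] gG[OF u] by (rule ND(6)[OF mult_mat_vec_carrier[OF G(1) u]])
    also have "\<dots> = col (A * G) j"
      using col_mult2[OF A G(1) j] mult_mat_unit_vec[OF G(1) j] by simp
    finally show "col (G * A) j = col (A * G) j" .
  qed (use G(1) A in auto)
  show thesis by (rule that[OF G(1) H(1) H(2,3) comm gG])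
qed

lemma matrix_module_aut:
  assumes G: "G \<in> carrier_mat n n" and H: "H \<in> carrier_mat n n"
    and inv: "G * H = 1\<^sub>m n" "H * G = 1\<^sub>m n" and comm: "G * A = A * G"
  shows "(\<lambda>v. G *\<^sub>v v) \<in> module_aut class_ring N"
proof -
  have smult: "G *\<^sub>v (h \<odot>\<^bsub>N\<^esub> v) = h \<odot>\<^bsub>N\<^esub> (G *\<^sub>v v)" if v: "v \<in> carrier_vec n" for h v
  proof (induction h rule: pCons_induct)
    case 0
    have "G *\<^sub>v 0\<^sub>v n = 0\<^sub>v n" using G by (intro eq_vecI) auto
    then show ?case using smult_0[OF v] smult_0[OF mult_mat_vec_carrier[OF G v]] by simp
  next
    case (pCons a q)
    have qv: "q \<odot>\<^bsub>N\<^esub> v \<in> carrier_vec n" by (rule smult_closed[OF v])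
    have Aqv: "A *\<^sub>v (q \<odot>\<^bsub>N\<^esub> v) \<in> carrier_vec n" by (rule mult_mat_vec_carrier[OF A qv])
    have av: "a \<cdot>\<^sub>v v \<in> carrier_vec n" using v by simp
    have "G *\<^sub>v (A *\<^sub>v (q \<odot>\<^bsub>N\<^esub> v)) = A *\<^sub>v (G *\<^sub>v (q \<odot>\<^bsub>N\<^esub> v))"
      using assoc_mult_mat_vec[OF G A qv] assoc_mult_mat_vec[OF A G qv] comm by simp
    then show ?case
      unfolding smult_pCons[OF v] smult_pCons[OF mult_mat_vec_carrier[OF G v]]
        mult_add_distrib_mat_vec[OF G av Aqv] mult_mat_smult_vec[OF G v] pCons.IH by simp
  qed
  have Gc: "G *\<^sub>v v \<in> carrier_vec n" if "v \<in> carrier_vec n" for v by (rule mult_mat_vec_carrier[OF G that])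
  have Hc: "H *\<^sub>v v \<in> carrier_vec n" if "v \<in> carrier_vec n" for v by (rule mult_mat_vec_carrier[OF H that])
  have HG: "H *\<^sub>v (G *\<^sub>v v) = v" and GH: "G *\<^sub>v (H *\<^sub>v v) = v" if "v \<in> carrier_vec n" for v
    using assoc_mult_mat_vec[OF H G that] assoc_mult_mat_vec[OF G H that] inv that by simp_all
  have "(\<lambda>v. G *\<^sub>v v) \<in> LinearCombinations.module_hom class_ring N N"
    unfolding LinearCombinations.module_hom_def ND(2,3)
    using Gc smult mult_add_distrib_mat_vec[OF G] by auto
  moreover have "bij_betw (\<lambda>v. G *\<^sub>v v) (carrier N) (carrier N)"
    unfolding ND(2) by (rule bij_betw_byWitness[where f' = "\<lambda>v. H *\<^sub>v v"]) (auto simp: HG GH Gc Hc)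
  ultimately show ?thesis by (simp add: module_aut_def)
qed

text \<open>Keep the middle term and replace the two maps by \<open>incl \<circ> g\<inverse>\<close> and \<open>g \<circ> proj\<close>. A witness is needed
  since the matrix of an empty class would be unspecified.\<close>

lemma ext_act_nonempty:
  assumes g: "g \<in> module_aut class_ring N" and X: "X \<in> \<xi>" "is_extension class_ring N N X"
  shows "ext_act class_ring N g \<xi> \<noteq> {}"
proof -
  obtain G H where G: "G \<in> carrier_mat n n" and H: "H \<in> carrier_mat n n" and inv: "G * H = 1\<^sub>m n" "H * G = 1\<^sub>m n"
    and comm: "G * A = A * G" and gG: "\<And>v. v \<in> carrier_vec n \<Longrightarrow> g v = G *\<^sub>v v"
    by (rule module_aut_matrix[OF g]) blast
  interpret X: module_extension class_ring N N X by (rule module_extension.intro[OF X(2)])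
  have "A * H = H * A" by (rule commute_with_inverse_mat[OF G H A inv comm])
  then have h: "(\<lambda>v. H *\<^sub>v v) \<in> module_aut class_ring N"
    by (intro matrix_module_aut[OF H G inv(2,1)]) simp
  let ?h = "\<lambda>v. H *\<^sub>v v"
  note hom_g = g[unfolded module_aut_def, THEN CollectD, THEN conjunct1]
    and bij_g = g[unfolded module_aut_def, THEN CollectD, THEN conjunct2]
  note hom_h = h[unfolded module_aut_def, THEN CollectD, THEN conjunct1]
    and bij_h = h[unfolded module_aut_def, THEN CollectD, THEN conjunct2]
  let ?X' = "\<lparr>middle = middle X, incl = (\<lambda>a. incl X (?h a)), proj = (\<lambda>m. g (proj X m))\<rparr>"
  have hN: "?h a \<in> carrier N" if "a \<in> carrier N" for a
    using LinearCombinations.module_hom_closed[OF hom_h] that by auto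
  have hg: "?h (g a) = a" if "a \<in> carrier N" for a
    using that assoc_mult_mat_vec[OF H G, of a] inv by (simp add: gG ND(2))
  have g0: "g a = \<zero>\<^bsub>N\<^esub> \<longleftrightarrow> a = \<zero>\<^bsub>N\<^esub>" if a: "a \<in> carrier N" for a
  proof -
    have "G *\<^sub>v 0\<^sub>v n = 0\<^sub>v n" using G by (intro eq_vecI) auto
    then have "g \<zero>\<^bsub>N\<^esub> = \<zero>\<^bsub>N\<^esub>" using gG[of "0\<^sub>v n"] by (simp add: ND(4))
    then show ?thesis using hg[OF a] hg[of "\<zero>\<^bsub>N\<^esub>"] by auto
  qed
  have "is_extension class_ring N N ?X'"
    unfolding is_extension_def extension.simps
  proof (intro conjI)
    show "Module.module class_ring N" "Module.module class_ring N" by (rule module_N)+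
    show "Module.module class_ring (middle X)" ..
    show "(\<lambda>a. incl X (?h a)) \<in> LinearCombinations.module_hom class_ring N (middle X)"
      using hN LinearCombinations.module_hom_add[OF hom_h] LinearCombinations.module_hom_smult[OF hom_h]
      unfolding LinearCombinations.module_hom_def by auto
    show "(\<lambda>m. g (proj X m)) \<in> LinearCombinations.module_hom class_ring (middle X) N"
      using LinearCombinations.module_hom_closed[OF hom_g]
        LinearCombinations.module_hom_add[OF hom_g] LinearCombinations.module_hom_smult[OF hom_g]
      unfolding LinearCombinations.module_hom_def by auto
    have "inj_on (incl X \<circ> ?h) (carrier N)"
      using bij_h X.incl_eq_iff by (intro comp_inj_on) (auto simp: bij_betw_def inj_on_def)
    then show "inj_on (\<lambda>a. incl X (?h a)) (carrier N)" by (simp add: comp_def)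
    have surj: "proj X ` carrier (middle X) = carrier N" using X(2) by (simp add: is_extension_def)
    show "(\<lambda>m. g (proj X m)) ` carrier (middle X) = carrier N"
      using bij_g unfolding image_image[symmetric, of g "proj X"] surj by (simp add: bij_betw_def)
    have "(\<lambda>a. incl X (?h a)) ` carrier N = incl X ` carrier N"
      using bij_h unfolding image_image[symmetric, of "incl X" ?h] by (simp add: bij_betw_def)
    also have "\<dots> = {m \<in> carrier (middle X). g (proj X m) = \<zero>\<^bsub>N\<^esub>}"
      unfolding X.range_incl using g0 X.proj.f_im by auto
    finally show "(\<lambda>a. incl X (?h a)) ` carrier N = a_kernel (middle X) N (\<lambda>m. g (proj X m))"
      by (simp add: a_kernel_def')
  qed
  moreover have "(\<lambda>m. m) \<in> LinearCombinations.module_hom class_ring (middle X) (middle ?X')"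
    by (simp add: LinearCombinations.module_hom_def)
  ultimately have "?X' \<in> ext_act class_ring N g \<xi>"
    unfolding ext_act_def using X(1) hg by (intro CollectI conjI bexI[of _ X] bexI[of _ "\<lambda>m. m"]) auto
  then show ?thesis by blast
qed

text \<open>If \<open>\<phi>\<close> realises the action of \<open>g\<close> with matrix \<open>G\<close> and inverse \<open>H\<close>, then \<open>v \<mapsto> \<phi> (s (H v))\<close> is a
  section of the new extension, and its defect is the old one conjugated by \<open>G\<close>.\<close>

lemma ext_act_coordinates:
  assumes G: "G \<in> carrier_mat n n" and H: "H \<in> carrier_mat n n" and inv: "G * H = 1\<^sub>m n" "H * G = 1\<^sub>m n"
    and comm: "G * A = A * G" and gG: "\<And>v. v \<in> carrier_vec n \<Longrightarrow> g v = G *\<^sub>v v"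
    and D: "D \<in> carrier_mat n n"
    and \<xi>: "\<And>X. X \<in> \<xi> \<Longrightarrow> is_extension class_ring N N X \<and> (\<exists>s U. extension_coordinates id 0 A X s U D)"
    and X': "X' \<in> ext_act class_ring N g \<xi>"
  shows "is_extension class_ring N N X' \<and> (\<exists>s U. extension_coordinates id 0 A X' s U (G * D * H))"
proof -
  from X' have ext': "is_extension class_ring N N X'" by (simp add: ext_act_def)
  from X' obtain X where "X \<in> \<xi>" and ex: "\<exists>\<phi> \<in> LinearCombinations.module_hom class_ring (middle X) (middle X').
        (\<forall>a\<in>carrier N. \<phi> (incl X a) = incl X' (g a)) \<and>
        (\<forall>m\<in>carrier (middle X). proj X' (\<phi> m) = g (proj X m))"
    unfolding ext_act_def by auto
  from ex obtain \<phi> where \<phi>: "\<phi> \<in> LinearCombinations.module_hom class_ring (middle X) (middle X')"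
    and \<phi>_comm: "(\<forall>a\<in>carrier N. \<phi> (incl X a) = incl X' (g a)) \<and>
        (\<forall>m\<in>carrier (middle X). proj X' (\<phi> m) = g (proj X m))" by (rule bexE)
  have ext: "is_extension class_ring N N X" using \<xi>[OF \<open>X \<in> \<xi>\<close>] by (rule conjunct1)
  from \<xi>[OF \<open>X \<in> \<xi>\<close>] obtain s U where cX: "extension_coordinates id 0 A X s U D" by auto
  interpret companion_extension fs N n A X s U D
    by unfold_locales (rule ext, rule cX, rule D)
  interpret X': module_extension class_ring N N X' by (rule module_extension.intro[OF ext'])
  have \<phi>_incl: "\<phi> (incl X a) = incl X' (g a)" if "a \<in> carrier N" for a using \<phi>_comm that by simp
  have \<phi>_proj: "proj X' (\<phi> m) = g (proj X m)" if "m \<in> carrier (middle X)" for m using \<phi>_comm that by simp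
  have \<phi>c: "\<phi> m \<in> carrier (middle X')" if "m \<in> carrier (middle X)" for m
    using funcset_mem[OF LinearCombinations.module_hom_closed[OF \<phi>] that] .
  have \<phi>s: "\<phi> (p \<odot>\<^bsub>middle X\<^esub> m) = p \<odot>\<^bsub>middle X'\<^esub> \<phi> m" if "m \<in> carrier (middle X)" for p m
    using LinearCombinations.module_hom_smult[OF \<phi> _ that, of p] by simp
  note \<phi>a = LinearCombinations.module_hom_add[OF \<phi>]
  have AH: "A * H = H * A" by (rule commute_with_inverse_mat[OF G H A inv comm])
  have Hc: "H *\<^sub>v v \<in> carrier_vec n" if "v \<in> carrier_vec n" for v by (rule mult_mat_vec_carrier[OF H that])
  have GH: "G *\<^sub>v (H *\<^sub>v v) = v" if "v \<in> carrier_vec n" for v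
    using assoc_mult_mat_vec[OF G H that] inv that by simp
  define s' where "s' v = \<phi> (s (H *\<^sub>v v))" for v
  have lin: "coefficient_linear (middle X') n s'"
  proof (rule coefficient_linearI)
    note E = coefficient_linearD[OF coefficient_linear_comp_mat[OF co(1) H]]
    fix v w :: "'k vec" and r assume v: "v \<in> carrier_vec n" and w: "w \<in> carrier_vec n"
    show "s' v \<in> carrier (middle X')" unfolding s'_def by (rule \<phi>c[OF E(1)[OF v]])
    show "s' (r \<cdot>\<^sub>v v) = [:r:] \<odot>\<^bsub>middle X'\<^esub> s' v"
      unfolding s'_def E(2)[OF v] by (rule \<phi>s[OF E(1)[OF v]])
    show "s' (v + w) = s' v \<oplus>\<^bsub>middle X'\<^esub> s' w"
      unfolding s'_def E(3)[OF v w] by (rule \<phi>a[OF E(1)[OF v] E(1)[OF w]])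
  qed
  have dim: "dim_row A = n" using A by simp
  have "extension_coordinates id 0 A X' s' (0\<^sub>m n n) (G * D * H)"
    unfolding extension_coordinates_def dim
  proof (intro conjI ballI lin)
    fix v :: "'k vec" assume v: "v \<in> carrier_vec n"
    note Hv = Hc[OF v]
    have DHv: "D *\<^sub>v (H *\<^sub>v v) \<in> carrier_vec n" by (rule mult_mat_vec_carrier[OF D Hv])
    have AHv: "A *\<^sub>v (H *\<^sub>v v) \<in> carrier_vec n" by (rule mult_mat_vec_carrier[OF A Hv])
    show "proj X' (s' v) = map_vec id v"
      unfolding s'_def id_vec using \<phi>_proj[OF sD(1)[OF Hv]] co(2)[OF Hv] gG[OF Hv] GH[OF v] by (simp add: id_vec)
    have "monom 1 1 \<odot>\<^bsub>middle X'\<^esub> s' v = \<phi> (monom 1 1 \<odot>\<^bsub>middle X\<^esub> s (H *\<^sub>v v))"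
      unfolding s'_def by (rule \<phi>s[OF sD(1)[OF Hv], symmetric])
    also have "\<dots> = \<phi> (s (A *\<^sub>v (H *\<^sub>v v))) \<oplus>\<^bsub>middle X'\<^esub> \<phi> (incl X (D *\<^sub>v (H *\<^sub>v v)))"
      unfolding co(3)[OF Hv] id_vec by (rule \<phi>a[OF sD(1)[OF AHv] X.incl.f_im]) (use DHv ND(2) in simp)
    also have "\<phi> (incl X (D *\<^sub>v (H *\<^sub>v v))) = incl X' (G * D * H *\<^sub>v v)"
    proof -
      have GD: "G * D \<in> carrier_mat n n" using G D by simp
      have "g (D *\<^sub>v (H *\<^sub>v v)) = G * D * H *\<^sub>v v"
        unfolding gG[OF DHv] assoc_mult_mat_vec[OF GD H v] assoc_mult_mat_vec[OF G D Hv] by (rule refl)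
      then show ?thesis using \<phi>_incl[of "D *\<^sub>v (H *\<^sub>v v)"] DHv ND(2) by simp
    qed
    also have "A *\<^sub>v (H *\<^sub>v v) = H *\<^sub>v (A *\<^sub>v v)"
      using assoc_mult_mat_vec[OF A H v] assoc_mult_mat_vec[OF H A v] AH by simp
    finally show "monom 1 1 \<odot>\<^bsub>middle X'\<^esub> s' v = s' (A *\<^sub>v v) \<oplus>\<^bsub>middle X'\<^esub> incl X' (G * D * H *\<^sub>v map_vec id v)"
      unfolding id_vec s'_def .
    have "[:0:] \<odot>\<^bsub>middle X'\<^esub> s' v = \<zero>\<^bsub>middle X'\<^esub>"
      using X'.M.smult_l_null[OF coefficient_linearD(1)[OF lin v]] by simp
    moreover have "0\<^sub>m n n *\<^sub>v map_vec id v = \<zero>\<^bsub>N\<^esub>" unfolding ND(4) using v by (intro eq_vecI) auto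
    ultimately show "[:0:] \<odot>\<^bsub>middle X'\<^esub> s' v = incl X' (0\<^sub>m n n *\<^sub>v map_vec id v)"
      using X'.incl.f0_is_0 by simp
  qed
  with ext' show ?thesis by (intro conjI exI)
qed

end

section \<open>The matrix of an extension\<close>

context companion_extension
begin

text \<open>Adding \<open>V\<close> to the section changes the defect by the commutator \<open>[A, V]\<close>.\<close>

lemma change_section:
  assumes V: "V \<in> carrier_mat n n"
  shows "\<exists>s'. extension_coordinates id 0 A X s' (0\<^sub>m n n) (D + (A * V - V * A))"
proof -
  let ?M = "middle X"
  define s' where "s' v = s v \<oplus>\<^bsub>?M\<^esub> incl X (V *\<^sub>v map_vec id v)" for v
  have lin: "coefficient_linear ?M n s'" unfolding s'_def
    by (rule coefficient_linear_add[OF X.M.module_axioms co(1) coefficient_linear_reduction[OF matrix_N A V is_ext]])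
  have inclc: "incl X w \<in> carrier ?M" if "w \<in> carrier_vec n" for w
    using X.incl.f_im[of w] that ND(2) by simp
  have dim: "dim_row A = n" using A by simp
  have "extension_coordinates id 0 A X s' (0\<^sub>m n n) (D + (A * V - V * A))"
    unfolding extension_coordinates_def dim
  proof (intro conjI ballI lin)
    fix v :: "'k vec" assume v: "v \<in> carrier_vec n"
    have Vv: "V *\<^sub>v v \<in> carrier_vec n" and Av: "A *\<^sub>v v \<in> carrier_vec n" and Dv: "D *\<^sub>v v \<in> carrier_vec n"
      using mult_mat_vec_carrier[OF V v] mult_mat_vec_carrier[OF A v] mult_mat_vec_carrier[OF D v] by blast+
    have AVv: "A *\<^sub>v (V *\<^sub>v v) \<in> carrier_vec n" and VAv: "V *\<^sub>v (A *\<^sub>v v) \<in> carrier_vec n"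
      using mult_mat_vec_carrier[OF A Vv] mult_mat_vec_carrier[OF V Av] by blast+
    have "proj X (incl X (V *\<^sub>v v)) = 0\<^sub>v n" using X.proj_incl[of "V *\<^sub>v v"] Vv ND(2,4) by simp
    then have "proj X (s v \<oplus>\<^bsub>?M\<^esub> incl X (V *\<^sub>v v)) = v"
      using X.proj.f_add[OF sD(1)[OF v] inclc[OF Vv]] co(2)[OF v] v ND(3) unfolding id_vec by simp
    then show "proj X (s' v) = map_vec id v" unfolding s'_def id_vec .
    let ?E = "D + (A * V - V * A)"
    have E: "?E *\<^sub>v v = D *\<^sub>v v + (A *\<^sub>v (V *\<^sub>v v) - V *\<^sub>v (A *\<^sub>v v))"
      using D A V v by (simp add: add_mult_distrib_mat_vec[of _ n n] minus_mult_distrib_mat_vec[of _ n n]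
          mult_carrier_mat[of _ n n _ n] minus_carrier_mat assoc_mult_mat_vec[of _ n n _ n])
    have Ec: "?E *\<^sub>v v \<in> carrier_vec n" unfolding E using Dv AVv VAv by simp
    have "monom 1 1 \<odot>\<^bsub>?M\<^esub> s' v = monom 1 1 \<odot>\<^bsub>?M\<^esub> s v \<oplus>\<^bsub>?M\<^esub> monom 1 1 \<odot>\<^bsub>?M\<^esub> incl X (V *\<^sub>v v)"
      unfolding s'_def id_vec by (rule X.M.smult_r_distr[OF _ sD(1)[OF v] inclc[OF Vv]]) simp
    also have "monom 1 1 \<odot>\<^bsub>?M\<^esub> incl X (V *\<^sub>v v) = incl X (A *\<^sub>v (V *\<^sub>v v))"
      unfolding ND(6)[OF Vv, symmetric] by (rule X.incl.f_smult[symmetric]) (use Vv ND(2) in simp_all)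
    also have "monom 1 1 \<odot>\<^bsub>?M\<^esub> s v = s (A *\<^sub>v v) \<oplus>\<^bsub>?M\<^esub> incl X (D *\<^sub>v v)"
      using co(3)[OF v] unfolding id_vec .
    also have "s (A *\<^sub>v v) \<oplus>\<^bsub>?M\<^esub> incl X (D *\<^sub>v v) \<oplus>\<^bsub>?M\<^esub> incl X (A *\<^sub>v (V *\<^sub>v v))
        = s (A *\<^sub>v v) \<oplus>\<^bsub>?M\<^esub> incl X (D *\<^sub>v v + A *\<^sub>v (V *\<^sub>v v))"
      using X.M.a_assoc[OF sD(1)[OF Av] inclc[OF Dv] inclc[OF AVv]]
        X.incl.f_add[of "D *\<^sub>v v" "A *\<^sub>v (V *\<^sub>v v)"] Dv AVv ND(2,3) by simp
    also have "D *\<^sub>v v + A *\<^sub>v (V *\<^sub>v v) = V *\<^sub>v (A *\<^sub>v v) + ?E *\<^sub>v v"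
    proof -
      have "p + q = r + (p + (q - r))" if "p \<in> carrier_vec n" "q \<in> carrier_vec n" "r \<in> carrier_vec n"
        for p q r :: "'k vec" using that by (intro eq_vecI) auto
      from this[OF Dv AVv VAv] show ?thesis unfolding E .
    qed
    also have "s (A *\<^sub>v v) \<oplus>\<^bsub>?M\<^esub> incl X (V *\<^sub>v (A *\<^sub>v v) + ?E *\<^sub>v v)
        = s' (A *\<^sub>v v) \<oplus>\<^bsub>?M\<^esub> incl X (?E *\<^sub>v v)"
      unfolding s'_def id_vec
      using X.M.a_assoc[OF sD(1)[OF Av] inclc[OF VAv] inclc[OF Ec]]
        X.incl.f_add[of "V *\<^sub>v (A *\<^sub>v v)" "?E *\<^sub>v v"] VAv Ec ND(2,3) by simp
    finally show "monom 1 1 \<odot>\<^bsub>?M\<^esub> s' v = s' (A *\<^sub>v v) \<oplus>\<^bsub>?M\<^esub> incl X (?E *\<^sub>v map_vec id v)"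
      unfolding id_vec .
    have "[:0:] \<odot>\<^bsub>?M\<^esub> s' v = \<zero>\<^bsub>?M\<^esub>"
      using X.M.smult_l_null[OF coefficient_linearD(1)[OF lin v]] by simp
    moreover have "0\<^sub>m n n *\<^sub>v map_vec id v = \<zero>\<^bsub>N\<^esub>" unfolding ND(4) using v by (intro eq_vecI) auto
    ultimately show "[:0:] \<odot>\<^bsub>?M\<^esub> s' v = incl X (0\<^sub>m n n *\<^sub>v map_vec id v)"
      using X.incl.f0_is_0 by simp
  qed
  then show ?thesis by (rule exI[of _ s'])
qed

text \<open>Two lifts of a generator differ by an element \<open>x\<close> of the submodule, and \<open>f\<^sub>j x\<close> vanishes modulo every
  common divisor \<open>c\<close> of \<open>f\<^sub>i\<close> and \<open>f\<^sub>j\<close> in component \<open>i\<close>. So modulo \<open>c\<close> the relations do not depend on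
  the lift, and the section provides one.\<close>

lemma relation_coefficients:
  assumes j: "j < length fs" and ft: "ft \<in> carrier (middle X)" "proj X ft = generator j"
    and rel: "fs ! j \<odot>\<^bsub>middle X\<^esub> ft = (\<Oplus>\<^bsub>middle X\<^esub>i\<in>{..<length fs}. \<epsilon> i \<odot>\<^bsub>middle X\<^esub> incl X (generator i))"
    and i: "i < length fs" and c: "c dvd fs ! i" "c dvd fs ! j"
  shows "[\<epsilon> i = contract fs (D * hankel_blocks fs) i j] (mod c)"
proof -
  let ?M = "middle X"
  obtain \<delta> where \<delta>: "\<delta> \<in> carrier_vec n" "fs ! j \<odot>\<^bsub>?M\<^esub> s (generator j) = incl X \<delta>"
    and \<delta>_cong: "[block_poly fs i \<delta> = contract fs (D * hankel_blocks fs) i j] (mod fs ! i)"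
    by (rule smult_section_generator[OF j]) (use i in blast)
  obtain w where w: "w \<in> carrier_vec n"
    and sum_w: "(\<Oplus>\<^bsub>?M\<^esub>i\<in>{..<length fs}. \<epsilon> i \<odot>\<^bsub>?M\<^esub> incl X (generator i)) = incl X w"
    and w_cong: "[block_poly fs i w = \<epsilon> i] (mod fs ! i)"
    using finsum_generators[of "length fs" \<epsilon>] i by auto
  have sg: "s (generator j) \<in> carrier ?M" by (rule sD(1)[OF generator_closed])
  have "proj X ft = proj X (s (generator j))"
    using ft(2) co(2)[OF generator_closed] unfolding id_vec by simp
  then obtain x where x: "x \<in> carrier N" "ft = s (generator j) \<oplus>\<^bsub>?M\<^esub> incl X x"
    using X.ex_incl_diff[OF ft(1) sg] by auto
  have xv: "x \<in> carrier_vec n" using x(1) ND(2) by simp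
  have fx: "fs ! j \<odot>\<^bsub>N\<^esub> x \<in> carrier_vec n" by (rule smult_closed[OF xv])
  have "incl X w = fs ! j \<odot>\<^bsub>?M\<^esub> s (generator j) \<oplus>\<^bsub>?M\<^esub> fs ! j \<odot>\<^bsub>?M\<^esub> incl X x"
    unfolding sum_w[symmetric] rel[symmetric] x(2)
    by (rule X.M.smult_r_distr[OF _ sg X.incl.f_im[OF x(1)]]) simp
  also have "fs ! j \<odot>\<^bsub>?M\<^esub> incl X x = incl X (fs ! j \<odot>\<^bsub>N\<^esub> x)"
    by (rule X.incl.f_smult[OF _ x(1), symmetric]) simp
  also have "fs ! j \<odot>\<^bsub>?M\<^esub> s (generator j) = incl X \<delta>" by (rule \<delta>(2))
  also have "incl X \<delta> \<oplus>\<^bsub>?M\<^esub> incl X (fs ! j \<odot>\<^bsub>N\<^esub> x) = incl X (\<delta> + fs ! j \<odot>\<^bsub>N\<^esub> x)"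
    using X.incl.f_add[of \<delta> "fs ! j \<odot>\<^bsub>N\<^esub> x"] \<delta>(1) fx ND(2,3) by simp
  finally have "w = \<delta> + fs ! j \<odot>\<^bsub>N\<^esub> x"
    using X.incl_eq_iff[of w "\<delta> + fs ! j \<odot>\<^bsub>N\<^esub> x"] w \<delta>(1) fx ND(2) by simp
  then have "block_poly fs i w = block_poly fs i \<delta> + block_poly fs i (fs ! j \<odot>\<^bsub>N\<^esub> x)"
    using \<delta>(1) fx i by (simp add: block_poly_add n_def)
  moreover have x_cong: "[block_poly fs i (fs ! j \<odot>\<^bsub>N\<^esub> x) = 0] (mod c)"
  proof -
    have "[block_poly fs i (fs ! j \<odot>\<^bsub>N\<^esub> x) = fs ! j * block_poly fs i x] (mod c)"
      by (rule cong_dvd_modulus[OF block_poly_smult_cong[OF xv i] c(1)])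
    also have "[fs ! j * block_poly fs i x = 0] (mod c)" using c(2) by (simp add: cong_0_iff)
    finally show ?thesis .
  qed
  ultimately have "[block_poly fs i w = contract fs (D * hankel_blocks fs) i j + 0] (mod c)"
    using cong_add[OF cong_dvd_modulus[OF \<delta>_cong c(1)] x_cong] by simp
  with cong_dvd_modulus[OF w_cong c(1)] show ?thesis
    by (metis add.right_neutral cong_sym cong_trans)
qed

lemma ex_relation:
  assumes j: "j < length fs"
  shows "\<exists>ft \<epsilon>. ft \<in> carrier (middle X) \<and> proj X ft = generator j \<and>
    fs ! j \<odot>\<^bsub>middle X\<^esub> ft = (\<Oplus>\<^bsub>middle X\<^esub>i\<in>{..<length fs}. \<epsilon> i \<odot>\<^bsub>middle X\<^esub> incl X (generator i))"
proof -
  obtain \<delta> where \<delta>: "\<delta> \<in> carrier_vec n" "fs ! j \<odot>\<^bsub>middle X\<^esub> s (generator j) = incl X \<delta>"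
    by (rule smult_section_generator[OF j])
  obtain w where w: "w \<in> carrier_vec n"
    and sum_w: "(\<Oplus>\<^bsub>middle X\<^esub>i\<in>{..<length fs}. block_poly fs i \<delta> \<odot>\<^bsub>middle X\<^esub> incl X (generator i)) = incl X w"
    and w_cong: "\<And>i. i < length fs \<Longrightarrow> [block_poly fs i w = block_poly fs i \<delta>] (mod fs ! i)"
    using finsum_generators[of "length fs" "\<lambda>i. block_poly fs i \<delta>"] by auto
  have "w = \<delta>" by (rule vec_eqI_cong[OF w \<delta>(1) w_cong])
  with sum_w \<delta>(2) have "fs ! j \<odot>\<^bsub>middle X\<^esub> s (generator j)
      = (\<Oplus>\<^bsub>middle X\<^esub>i\<in>{..<length fs}. block_poly fs i \<delta> \<odot>\<^bsub>middle X\<^esub> incl X (generator i))" by simp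
  moreover have "proj X (s (generator j)) = generator j"
    using co(2)[OF generator_closed] unfolding id_vec .
  ultimately show ?thesis using sD(1)[OF generator_closed] by (intro exI conjI)
qed

end

lemma primary_mat_eq: "primary_mat f lams = companion_blocks (map (\<lambda>k. f ^ k) lams)"
  by (simp add: primary_mat_def blockwise_def comp_def)

lemma primary_mat_carrier:
  "primary_mat f lams \<in> carrier_mat (dim_row (primary_mat f lams)) (dim_row (primary_mat f lams))"
  using companion_blocks_carrier[of "map (\<lambda>k. f ^ k) lams"] by (auto simp: primary_mat_eq)

lemma module_of_matrix_M_A: "module_of_matrix id (primary_mat p lams) (M_A p lams)"
proof -
  have "comm_ring_hom (id :: 'a \<Rightarrow> 'a)" by unfold_locales auto
  moreover note simps = mat_module_simps[OF primary_mat_carrier[of p lams]]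
  have "[:r:] \<odot>\<^bsub>M_A p lams\<^esub> v = id r \<cdot>\<^sub>v v" "monom 1 1 \<odot>\<^bsub>M_A p lams\<^esub> v = primary_mat p lams *\<^sub>v v"
    if "v \<in> carrier_vec (dim_row (primary_mat p lams))" for r v
    unfolding M_A_def id_apply by (rule simps(4)[OF that], rule simps(5)[OF that])
  ultimately show ?thesis
    unfolding module_of_matrix_def using simps(1-3) primary_mat_carrier[of p lams]
    by (intro conjI ballI allI) (assumption | simp only: M_A_def)+
qed

lemma companion_module_M_A:
  fixes p :: "'k :: field poly"
  assumes "lead_coeff p = 1" "0 < degree p" "\<forall>k\<in>set lams. 1 \<le> k" "Module.module class_ring (M_A p lams)"
  shows "companion_module (map (\<lambda>k. p ^ k) lams) (M_A p lams) (dim_row (primary_mat p lams)) (primary_mat p lams)"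
proof (rule companion_module.intro)
  fix i assume "i < length (map (\<lambda>k. p ^ k) lams)"
  then have i: "i < length lams" by simp
  then have "1 \<le> lams ! i" using assms(3) by simp
  moreover have "p \<noteq> 0" using assms(1) by auto
  moreover have "lead_coeff (p ^ (lams ! i)) = 1" unfolding lead_coeff_power assms(1) by simp
  ultimately show "lead_coeff (map (\<lambda>k. p ^ k) lams ! i) = 1 \<and> 0 < degree (map (\<lambda>k. p ^ k) lams ! i)"
    using assms(1,2) i by (simp add: degree_power_eq)
next
  show "dim_row (primary_mat p lams) = block_offset (map (\<lambda>k. p ^ k) lams) (length (map (\<lambda>k. p ^ k) lams))"
    using companion_blocks_carrier[of "map (\<lambda>k. p ^ k) lams"] by (simp add: primary_mat_eq)
qed (use assms module_of_matrix_M_A in \<open>simp_all add: primary_mat_eq\<close>)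

text \<open>The matrix of the class is the matrix of contractions of \<open>D T\<close>: relations exist for the lifts given
  by the section, and all other choices give the same entries modulo \<open>p ^ min \<lambda>\<^sub>i \<lambda>\<^sub>j\<close>, a
  common divisor of \<open>p ^ \<lambda>\<^sub>i\<close> and \<open>p ^ \<lambda>\<^sub>j\<close>.\<close>

lemma ext_matrix_eq:
  fixes p :: "'k :: field poly" and \<xi> :: "('k poly, 'k vec, 'k vec) ext_class"
    and lams :: "nat list"
  defines "l \<equiv> length lams" and "A \<equiv> primary_mat p lams" and "fs \<equiv> map (\<lambda>k. p ^ k) lams"
  defines "n \<equiv> dim_row A"
  assumes p: "lead_coeff p = 1" "0 < degree p" and lams: "\<forall>k\<in>set lams. 1 \<le> k"
    and D: "D \<in> carrier_mat n n" and nonempty: "\<xi> \<noteq> {}"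
    and \<xi>: "\<And>X. X \<in> \<xi> \<Longrightarrow> is_extension class_ring (M_A p lams) (M_A p lams) X \<and>
      (\<exists>s U. extension_coordinates id 0 A X s U D)"
  shows "ext_matrix p lams \<xi> = mat l l (\<lambda>(i, j).
    contract fs (D * hankel_blocks fs) i j mod p ^ min (lams ! i) (lams ! j))"
proof -
  let ?N = "M_A p lams"
  obtain X0 where X0: "X0 \<in> \<xi>" using nonempty by blast
  have mod_N: "Module.module class_ring ?N" using \<xi>[OF X0] by (simp add: is_extension_def)
  have dim_n: "dim_row (primary_mat p lams) = n" by (simp add: n_def A_def)
  interpret companion_module fs ?N n A unfolding fs_def n_def A_def
    by (rule companion_module_M_A[OF p lams mod_N])
  have len: "length fs = l" by (simp add: fs_def l_def)
  have fs_nth: "p ^ (lams ! j) = fs ! j" if "j < l" for j using that by (simp add: fs_def l_def)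
  have gen: "gen_A p lams i = generator i" if "i < l" for i
  proof -
    have "(\<Sum>j<i. degree (p ^ (lams ! j))) = block_offset fs i"
      unfolding block_offset_def using that by (intro sum.cong refl) (simp add: fs_def l_def)
    then show ?thesis by (simp only: gen_A_def generator_def dim_n)
  qed
  have dvd: "p ^ min (lams ! i) (lams ! j) dvd fs ! i" "p ^ min (lams ! i) (lams ! j) dvd fs ! j"
    if "i < l" "j < l" for i j
    using that unfolding fs_nth[symmetric, OF that(1)] fs_nth[symmetric, OF that(2)]
    by (simp_all add: le_imp_power_dvd)
  have loc: "\<exists>s U. companion_extension fs ?N n A X s U D" if X: "X \<in> \<xi>" for X
  proof -
    from \<xi>[OF X] obtain s U where "is_extension class_ring ?N ?N X" "extension_coordinates id 0 A X s U D"
      by auto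
    then have "companion_extension fs ?N n A X s U D" using D by unfold_locales
    then show ?thesis by (intro exI)
  qed
  have sum_gen: "(\<Oplus>\<^bsub>middle X\<^esub>i\<in>{..<l}. \<epsilon> i \<odot>\<^bsub>middle X\<^esub> incl X (gen_A p lams i))
      = (\<Oplus>\<^bsub>middle X\<^esub>i\<in>{..<length fs}. \<epsilon> i \<odot>\<^bsub>middle X\<^esub> incl X (generator i))" if X: "X \<in> \<xi>" for X \<epsilon>
  proof -
    from loc[OF X] obtain s U where "companion_extension fs ?N n A X s U D" by auto
    then interpret E: companion_extension fs ?N n A X s U D .
    have "\<epsilon> i \<odot>\<^bsub>middle X\<^esub> incl X (generator i) \<in> carrier (middle X)" for i
      using E.X.M.smult_closed[of "\<epsilon> i" "incl X (generator i)"] E.X.incl.f_im[of "generator i"]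
        generator_closed ND(2) by simp
    then show ?thesis by (intro E.X.M.finsum_cong') (auto simp: len gen)
  qed
  let ?E = "mat l l (\<lambda>(i, j). contract fs (D * hankel_blocks fs) i j mod p ^ min (lams ! i) (lams ! j))"
  show ?thesis unfolding ext_matrix_def l_def[symmetric]
  proof (rule the_equality)
    from loc[OF X0] obtain s U where "companion_extension fs ?N n A X0 s U D" by auto
    then interpret E: companion_extension fs ?N n A X0 s U D .
    have "\<forall>j. \<exists>ft \<epsilon>. j < l \<longrightarrow> ft \<in> carrier (middle X0) \<and> proj X0 ft = generator j \<and>
        fs ! j \<odot>\<^bsub>middle X0\<^esub> ft = (\<Oplus>\<^bsub>middle X0\<^esub>i\<in>{..<length fs}. \<epsilon> i \<odot>\<^bsub>middle X0\<^esub> incl X0 (generator i))"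
      using E.ex_relation len by auto
    from choice[OF this] obtain ft where "\<forall>j. \<exists>\<epsilon>. j < l \<longrightarrow> ft j \<in> carrier (middle X0) \<and> proj X0 (ft j) = generator j \<and>
        fs ! j \<odot>\<^bsub>middle X0\<^esub> ft j = (\<Oplus>\<^bsub>middle X0\<^esub>i\<in>{..<length fs}. \<epsilon> i \<odot>\<^bsub>middle X0\<^esub> incl X0 (generator i))"
      by blast
    from choice[OF this] obtain \<epsilon> where rel: "\<And>j. j < l \<Longrightarrow> ft j \<in> carrier (middle X0) \<and> proj X0 (ft j) = generator j \<and>
        fs ! j \<odot>\<^bsub>middle X0\<^esub> ft j = (\<Oplus>\<^bsub>middle X0\<^esub>i\<in>{..<length fs}. \<epsilon> j i \<odot>\<^bsub>middle X0\<^esub> incl X0 (generator i))"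
      by blast
    have "?E = mat l l (\<lambda>(i, j). \<epsilon> j i mod p ^ min (lams ! i) (lams ! j))"
    proof (rule eq_matI)
      fix i j assume "i < dim_row (mat l l (\<lambda>(i, j). \<epsilon> j i mod p ^ min (lams ! i) (lams ! j)))"
        "j < dim_col (mat l l (\<lambda>(i, j). \<epsilon> j i mod p ^ min (lams ! i) (lams ! j)))"
      then have ij: "i < l" "j < l" by simp_all
      have "[\<epsilon> j i = contract fs (D * hankel_blocks fs) i j] (mod p ^ min (lams ! i) (lams ! j))"
        by (rule E.relation_coefficients[of j "ft j"]) (use rel[OF ij(2)] ij len dvd[OF ij] in simp_all)
      then show "?E $$ (i, j) = mat l l (\<lambda>(i, j). \<epsilon> j i mod p ^ min (lams ! i) (lams ! j)) $$ (i, j)"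
        using ij by (simp add: cong_def)
    qed simp_all
    then show "\<exists>X\<in>\<xi>. \<exists>ft \<epsilon>. (\<forall>j<l. ft j \<in> carrier (middle X) \<and> proj X (ft j) = gen_A p lams j \<and>
        p ^ (lams ! j) \<odot>\<^bsub>middle X\<^esub> ft j = (\<Oplus>\<^bsub>middle X\<^esub>i\<in>{..<l}. \<epsilon> i j \<odot>\<^bsub>middle X\<^esub> incl X (gen_A p lams i))) \<and>
        ?E = mat l l (\<lambda>(i, j). \<epsilon> i j mod p ^ min (lams ! i) (lams ! j))"
      using rel X0 by (intro bexI[of _ X0] exI[of _ ft] exI[of _ "\<lambda>i j. \<epsilon> j i"]) (simp_all add: sum_gen gen fs_nth)
  next
    fix E assume "\<exists>X\<in>\<xi>. \<exists>ft \<epsilon>. (\<forall>j<l. ft j \<in> carrier (middle X) \<and> proj X (ft j) = gen_A p lams j \<and>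
        p ^ (lams ! j) \<odot>\<^bsub>middle X\<^esub> ft j = (\<Oplus>\<^bsub>middle X\<^esub>i\<in>{..<l}. \<epsilon> i j \<odot>\<^bsub>middle X\<^esub> incl X (gen_A p lams i))) \<and>
        E = mat l l (\<lambda>(i, j). \<epsilon> i j mod p ^ min (lams ! i) (lams ! j))"
    then obtain X ft \<epsilon> where X: "X \<in> \<xi>" and rel: "\<And>j. j < l \<Longrightarrow> ft j \<in> carrier (middle X) \<and>
        proj X (ft j) = gen_A p lams j \<and>
        p ^ (lams ! j) \<odot>\<^bsub>middle X\<^esub> ft j = (\<Oplus>\<^bsub>middle X\<^esub>i\<in>{..<l}. \<epsilon> i j \<odot>\<^bsub>middle X\<^esub> incl X (gen_A p lams i))"
      and E: "E = mat l l (\<lambda>(i, j). \<epsilon> i j mod p ^ min (lams ! i) (lams ! j))"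
      by (elim bexE exE conjE) blast
    from loc[OF X] obtain s U where "companion_extension fs ?N n A X s U D" by auto
    then interpret E: companion_extension fs ?N n A X s U D .
    show "E = ?E" unfolding E
    proof (rule eq_matI)
      fix i j assume "i < dim_row ?E" "j < dim_col ?E"
      then have ij: "i < l" "j < l" by simp_all
      have "[\<epsilon> i j = contract fs (D * hankel_blocks fs) i j] (mod p ^ min (lams ! i) (lams ! j))"
        by (rule E.relation_coefficients[of j "ft j" "\<lambda>i. \<epsilon> i j"])
          (use rel[OF ij(2)] ij len dvd[OF ij] in \<open>simp_all add: gen fs_nth sum_gen[OF X]\<close>)
      then show "mat l l (\<lambda>(i, j). \<epsilon> i j mod p ^ min (lams ! i) (lams ! j)) $$ (i, j) = ?E $$ (i, j)"
        using ij by (simp add: cong_def)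
    qed simp_all
  qed
qed

section \<open>Local rings of length two\<close>

text \<open>In length two every proper nonzero ideal is maximal, hence equal to \<open>(\<pi>)\<close>. The kernel of \<open>red\<close> is a
  maximal ideal, so it is \<open>(\<pi>)\<close> too. If \<open>\<pi>\<^sup>2\<close> were nonzero, it would generate \<open>(\<pi>)\<close>, giving
  \<open>\<pi> (1 - x \<pi>) = 0\<close> with \<open>1 - x \<pi>\<close> a unit and so \<open>\<pi> = 0\<close>; but \<open>(\<pi>)\<close> is nonzero by the length.\<close>

lemma residue_map_if_length_two:
  fixes red :: "'r :: comm_ring_1 \<Rightarrow> 'k :: field" and \<pi> :: 'r
  assumes loc: "local_ring (class_ring :: 'r ring)" and len: "has_length (class_ring :: 'r ring) 2"
    and hom: "comm_ring_hom red" and surj: "surj red"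
    and max: "maximalideal (PIdl\<^bsub>class_ring\<^esub> \<pi>) class_ring"
  shows "residue_map red \<pi>"
proof -
  let ?R = "class_ring :: 'r ring"
  interpret comm_ring_hom red by (rule hom)
  have cring: "cring ?R" and ring: "ring ?R"
    by (rule class_cring.cring_axioms, rule class_ring.ring_axioms)
  define m where "m = {x. red x = 0}"
  have idealD: "0 \<in> J" "x \<in> J \<Longrightarrow> y \<in> J \<Longrightarrow> x + y \<in> J" "x \<in> J \<Longrightarrow> z * x \<in> J" if "ideal J ?R" for J x y z
    using that additive_subgroup.zero_closed[OF ideal.axioms(1)[OF that]]
      additive_subgroup.a_closed[OF ideal.axioms(1)[OF that], of x y] ideal.I_l_closed[OF that, of x z] by auto
  have one_ideal: "J = UNIV" if "ideal J ?R" "1 \<in> J" for J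
    using ideal.one_imp_carrier[OF that(1)] that(2) by simp
  have m_ideal: "ideal m ?R"
  proof (rule idealI)
    show "ring ?R" by (rule ring)
    show "subgroup m (add_monoid ?R)"
    proof (rule group.subgroupI[OF abelian_group.a_group[OF ring.is_abelian_group[OF ring]]])
      fix a assume "a \<in> m"
      moreover have "\<ominus>\<^bsub>?R\<^esub> a = - a" by (simp add: class_ring_simps)
      ultimately show "inv\<^bsub>add_monoid ?R\<^esub> a \<in> m" by (simp add: m_def hom_distribs a_inv_def)
    qed (auto simp: m_def hom_distribs intro: exI[of _ 0])
  qed (auto simp: m_def hom_distribs)
  have PIdl: "PIdl\<^bsub>?R\<^esub> a = {x * a |x. True}" for a by (simp add: cgenideal_def)
  have PIdl_ideal: "ideal (PIdl\<^bsub>?R\<^esub> a) ?R" for a by (rule cring.cgenideal_ideal[OF cring]) simp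
  have chain_bound: "\<not> ideal_chain ?R I 3" for I
    using len by (simp add: has_length_def numeral_3_eq_3 numeral_2_eq_2)
  have zero_ideal: "ideal {0} ?R" using ring.zeroideal[OF ring] by simp
  have univ_ideal: "ideal UNIV ?R" using ring.oneideal[OF ring] by simp
  have maximal: "maximalideal J ?R" if J: "ideal J ?R" "J \<noteq> {0}" "J \<noteq> UNIV" for J
  proof (rule maximalidealI[OF J(1)])
    show "carrier ?R \<noteq> J" using J(3) by auto
    fix J' assume J': "ideal J' ?R" "J \<subseteq> J'" "J' \<subseteq> carrier ?R"
    show "J' = J \<or> J' = carrier ?R"
    proof (rule ccontr)
      assume neg: "\<not> (J' = J \<or> J' = carrier ?R)"
      \<comment> \<open>A larger proper ideal would give a chain of length three.\<close>
      let ?I = "\<lambda>j::nat. if j = 0 then {0} else if j = 1 then J else if j = 2 then J' else UNIV"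
      have "ideal_chain ?R ?I 3" unfolding ideal_chain_def
      proof (intro conjI allI impI)
        fix j :: nat
        show "ideal (?I j) ?R" using J(1) J'(1) zero_ideal univ_ideal by simp
        assume "j < 3"
        then consider "j = 0" | "j = 1" | "j = 2" by linarith
        then show "?I j \<subset> ?I (Suc j)" using J J' neg idealD(1)[OF J(1)] by cases auto
      qed
      with chain_bound show False by blast
    qed
  qed
  have unique: "J = J'" if "maximalideal J ?R" "maximalideal J' ?R" for J J'
    using loc that unfolding local_ring_def by (elim conjE ex1E) metis
  have "1 \<notin> m" by (simp add: m_def)
  then have m_proper: "m \<noteq> UNIV" by blast
  obtain I where I: "ideal_chain ?R I 2" using len by (auto simp: has_length_def)
  have I1: "ideal (I 1) ?R" "I 0 \<subset> I 1" "I 1 \<subset> I 2" "ideal (I 0) ?R"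
    using I by (auto simp: ideal_chain_def numeral_2_eq_2)
  have "I 1 \<noteq> {0}" using I1(2) idealD(1)[OF I1(4)] by auto
  moreover have "I 1 \<noteq> UNIV" using I1(3) by auto
  ultimately have "maximalideal (I 1) ?R" using maximal I1(1) by blast
  then have "I 1 = PIdl\<^bsub>?R\<^esub> \<pi>" using unique max by blast
  with \<open>I 1 \<noteq> {0}\<close> have \<pi>_nz: "\<pi> \<noteq> 0" by (auto simp: PIdl)
  have only: "J = PIdl\<^bsub>?R\<^esub> \<pi>" if "ideal J ?R" "J \<noteq> {0}" "J \<noteq> UNIV" for J
    using unique[OF maximal[OF that] max] .
  have m_max: "maximalideal m ?R"
  proof (rule maximalidealI[OF m_ideal])
    show "carrier ?R \<noteq> m" using m_proper by auto
    fix J assume J: "ideal J ?R" "m \<subseteq> J" "J \<subseteq> carrier ?R"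
    show "J = m \<or> J = carrier ?R"
    proof (rule ccontr)
      assume neg: "\<not> (J = m \<or> J = carrier ?R)"
      then obtain x where x: "x \<in> J" "red x \<noteq> 0" using J(2) by (auto simp: m_def)
      obtain s where s: "red s = inverse (red x)" using surj by (metis surjD)
      have "1 - s * x \<in> m" using s x(2) by (simp add: m_def hom_distribs)
      then have "1 - s * x \<in> J" using J(2) by blast
      then have "(1 - s * x) + s * x \<in> J" using idealD(2,3)[OF J(1)] x(1) by blast
      then have "1 \<in> J" by simp
      then show False using one_ideal[OF J(1)] neg by simp
    qed
  qed
  have m_eq: "m = PIdl\<^bsub>?R\<^esub> \<pi>" by (rule unique[OF m_max max])
  have unit: "r dvd 1" if "red r \<noteq> 0" for r
  proof -
    have r: "r \<in> PIdl\<^bsub>?R\<^esub> r" by (auto simp: PIdl intro: exI[of _ 1])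
    have "PIdl\<^bsub>?R\<^esub> r = UNIV"
    proof (rule ccontr)
      assume "PIdl\<^bsub>?R\<^esub> r \<noteq> UNIV"
      moreover have "PIdl\<^bsub>?R\<^esub> r \<noteq> {0}" using r that by auto
      ultimately have "PIdl\<^bsub>?R\<^esub> r = m" using only PIdl_ideal m_eq by simp
      with r that show False by (simp add: m_def)
    qed
    then obtain x where "1 = x * r" unfolding PIdl by blast
    then have "1 = r * x" by (simp add: mult.commute)
    then show ?thesis by (rule dvdI)
  qed
  have "\<pi> \<in> PIdl\<^bsub>?R\<^esub> \<pi>" by (auto simp: PIdl intro: exI[of _ 1])
  then have red_\<pi>: "red \<pi> = 0" unfolding m_eq[symmetric] by (simp add: m_def)
  have \<pi>\<pi>: "\<pi> * \<pi> = 0"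
  proof (rule ccontr)
    assume nz: "\<pi> * \<pi> \<noteq> 0"
    have in_P: "\<pi> * \<pi> \<in> PIdl\<^bsub>?R\<^esub> (\<pi> * \<pi>)" by (auto simp: PIdl intro: exI[of _ 1])
    have "PIdl\<^bsub>?R\<^esub> (\<pi> * \<pi>) \<noteq> UNIV"
    proof
      assume "PIdl\<^bsub>?R\<^esub> (\<pi> * \<pi>) = UNIV"
      then obtain x where "1 = x * (\<pi> * \<pi>)" unfolding PIdl by blast
      then have "red 1 = red x * (red \<pi> * red \<pi>)" by (metis hom_mult)
      then show False by (simp add: red_\<pi>)
    qed
    then have "PIdl\<^bsub>?R\<^esub> (\<pi> * \<pi>) = PIdl\<^bsub>?R\<^esub> \<pi>" using only PIdl_ideal in_P nz by blast
    moreover have "\<pi> \<in> PIdl\<^bsub>?R\<^esub> \<pi>" by (auto simp: PIdl intro: exI[of _ 1])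
    ultimately obtain x where x: "\<pi> = x * (\<pi> * \<pi>)" unfolding PIdl by blast
    have "red (1 - x * \<pi>) \<noteq> 0" by (simp add: hom_distribs red_\<pi>)
    from unit[OF this] obtain u where u: "1 = (1 - x * \<pi>) * u" by (elim dvdE)
    have "\<pi> = \<pi> * ((1 - x * \<pi>) * u)" using u by simp
    also have "\<dots> = (\<pi> - x * (\<pi> * \<pi>)) * u" by (simp add: algebra_simps)
    finally show False using x \<pi>_nz by simp
  qed
  have red_iff: "red r = 0 \<longleftrightarrow> (\<exists>s. r = \<pi> * s)" for r
  proof -
    have "red r = 0 \<longleftrightarrow> r \<in> PIdl\<^bsub>?R\<^esub> \<pi>" unfolding m_eq[symmetric] by (simp add: m_def)
    then show ?thesis by (simp add: PIdl mult.commute)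
  qed
  have ann: "\<pi> * r = 0 \<longleftrightarrow> red r = 0" for r
  proof
    assume "red r = 0"
    then obtain s where "r = \<pi> * s" using red_iff by blast
    then show "\<pi> * r = 0" using \<pi>\<pi> by (simp add: mult.assoc[symmetric])
  next
    assume 0: "\<pi> * r = 0"
    show "red r = 0"
    proof (rule ccontr)
      assume "red r \<noteq> 0"
      from unit[OF this] obtain u where u: "1 = r * u" by (elim dvdE)
      have "\<pi> = (\<pi> * r) * u" using u by (simp add: mult.assoc)
      with 0 \<pi>_nz show False by simp
    qed
  qed
  show ?thesis using surj red_iff ann by unfold_locales
qed

text \<open>In a ring with zero divisors the degree of a product may drop, but not when the factors are monic.\<close>

lemma monic_power_comm_ring:
  fixes f :: "'a :: comm_ring_1 poly"
  assumes "lead_coeff f = 1"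
  shows "lead_coeff (f ^ k) = 1 \<and> degree (f ^ k) = k * degree f"
proof (induction k)
  case (Suc k)
  have "coeff (f * f ^ k) (degree f + degree (f ^ k)) = 1"
    unfolding coeff_mult_degree_sum assms conjunct1[OF Suc] by simp
  moreover from this have "degree (f * f ^ k) = degree f + degree (f ^ k)"
    by (intro antisym degree_mult_le le_degree) auto
  ultimately show ?case using Suc by simp
qed simp

section \<open>The matrices attached to an extension class\<close>

context residue_map
begin

lemma module_of_matrix_M_A_lifted:
  "module_of_matrix red (primary_mat p lams) (M_A_lifted red p lams)"
proof -
  note N = module_of_matrixD[OF module_of_matrix_M_A[of p lams] primary_mat_carrier]
  have smult: "h \<odot>\<^bsub>M_A_lifted red p lams\<^esub> v = map_poly red h \<odot>\<^bsub>M_A p lams\<^esub> v" for h v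
    by (simp add: M_A_lifted_def restrict_scalars_def)
  have C: "map_poly red [:r:] = [:red r:]" for r
    by (intro poly_eqI) (simp add: coeff_pCons split: nat.split)
  have t: "map_poly red (monom 1 1) = monom 1 1" by simp
  have "[:r:] \<odot>\<^bsub>M_A_lifted red p lams\<^esub> v = red r \<cdot>\<^sub>v v"
    "monom 1 1 \<odot>\<^bsub>M_A_lifted red p lams\<^esub> v = primary_mat p lams *\<^sub>v v"
    if "v \<in> carrier_vec (dim_row (primary_mat p lams))" for r v
    unfolding smult C t using N(5)[OF that, of "red r"] N(6)[OF that] by simp_all
  moreover have "carrier (M_A_lifted red p lams) = carrier (M_A p lams)"
    "add (M_A_lifted red p lams) = add (M_A p lams)" "zero (M_A_lifted red p lams) = zero (M_A p lams)"
    by (simp_all add: M_A_lifted_def restrict_scalars_def)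
  ultimately show ?thesis
    unfolding module_of_matrix_def using N(2-4) primary_mat_carrier[of p lams] comm_ring_hom_axioms
    by (intro conjI ballI allI) (assumption | simp only:)+
qed

text \<open>The identity is a section of \<open>R\<^sup>n\<close> with the action of \<open>A0\<close>. It commutes with \<open>t\<close>, and multiplication
  by \<open>\<pi>\<close> is the inclusion after reduction, whence \<open>U = 1\<close> and \<open>D = 0\<close>.\<close>

lemma xi_A0_coordinates:
  assumes A0: "A0 \<in> carrier_mat n n"
  shows "extension_coordinates red \<pi> A0
    \<lparr>middle = mat_module A0, incl = (\<lambda>x. \<pi> \<cdot>\<^sub>v map_vec (inv_into UNIV red) x), proj = map_vec red\<rparr>
    (\<lambda>v. v) (1\<^sub>m n) (0\<^sub>m n n)"
proof -
  have dim: "dim_row A0 = n" using A0 by simp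
  have sec: "red (inv_into UNIV red x) = x" for x by (rule surj_f_inv_f[OF surj_red])
  note simps = mat_module_simps[OF A0]
  show ?thesis unfolding extension_coordinates_def dim extension.simps
  proof (intro conjI ballI)
    show "coefficient_linear (mat_module A0) n (\<lambda>v. v)"
      by (rule coefficient_linearI) (simp_all add: simps)
    fix v :: "'r vec" assume v: "v \<in> carrier_vec n"
    show "map_vec red v = map_vec red v" by (rule refl)
    have rv: "map_vec red v \<in> carrier_vec n" using v by simp
    have zero: "\<pi> \<cdot>\<^sub>v map_vec (inv_into UNIV red) (0\<^sub>m n n *\<^sub>v map_vec red v) = 0\<^sub>v n"
    proof -
      have "0\<^sub>m n n *\<^sub>v map_vec red v = 0\<^sub>v n" using rv by (intro eq_vecI) auto
      then show ?thesis by (intro eq_vecI) (simp_all add: pi_mult_eq_0_iff sec)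
    qed
    have Av: "A0 *\<^sub>v v \<in> carrier_vec n" by (rule mult_mat_vec_carrier[OF A0 v])
    show "monom 1 1 \<odot>\<^bsub>mat_module A0\<^esub> v
        = A0 *\<^sub>v v \<oplus>\<^bsub>mat_module A0\<^esub> (\<pi> \<cdot>\<^sub>v map_vec (inv_into UNIV red) (0\<^sub>m n n *\<^sub>v map_vec red v))"
      unfolding zero simps(5)[OF v] simps(2) by (rule right_zero_vec[OF Av, symmetric])
    have "1\<^sub>m n *\<^sub>v map_vec red v = map_vec red v" by (rule one_mult_mat_vec[OF rv])
    then show "[:\<pi>:] \<odot>\<^bsub>mat_module A0\<^esub> v
        = \<pi> \<cdot>\<^sub>v map_vec (inv_into UNIV red) (1\<^sub>m n *\<^sub>v map_vec red v)"
      unfolding simps(4)[OF v] using v by (intro eq_vecI) (simp_all add: pi_mult_eq_iff sec)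
  qed
qed

text \<open>Restriction of \<open>\<xi>\<close> to \<open>R[t]\<close> has coordinates \<open>U = 0\<close> and \<open>D\<close>, the class of \<open>A0\<close> has \<open>U = 1\<close> and
  defect \<open>0\<close>; their Baer sum has \<open>U = 1\<close> and defect \<open>D\<close>, to which the computation in a lifted basis
  applies.\<close>

lemma A_xi_form:
  fixes p :: "'k poly" and P :: "'r poly" and lams :: "nat list"
  defines "A \<equiv> primary_mat p lams" and "A0 \<equiv> primary_mat P lams"
  defines "n \<equiv> dim_row A"
  assumes A0: "A0 \<in> carrier_mat n n" and red_A0: "map_mat red A0 = A" and D: "D \<in> carrier_mat n n"
    and \<xi>: "\<And>X. X \<in> \<xi> \<Longrightarrow> is_extension class_ring (M_A p lams) (M_A p lams) X \<and>
      (\<exists>s. extension_coordinates id 0 A X s (0\<^sub>m n n) D)"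
    and B: "B \<in> A_xi red \<pi> p P lams \<xi>"
  obtains K V where "K \<in> carrier_mat n n" "V \<in> carrier_mat n n"
    "B = A0 + \<pi> \<cdot>\<^sub>m K" "map_mat red K = D + (A * V - V * A)" "\<xi> \<noteq> {}"
proof -
  let ?L = "M_A_lifted red p lams" and ?N = "M_A p lams"
  have A: "A \<in> carrier_mat n n" unfolding A_def n_def by (rule primary_mat_carrier)
  have matL: "module_of_matrix red A ?L" unfolding A_def by (rule module_of_matrix_M_A_lifted)
  note LD = module_of_matrixD[OF matL A]
  have L: "?L = restrict_scalars (map_poly red) ?N" by (simp add: M_A_lifted_def)
  from B obtain X b where Bc: "B \<in> carrier_mat n n"
    and X: "X \<in> ext_add class_ring ?L ?L (ext_restrict class_ring (map_poly red) ?N ?N \<xi>) (xi_A0 red \<pi> p P lams)"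
    and b: "is_coeff_basis (middle X) n b" "\<forall>j<n. proj X (b j) = unit_vec n j"
      "\<forall>j<n. monom 1 1 \<odot>\<^bsub>middle X\<^esub> b j = (\<Oplus>\<^bsub>middle X\<^esub>i\<in>{..<n}. [:B $$ (i, j):] \<odot>\<^bsub>middle X\<^esub> b i)"
    unfolding A_xi_def Let_def A_def[symmetric] n_def[symmetric] by auto
  from X obtain X1 X2 where X1: "X1 \<in> ext_restrict class_ring (map_poly red) ?N ?N \<xi>"
    and X2: "X2 \<in> xi_A0 red \<pi> p P lams" and X12: "X \<in> ext_class_of class_ring ?L ?L (baer_sum ?L X1 X2)"
    unfolding ext_add_def by auto
  from X1 obtain X0 where X0: "X0 \<in> \<xi>"
    and X01: "X1 \<in> ext_class_of class_ring ?L ?L (restrict_extension (map_poly red) X0)"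
    unfolding ext_restrict_def L[symmetric] by auto
  have ext1: "is_extension class_ring ?L ?L X1" and eq1: "ext_equiv class_ring ?L (restrict_extension (map_poly red) X0) X1"
    using X01 by (simp_all add: ext_class_of_def)
  let ?E0 = "\<lparr>middle = mat_module A0, incl = (\<lambda>x. \<pi> \<cdot>\<^sub>v map_vec (inv_into UNIV red) x), proj = map_vec red\<rparr>"
  have ext2: "is_extension class_ring ?L ?L X2" and eq2: "ext_equiv class_ring ?L ?E0 X2"
    using X2 by (simp_all add: xi_A0_def ext_class_of_def A0_def)
  have ext: "is_extension class_ring ?L ?L X" and eq: "ext_equiv class_ring ?L (baer_sum ?L X1 X2) X"
    using X12 by (simp_all add: ext_class_of_def)
  have one: "1\<^sub>m n \<in> carrier_mat n n" and zero: "0\<^sub>m n n \<in> carrier_mat n n" by simp_all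
  from \<xi>[OF X0] obtain s0 where ext0: "is_extension class_ring ?N ?N X0"
    and s0: "extension_coordinates id 0 A X0 s0 (0\<^sub>m n n) D" by auto
  have c1: "extension_coordinates red \<pi> A0 (restrict_extension (map_poly red) X0) (\<lambda>v. s0 (map_vec red v)) (0\<^sub>m n n) D"
    by (rule extension_coordinates_restrict[OF s0 A A0 red_A0])
  have "incl (restrict_extension (map_poly red) X0) a \<in> carrier (middle (restrict_extension (map_poly red) X0))"
    if "a \<in> carrier ?L" for a
  proof -
    interpret X0: module_extension class_ring ?N ?N X0 by (rule module_extension.intro[OF ext0])
    have "a \<in> carrier ?N" using that by (simp add: L restrict_scalars_def)
    then show ?thesis using X0.incl.f_im by (simp add: restrict_extension_def restrict_scalars_def)
  qed
  then obtain s1 where s1: "extension_coordinates red \<pi> A0 X1 s1 (0\<^sub>m n n) D"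
    using extension_coordinates_transport[OF c1 A0 D zero LD(2) _ eq1] by blast
  have "incl ?E0 a \<in> carrier (middle ?E0)" if "a \<in> carrier ?L" for a
    using that mat_module_simps(1)[OF A0] LD(2) by simp
  then obtain s2 where s2: "extension_coordinates red \<pi> A0 X2 s2 (1\<^sub>m n) (0\<^sub>m n n)"
    using extension_coordinates_transport[OF xi_A0_coordinates[OF A0] A0 zero one LD(2) _ eq2] by blast
  obtain s3 where s3: "extension_coordinates red \<pi> A0 (baer_sum ?L X1 X2) s3 (0\<^sub>m n n + 1\<^sub>m n) (D + 0\<^sub>m n n)"
    using extension_coordinates_baer_sum(1)[OF LD(2,3) ext1 ext2 A0 zero one D zero s1 s2] by blast
  have simp_mats: "0\<^sub>m n n + 1\<^sub>m n = (1\<^sub>m n :: 'k mat)" "D + 0\<^sub>m n n = D" using D by simp_all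
  obtain s where s: "extension_coordinates red \<pi> A0 X s (1\<^sub>m n) D"
    using extension_coordinates_transport[OF s3[unfolded simp_mats] A0 D one LD(2) _ eq]
      extension_coordinates_baer_sum(2)[OF LD(2,3) ext1 ext2 A0 zero one D zero s1 s2] by blast
  obtain K V where "K \<in> carrier_mat n n" "V \<in> carrier_mat n n"
    "B = A0 + \<pi> \<cdot>\<^sub>m K" "map_mat red K = D + (A * V - V * A)"
    by (rule matrix_of_basis[OF matL A A0 red_A0 D ext s b(1) _ Bc]) (use b in auto)
  moreover have "\<xi> \<noteq> {}" using X0 by blast
  ultimately show thesis by (rule that)
qed

end

section \<open>Similarity to the transpose\<close>

text \<open>Congruence modulo \<open>p ^ min a b\<close> is equality modulo the ideal generated by \<open>p\<^sup>a\<close> and \<open>p\<^sup>b\<close>.\<close>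

lemma power_min_dvd_iff:
  fixes p :: "'a :: comm_ring_1"
  shows "p ^ min a b dvd x \<longleftrightarrow> (\<exists>u v. x = u * p ^ a + v * p ^ b)"
proof
  assume "p ^ min a b dvd x"
  then obtain w where w: "x = p ^ min a b * w" by (elim dvdE)
  show "\<exists>u v. x = u * p ^ a + v * p ^ b"
  proof (cases "a \<le> b")
    case True
    then have "x = w * p ^ a + 0 * p ^ b" using w by (simp add: mult.commute)
    then show ?thesis by blast
  next
    case False
    then have "x = 0 * p ^ a + w * p ^ b" using w by (simp add: mult.commute)
    then show ?thesis by blast
  qed
next
  assume "\<exists>u v. x = u * p ^ a + v * p ^ b"
  then show "p ^ min a b dvd x" by (auto intro!: dvd_add dvd_mult le_imp_power_dvd)
qed

theorem theorem7p1:
  fixes red :: "'r :: comm_ring_1 \<Rightarrow> 'k :: field"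
    and \<pi> :: 'r
    and p :: "'k poly"
    and P :: "'r poly"
    and lams :: "nat list"
    and \<xi> :: "('k poly, 'k vec, 'k vec) ext_class"
    and A\<^sub>\<xi> :: "'r mat"
  assumes "local_ring (class_ring :: 'r ring)"
    and "principal_ideal_ring (class_ring :: 'r ring)"
    and "has_length (class_ring :: 'r ring) 2"
    and "comm_ring_hom red" and "surj red"
    and "maximalideal (PIdl\<^bsub>class_ring\<^esub> \<pi>) class_ring"
    and "lead_coeff p = 1" and "irreducible p"
    and "lams \<noteq> []" and "sorted_wrt (\<ge>) lams" and "\<forall>k\<in>set lams. 1 \<le> k"
    and "lead_coeff P = 1" and "map_poly red P = p"
    and "\<xi> \<in> Ext1 class_ring (M_A p lams) (M_A p lams)"
    and "A\<^sub>\<xi> \<in> A_xi red \<pi> p P lams \<xi>"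
  shows "similar_mat A\<^sub>\<xi> (transpose_mat A\<^sub>\<xi>) \<longleftrightarrow>
    (\<exists>g \<in> G_A p lams.
       ext_matrix p lams (ext_act class_ring (M_A p lams) g \<xi>) =
       transpose_mat (ext_matrix p lams \<xi>))"
proof -
  interpret residue_map red \<pi> by (rule residue_map_if_length_two[OF assms(1,3-6)])
  note p_monic = assms(7) and lams = assms(11) and P_monic = assms(12)
  let ?N = "M_A p lams"
  define l where "l = length lams"
  define fs where "fs = map (\<lambda>k. P ^ k) lams"
  define gs where "gs = map (\<lambda>k. p ^ k) lams"
  define A where "A = primary_mat p lams"
  define A0 where "A0 = primary_mat P lams"
  define n where "n = dim_row A"
  have p_deg: "0 < degree p"
  proof (rule ccontr)
    assume "\<not> 0 < degree p"
    then have "degree p = 0" by simp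
    moreover have "p \<noteq> 0" using p_monic by auto
    ultimately have "p dvd 1" using is_unit_iff_degree by blast
    with assms(8) show False using irreducible_not_unit by blast
  qed
  have "degree P = degree p" using degree_map_poly_red[OF P_monic] assms(13) by simp
  then have P_deg: "0 < degree P" using p_deg by simp
  have fs: "lead_coeff f = 1 \<and> 0 < degree f" if "f \<in> set fs" for f
  proof -
    from that obtain k where k: "k \<in> set lams" "f = P ^ k" by (auto simp: fs_def)
    then have "0 < k" using lams by auto
    moreover have "lead_coeff (P ^ k) = 1" "degree (P ^ k) = k * degree P"
      using monic_power_comm_ring[OF P_monic, of k] by blast+
    ultimately show ?thesis unfolding k(2) using P_deg by (intro conjI) simp_all
  qed
  have monic: "\<And>f. f \<in> set fs \<Longrightarrow> lead_coeff f = 1" using fs by blast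
  have chain: "f dvd g \<or> g dvd f" if "f \<in> set fs" "g \<in> set fs" for f g
  proof -
    from that obtain a b where "f = P ^ a" "g = P ^ b" by (auto simp: fs_def)
    then show ?thesis by (cases "a \<le> b") (simp_all add: le_imp_power_dvd)
  qed
  have gs_red: "map (map_poly red) fs = gs"
    by (simp add: fs_def gs_def comp_def map_poly_hom.hom_power assms(13))
  have A_eq: "A = companion_blocks gs" and A0_eq: "A0 = companion_blocks fs"
    by (simp_all add: A_def A0_def primary_mat_eq fs_def gs_def)
  have len: "length gs = l" "length fs = l" by (simp_all add: gs_def fs_def l_def)
  have "block_offset fs (length fs) = block_offset gs (length gs)"
    using block_offset_red[of fs, OF monic, of "length fs"] unfolding gs_red len by simp
  also have "\<dots> = n" using companion_blocks_carrier[of gs] by (simp add: n_def A_eq)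
  finally have n_fs: "block_offset fs (length fs) = n" .
  have red_A0: "map_mat red A0 = A"
    unfolding A_eq A0_eq gs_red[symmetric] using monic by (rule companion_blocks_red)
  have A0: "A0 \<in> carrier_mat n n" unfolding A0_eq n_fs[symmetric] by (rule companion_blocks_carrier)
  have A: "A \<in> carrier_mat n n" using A0 red_A0 by auto
  have matN: "module_of_matrix id A ?N" unfolding A_def by (rule module_of_matrix_M_A)

  from assms(14) obtain X0 :: "('k poly, 'k vec, 'k vec \<times> 'k vec, 'k vec) extension"
    where ext0: "is_extension class_ring ?N ?N X0" and \<xi>_eq: "\<xi> = ext_class_of class_ring ?N ?N X0"
    unfolding Ext1_def by auto
  interpret X0: module_extension class_ring ?N ?N X0 by (rule module_extension.intro[OF ext0])
  have modN: "Module.module class_ring ?N" ..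
  interpret C: companion_module gs ?N n A
    unfolding gs_def n_def A_def by (rule companion_module_M_A[OF p_monic p_deg lams modN])
  \<comment> \<open>\<open>D\<close> represents \<open>\<xi>\<close>; the same matrix serves for every extension in the class.\<close>
  obtain s0 D where D: "D \<in> carrier_mat n n" and s0: "extension_coordinates id 0 A X0 s0 (0\<^sub>m n n) D"
    using ex_extension_coordinates[OF matN A ext0] by auto
  have \<xi>: "is_extension class_ring ?N ?N X \<and> (\<exists>s. extension_coordinates id 0 A X s (0\<^sub>m n n) D)"
    if "X \<in> \<xi>" for X
  proof -
    have "is_extension class_ring ?N ?N X" "ext_equiv class_ring ?N X0 X"
      using that by (simp_all add: \<xi>_eq ext_class_of_def)
    moreover have "(0\<^sub>m n n :: 'k mat) \<in> carrier_mat n n" by simp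
    ultimately show ?thesis
      using extension_coordinates_transport[OF s0 A D _ C.ND(2) X0.incl.f_im] by blast
  qed
  note form = A_xi_form[OF A0[unfolded n_def A_def A0_def] red_A0[unfolded A_def A0_def]
      D[unfolded n_def A_def] \<xi>[unfolded n_def A_def] assms(15), folded A_def A0_def, folded n_def]
  obtain K V where K: "K \<in> carrier_mat n n" and V: "V \<in> carrier_mat n n" and B: "A\<^sub>\<xi> = A0 + \<pi> \<cdot>\<^sub>m K"
    and red_K: "map_mat red K = D + (A * V - V * A)" and nonempty: "\<xi> \<noteq> {}"
    by (rule form)
  \<comment> \<open>The reduction of \<open>K\<close> differs from \<open>D\<close> by a commutator, so it represents \<open>\<xi>\<close> as well and can be used on both sides.\<close>
  let ?D = "map_mat red K"
  have D': "?D \<in> carrier_mat n n" using K by simp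
  have \<xi>': "is_extension class_ring ?N ?N X \<and> (\<exists>s U. extension_coordinates id 0 A X s U ?D)"
    if X: "X \<in> \<xi>" for X
  proof -
    from \<xi>[OF X] obtain s where ext: "is_extension class_ring ?N ?N X"
      and s: "extension_coordinates id 0 A X s (0\<^sub>m n n) D" by auto
    interpret E: companion_extension gs ?N n A X s "0\<^sub>m n n" D
      by unfold_locales (rule ext, rule s, rule D)
    from E.change_section[OF V] ext show ?thesis unfolding red_K by (intro conjI) auto
  qed
  let ?T = "hankel_blocks gs"
  have E: "ext_matrix p lams \<xi> = mat l l (\<lambda>(i, j). contract gs (?D * ?T) i j mod p ^ min (lams ! i) (lams ! j))"
    unfolding l_def gs_def
    by (rule ext_matrix_eq[OF p_monic p_deg lams D'[unfolded n_def A_def] nonempty \<xi>'[unfolded A_def]])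
  have E_act: "ext_matrix p lams (ext_act class_ring ?N g \<xi>) = transpose_mat (ext_matrix p lams \<xi>) \<longleftrightarrow>
      (\<forall>i<length gs. \<forall>j<length gs. \<exists>u v. contract gs (G * ?D * H * ?T) i j - contract gs (?D * ?T) j i
         = u * gs ! i + v * gs ! j)"
    if g: "g \<in> module_aut class_ring ?N" and G: "G \<in> carrier_mat n n" and H: "H \<in> carrier_mat n n"
      and inv: "G * H = 1\<^sub>m n" "H * G = 1\<^sub>m n" and comm: "G * A = A * G"
      and gG: "\<And>v. v \<in> carrier_vec n \<Longrightarrow> g v = G *\<^sub>v v" for g G H
  proof -
    have GDH: "G * ?D * H \<in> carrier_mat n n" using G D' H by simp
    have coords: "is_extension class_ring ?N ?N X' \<and> (\<exists>s U. extension_coordinates id 0 A X' s U (G * ?D * H))"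
      if "X' \<in> ext_act class_ring ?N g \<xi>" for X'
      by (rule C.ext_act_coordinates[OF G H inv comm gG D' \<xi>' that])
    obtain X where "X \<in> \<xi>" using nonempty by blast
    then have "ext_act class_ring ?N g \<xi> \<noteq> {}" using C.ext_act_nonempty[OF g] \<xi>' by blast
    then have "ext_matrix p lams (ext_act class_ring ?N g \<xi>)
        = mat l l (\<lambda>(i, j). contract gs (G * ?D * H * ?T) i j mod p ^ min (lams ! i) (lams ! j))"
      unfolding l_def gs_def
      by (rule ext_matrix_eq[OF p_monic p_deg lams GDH[unfolded n_def A_def] _ coords[unfolded A_def]])
    then have "ext_matrix p lams (ext_act class_ring ?N g \<xi>) = transpose_mat (ext_matrix p lams \<xi>) \<longleftrightarrow>
        (\<forall>i<l. \<forall>j<l. contract gs (G * ?D * H * ?T) i j mod p ^ min (lams ! i) (lams ! j)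
           = contract gs (?D * ?T) j i mod p ^ min (lams ! i) (lams ! j))"
      unfolding E by (auto simp: mat_eq_iff min.commute)
    also have "\<dots> \<longleftrightarrow> (\<forall>i<length gs. \<forall>j<length gs. \<exists>u v.
        contract gs (G * ?D * H * ?T) i j - contract gs (?D * ?T) j i = u * gs ! i + v * gs ! j)"
      unfolding len(1) by (auto simp: mod_eq_dvd_iff power_min_dvd_iff gs_def l_def)
    finally show ?thesis .
  qed
  have "similar_mat A\<^sub>\<xi> (transpose_mat A\<^sub>\<xi>) \<longleftrightarrow>
    (\<exists>G\<in>carrier_mat n n. \<exists>H\<in>carrier_mat n n. G * H = 1\<^sub>m n \<and> H * G = 1\<^sub>m n \<and> G * A = A * G \<and>
       (\<forall>i<length gs. \<forall>j<length gs. \<exists>u v. contract gs (G * ?D * H * ?T) i j - contract gs (?D * ?T) j i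
         = u * gs ! i + v * gs ! j))"
    by (rule similar_transpose_iff[where fs = fs, unfolded n_fs gs_red, folded A0_eq A_eq])
      (rule fs chain K B; assumption?)+
  also have "\<dots> \<longleftrightarrow> (\<exists>g \<in> G_A p lams.
       ext_matrix p lams (ext_act class_ring ?N g \<xi>) = transpose_mat (ext_matrix p lams \<xi>))"
  proof
    assume "\<exists>G\<in>carrier_mat n n. \<exists>H\<in>carrier_mat n n. G * H = 1\<^sub>m n \<and> H * G = 1\<^sub>m n \<and> G * A = A * G \<and>
       (\<forall>i<length gs. \<forall>j<length gs. \<exists>u v. contract gs (G * ?D * H * ?T) i j - contract gs (?D * ?T) j i
         = u * gs ! i + v * gs ! j)"
    then obtain G H where GH: "G \<in> carrier_mat n n" "H \<in> carrier_mat n n"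
        "G * H = 1\<^sub>m n" "H * G = 1\<^sub>m n" "G * A = A * G"
      and eq: "\<forall>i<length gs. \<forall>j<length gs. \<exists>u v. contract gs (G * ?D * H * ?T) i j - contract gs (?D * ?T) j i
         = u * gs ! i + v * gs ! j" by auto
    have g: "(\<lambda>v. G *\<^sub>v v) \<in> module_aut class_ring ?N" by (rule C.matrix_module_aut[OF GH])
    have E_g: "ext_matrix p lams (ext_act class_ring ?N (\<lambda>v. G *\<^sub>v v) \<xi>) = transpose_mat (ext_matrix p lams \<xi>)"
      by (rule iffD2[OF E_act[OF g GH refl] eq])
    show "\<exists>g \<in> G_A p lams. ext_matrix p lams (ext_act class_ring ?N g \<xi>) = transpose_mat (ext_matrix p lams \<xi>)"
      unfolding G_A_def by (rule bexI) (rule E_g, rule g)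
  next
    assume "\<exists>g \<in> G_A p lams. ext_matrix p lams (ext_act class_ring ?N g \<xi>) = transpose_mat (ext_matrix p lams \<xi>)"
    then obtain g where g: "g \<in> module_aut class_ring ?N"
      and eq: "ext_matrix p lams (ext_act class_ring ?N g \<xi>) = transpose_mat (ext_matrix p lams \<xi>)"
      unfolding G_A_def by auto
    obtain G H where GH: "G \<in> carrier_mat n n" "H \<in> carrier_mat n n"
        "G * H = 1\<^sub>m n" "H * G = 1\<^sub>m n" "G * A = A * G" "\<And>v. v \<in> carrier_vec n \<Longrightarrow> g v = G *\<^sub>v v"
      by (rule C.module_aut_matrix[OF g]) blast
    from iffD1[OF E_act[OF g GH] eq] GH(1-5)
    show "\<exists>G\<in>carrier_mat n n. \<exists>H\<in>carrier_mat n n. G * H = 1\<^sub>m n \<and> H * G = 1\<^sub>m n \<and> G * A = A * G \<and>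
       (\<forall>i<length gs. \<forall>j<length gs. \<exists>u v. contract gs (G * ?D * H * ?T) i j - contract gs (?D * ?T) j i
         = u * gs ! i + v * gs ! j)" by (intro bexI conjI)
  qed
  finally show ?thesis .
qed

end
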